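(* Let $K\in C^{0,\alpha}(\mathbb{R}^2)$ satisfy $K(x)\le K(y)$ whenever $|x|\ge|y|$. If $K$ is unbounded below, assume in addition one of: (1) there exists $C>0$ such that $|K(x)|\le C\inf_{y\in B_1(x)}|K(y)|$ for all sufficiently large $|x|$; or (2) there exist $P\ge1$, $C>0$ with $|K(x)|\le C|\ln|x||^P$ for all sufficiently large $|x|$. Let $u\in C^2(\mathbb{R}^2)$ solve $\Delta u+Ke^{2u}=0$, with $\int_{\mathbb{R}^2}|K|e^{2u}\,dx<\infty$ and $\sup_{y}\int_{B_R(y)}u^+\,dx<\infty$ for every $R>0$, and suppose $$\int_{\mathbb{R}^2}K(x)e^{2u(x)}\,dx>\kappa_*(K):=\pi\inf\Big\{q>0:\int_{\mathbb{R}^2}|K(x)|(1+|x|)^{-q}\,dx<\infty\Big\}.$$ Then there exists $x^*\in\mathbb{R}^2$ such that $u$ is radially symmetric about $x^*$ and decreasing away from it: $u(x)\le u(y)$ whenever $|x-x^*|\ge|y-x^*|$. Moreover, if $K$ is not constant then $x^*=0$ (if $K$ is constant, $x^*$ is not restricted).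
   Context: $B_R(y)$ is the open disk of radius $R$ centered at $y$; $u^+=\max\{u,0\}$. The metric $e^{2u}(dx_1^2+dx_2^2)$ then is radially symmetric and non-expansive about $x^*$. *)

theory Defs
  imports "HOL-Analysis.Analysis"
begin

definition C2 :: "(real^2 \<Rightarrow> real) \<Rightarrow> bool" where
  "C2 u \<longleftrightarrow> (\<exists>Du D2u.
      (\<forall>x. (u has_derivative Du x) (at x)) \<and>
      (\<forall>x v. ((\<lambda>y. Du y v) has_derivative D2u x v) (at x)) \<and>
      (\<forall>v w. continuous_on UNIV (\<lambda>x. D2u x v w)))"

definition laplacian :: "(real^2 \<Rightarrow> real) \<Rightarrow> real^2 \<Rightarrow> real" where
  "laplacian u x = (\<Sum>i\<in>UNIV. deriv (deriv (\<lambda>t. u (x + t *\<^sub>R axis i 1))) 0)"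

definition holder_loc :: "real \<Rightarrow> (real^2 \<Rightarrow> real) \<Rightarrow> bool" where
  "holder_loc \<alpha> K \<longleftrightarrow> (\<forall>R. \<exists>C. \<forall>x\<in>cball 0 R. \<forall>y\<in>cball 0 R.
      \<bar>K x - K y\<bar> \<le> C * dist x y powr \<alpha>)"

text \<open>kappa_*(K) = pi * inf{q>0 : integral of |K|(1+|x|)^(-q) finite}, in ereal
  (infinity if the set is empty).\<close>
definition kappa_star :: "(real^2 \<Rightarrow> real) \<Rightarrow> ereal" where
  "kappa_star K = ereal pi * Inf {ereal q | q. q > 0 \<and>
      integrable lborel (\<lambda>x. \<bar>K x\<bar> * (1 + norm x) powr (- q))}"

end

theory Submission
  imports Defs "HOL-Real_Asymp.Real_Asymp"
begin

text \<open>
  Write f for \<open>K e\<^sup>2\<^sup>u\<close> and \<open>\<kappa>\<close> for its integral. Green's formula on large disks, together with the uniform bound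
  on the local averages of \<open>u\<^sup>+\<close>, represents u as a constant plus the logarithmic potential of f, which gives
  \<open>u = - (\<kappa> / 2\<pi> + o(1)) ln |x|\<close>. Since K is radially monotone, the integrability behind \<open>\<kappa>\<^sub>* < \<kappa>\<close> turns into a
  pointwise bound for K, and f decays faster than \<open>|x|\<^sup>-\<^sup>2\<close>. The method of moving planes then applies: the
  decay excludes negative minima of the reflected difference near infinity, and Hopf's lemma excludes that
  the plane stops unless u is symmetric about it. If it stops before the origin then K is symmetric about a
  line not through the origin, hence constant; for constant K, two orthogonal symmetry lines determine the centre.
\<close>

section \<open>Polar coordinates in the plane\<close>

text \<open>Globally nothing bounds \<open>K\<close> or \<open>u\<close> from below at the outset,
  so every estimate is one-sided until late. Since \<open>K\<close> is largest at the origin, the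
  positive part of \<open>f\<close> is at most a constant times \<open>exp (2 * u)\<close>. This
  leads to \<open>u\<close> bounded above, then to \<open>f\<close> bounded above, and then only to
  the upper half of the logarithmic asymptotics. Together with \<open>|K|\<close> of order at most
  |x|^(q-2), that half already forces \<open>|f|\<close> to decay, because a mass above pi q puts
  the exponent q - 2 - mass/pi below -2. Decay bounds \<open>f\<close> from below, and the same
  potential estimate applied to \<open>-f\<close> gives the other half. The error in the asymptotics
  is o(ln |x|), so the difference between \<open>u\<close> and its mirror image is known only to be
  o(ln |x|). A bounded comparison function would not make the quotient vanish at infinity. The one
  used grows like ln |x|, and a slowly decaying power subtracted from it makes it a strict
  supersolution.\<close>

definition vec2 :: "real \<times> real \<Rightarrow> real^2" where "vec2 p = (\<chi> i. if i = 1 then fst p else snd p)"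

lemma vec2_nth [simp]: "vec2 p $ 1 = fst p" "vec2 p $ 2 = snd p"
  by (auto simp: vec2_def)

lemma vec2_eq_iff: "x = y \<longleftrightarrow> x $ 1 = y $ 1 \<and> x $ 2 = (y::real^2) $ 2"
  by (auto simp: vec_eq_iff forall_2)

lemma norm2: "norm (x::real^2) = sqrt ((x$1)\<^sup>2 + (x$2)\<^sup>2)"
  by (simp add: norm_vec_def L2_set_def sum_2)

lemma continuous_vec2 [continuous_intros]:
  "continuous_on S f \<Longrightarrow> continuous_on S g \<Longrightarrow> continuous_on S (\<lambda>x. vec2 (f x, g x))"
proof -
  assume f: "continuous_on S f" and g: "continuous_on S g"
  have "continuous_on S (\<lambda>x. vec2 (f x, g x) $ i)" for i
    using f g exhaust_2[of i] by auto
  then have "continuous_on S (\<lambda>x. \<chi> i. vec2 (f x, g x) $ i)"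
    by (intro continuous_on_vec_lambda)
  then show ?thesis by simp
qed

lemma measurable_vec2 [measurable]: "vec2 \<in> borel_measurable borel"
proof -
  have "continuous_on UNIV (\<lambda>p. vec2 (fst p, snd p))"
    by (intro continuous_vec2 continuous_on_fst continuous_on_snd continuous_on_id)
  then show ?thesis by (simp add: borel_measurable_continuous_onI)
qed

lemma measurable_vec_nth [measurable]: "(\<lambda>x::real^2. x $ i) \<in> borel_measurable borel"
  by (rule borel_measurable_continuous_onI) (rule continuous_on_component[OF continuous_on_id])

lemma Basis2: "(Basis::(real^2) set) = {axis 1 1, axis 2 1}"
  by (auto simp: Basis_vec_def UNIV_2)

lemma axis2_neq: "axis 1 (1::real) \<noteq> (axis 2 1 :: real^2)"
  by (simp add: axis_eq_axis)

text \<open>Fubini is available on pairs, the determinant form of the change of variables on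
  \<open>real^2\<close>; this identity carries measures from one type to the other.\<close>

lemma distr_vec2: "distr lborel borel vec2 = lborel"
proof (rule lborel_eqI[symmetric])
  fix l u :: "real^2" assume le: "\<And>b. b \<in> Basis \<Longrightarrow> l \<bullet> b \<le> u \<bullet> b"
  have eq: "vec2 -` box l u = box (l$1, l$2) (u$1, u$2)"
    by (auto simp: box_def Basis2 Basis_prod_def inner_axis)
  have "emeasure (distr lborel borel vec2) (box l u) = emeasure lborel (box (l$1, l$2) (u$1, u$2))"
    by (subst emeasure_distr) (auto simp: eq)
  also have "\<dots> = (\<Prod>b\<in>Basis. (u - l) \<bullet> b)"
    using le[of "axis 1 1"] le[of "axis 2 1"]
    by (subst emeasure_lborel_box)
       (auto simp: Basis2 axis2_neq Basis_prod_def inner_axis ennreal_mult mult.commute)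
  finally show "emeasure (distr lborel borel vec2) (box l u) = (\<Prod>b\<in>Basis. (u - l) \<bullet> b)" .
qed simp

definition circ :: "real \<Rightarrow> real^2" where "circ t = vec2 (cos t, sin t)"

lemma circ_nth [simp]: "circ t $ 1 = cos t" "circ t $ 2 = sin t"
  by (auto simp: circ_def)

lemma norm_circ [simp]: "norm (circ t) = 1"
  by (simp add: norm2)

lemma continuous_circ [continuous_intros]:
  fixes f :: "'a::t2_space \<Rightarrow> real"
  shows "continuous_on S f \<Longrightarrow> continuous_on S (\<lambda>x. circ (f x))"
  unfolding circ_def by (intro continuous_vec2 continuous_on_cos continuous_on_sin)

lemma measurable_circ [measurable]: "circ \<in> borel_measurable borel"
  by (rule borel_measurable_continuous_onI) (rule continuous_circ[OF continuous_on_id])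

lemma circ_polar:
  assumes "y $ 2 \<noteq> 0"
  obtains t where "0 < t" "t < 2 * pi" "y = norm y *\<^sub>R circ t"
proof -
  have n: "norm y > 0" using assms by auto
  have n2: "(norm y)\<^sup>2 = (y$1)\<^sup>2 + (y$2)\<^sup>2" by (simp add: norm2)
  have "(y$1 / norm y)\<^sup>2 + (y$2 / norm y)\<^sup>2 = ((y$1)\<^sup>2 + (y$2)\<^sup>2) / (norm y)\<^sup>2"
    by (simp add: power_divide add_divide_distrib)
  also have "\<dots> = 1" using n by (simp add: n2[symmetric])
  finally have "(y$1 / norm y)\<^sup>2 + (y$2 / norm y)\<^sup>2 = 1" .
  then obtain t where t: "0 \<le> t" "t < 2 * pi" "y$1 / norm y = cos t" "y$2 / norm y = sin t"
    by (rule sincos_total_2pi)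
  have "t \<noteq> 0" using t(4) assms n by auto
  moreover have "y $ 1 = norm y * cos t" "y $ 2 = norm y * sin t"
    using n by (simp_all flip: t(3,4))
  ultimately show ?thesis using t(1,2)
    by (intro that[of t]) (auto simp: vec2_eq_iff)
qed

lemma circ_inj: assumes "0 \<le> s" "s < 2 * pi" "0 \<le> t" "t < 2 * pi" "circ s = circ t" shows "s = t"
proof -
  have "sin s = sin t \<and> cos s = cos t" using assms(5) by (simp add: vec2_eq_iff)
  then obtain n :: int where n: "s = t + 2 * pi * real_of_int n" using sin_cos_eq_iff by blast
  have "2 * pi * real_of_int n < 2 * pi * 1" using n assms by linarith
  then have "real_of_int n < 1" using pi_gt_zero by (subst (asm) mult_less_cancel_left_pos) auto
  moreover have "2 * pi * (-1) < 2 * pi * real_of_int n" using n assms by linarith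
  then have "-1 < real_of_int n" using pi_gt_zero by (subst (asm) mult_less_cancel_left_pos) auto
  ultimately have "n = 0" by linarith
  with n show ?thesis by simp
qed

text \<open>Radius and angle are packed into a vector, so that the change of variables with a
  Jacobian matrix applies.\<close>

definition polar_map :: "real^2 \<Rightarrow> real^2" where "polar_map x = (x$1) *\<^sub>R circ (x$2)"

text \<open>The open angular interval makes \<open>polar_map\<close> injective; the half-line that
  its image then misses is a null set.\<close>

definition polar_dom :: "(real^2) set" where "polar_dom = {x. 0 < x$1 \<and> 0 < x$2 \<and> x$2 < 2 * pi}"

lemma measurable_polar_map [measurable]: "polar_map \<in> borel_measurable borel"
  unfolding polar_map_def by measurable

lemma polar_dom_borel [measurable]: "polar_dom \<in> sets borel"
  unfolding polar_dom_def by measurable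

lemma polar_map_inj: "inj_on polar_map polar_dom"
proof (rule inj_onI)
  fix x y assume x: "x \<in> polar_dom" and y: "y \<in> polar_dom" and e: "polar_map x = polar_map y"
  have "norm (polar_map x) = x $ 1" "norm (polar_map y) = y $ 1" using x y by (auto simp: polar_map_def polar_dom_def)
  with e have 1: "x $ 1 = y $ 1" by simp
  with e have "circ (x$2) = circ (y$2)" using x y by (auto simp: polar_map_def polar_dom_def)
  then have "x $ 2 = y $ 2" using x y by (intro circ_inj) (auto simp: polar_dom_def)
  with 1 show "x = y" by (simp add: vec2_eq_iff)
qed

definition polar_der :: "real^2 \<Rightarrow> real^2 \<Rightarrow> real^2" where
  "polar_der x h = vec2 (h$1 * cos (x$2) - x$1 * sin (x$2) * h$2, h$1 * sin (x$2) + x$1 * cos (x$2) * h$2)"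

lemma has_derivative_vn: "((\<lambda>x. (x::real^2) $ i) has_derivative (\<lambda>h. h $ i)) (at x within S)"
  by (intro bounded_linear_imp_has_derivative bounded_linear_vec_nth)

lemma polar_map_der: "(polar_map has_derivative polar_der x) (at x within S)"
proof -
  have 1: "polar_map = (\<lambda>x. (x$1 * cos (x$2)) *\<^sub>R axis 1 1 + (x$1 * sin (x$2)) *\<^sub>R axis 2 1)"
    by (auto simp: fun_eq_iff vec2_eq_iff polar_map_def axis_def)
  show ?thesis unfolding 1
    apply (rule has_derivative_eq_rhs)
    apply (rule has_derivative_add[OF has_derivative_scaleR_left[OF has_derivative_mult[OF has_derivative_vn
       DERIV_compose_FDERIV[OF DERIV_cos has_derivative_vn]]]
       has_derivative_scaleR_left[OF has_derivative_mult[OF has_derivative_vn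
       DERIV_compose_FDERIV[OF DERIV_sin has_derivative_vn]]]])
    apply (auto simp: fun_eq_iff polar_der_def vec2_eq_iff axis_def algebra_simps)
    done
qed

lemma det_polar_der: "det (matrix (polar_der x)) = x$1"
proof -
  have "det (matrix (polar_der x)) = x$1 * (cos (x$2) * cos (x$2)) + x$1 * (sin (x$2) * sin (x$2))"
    unfolding det_2 matrix_def polar_der_def
    by (simp add: axis_def algebra_simps)
  also have "\<dots> = x$1 * ((cos (x$2))\<^sup>2 + (sin (x$2))\<^sup>2)" by (simp only: power2_eq_square distrib_left)
  finally show ?thesis by simp
qed

lemma negligible_axis: "negligible {y::real^2. y $ 2 = 0}"
  using negligible_standard_hyperplane[of "axis 2 1 :: real^2" 0] by (simp add: inner_axis Basis2)

text \<open>An identity of measures rather than of integrals, so that the polar formulas for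
  nonnegative and for Bochner integrals both follow. On a box it is the area formula for an
  injective map with Jacobian determinant r.\<close>

lemma polar_measure:
  "distr (density lborel (\<lambda>x. indicator polar_dom x * ennreal (x$1))) borel polar_map = (lborel :: (real^2) measure)"
proof (rule lborel_eqI[symmetric])
  fix l u :: "real^2" assume le: "\<And>b. b \<in> Basis \<Longrightarrow> l \<bullet> b \<le> u \<bullet> b"
  define S where "S = polar_dom \<inter> polar_map -` box l u"
  have S [measurable]: "S \<in> sets borel" unfolding S_def
    using measurable_sets[OF measurable_polar_map, of "box l u"] by auto
  have im: "polar_map ` S \<subseteq> box l u" by (auto simp: S_def)
  have diff: "box l u - polar_map ` S \<subseteq> {y. y $ 2 = 0}"
  proof (safe, rule ccontr)
    fix y assume y: "y \<in> box l u" "y \<notin> polar_map ` S" "y $ 2 \<noteq> 0"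
    from circ_polar[OF y(3)] obtain t where t: "0 < t" "t < 2 * pi" "y = norm y *\<^sub>R circ t" by blast
    have "vec2 (norm y, t) \<in> S" "polar_map (vec2 (norm y, t)) = y"
      using y(1,3) t by (auto simp: S_def polar_dom_def polar_map_def)
    with y show False by (metis imageI)
  qed
  have neg: "negligible ((box l u - polar_map ` S) \<union> (polar_map ` S - box l u))"
    using negligible_subset[OF negligible_axis diff] im by (simp add: Un_absorb1 subset_eq negligible_Un_eq Diff_eq_empty_iff[THEN iffD2, OF im])
  have m: "polar_map ` S \<in> lmeasurable" "measure lebesgue (polar_map ` S) = measure lebesgue (box l u)"
    using lmeasurable_negligible_symdiff[OF lmeasurable_box neg]
      measure_negligible_symdiff[OF lmeasurable_box neg] by auto
  have hi: "((\<lambda>x. \<bar>det (matrix (polar_der x))\<bar>) has_integral measure lebesgue (box l u)) S"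
    using has_measure_differentiable_image[of S polar_map polar_der "measure lebesgue (box l u)"] m S
    by (simp add: polar_map_der inj_on_subset[OF polar_map_inj] S_def)
  have hi2: "((\<lambda>x. x $ 1) has_integral measure lebesgue (box l u)) S"
    by (rule has_integral_eq[OF _ hi]) (auto simp: det_polar_der S_def polar_dom_def)
  have hi3: "((\<lambda>x. indicator S x * x $ 1) has_integral measure lebesgue (box l u)) UNIV"
  proof -
    have "(\<lambda>x. indicator S x * x $ 1) = (\<lambda>x::real^2. if x \<in> S then x $ 1 else 0)" by (auto simp: indicator_def)
    with hi2 show ?thesis by (simp only: has_integral_restrict_UNIV)
  qed
  have "emeasure (distr (density lborel (\<lambda>x. indicator polar_dom x * ennreal (x$1))) borel polar_map) (box l u)
      = (\<integral>\<^sup>+x. indicator polar_dom x * ennreal (x$1) * indicator (polar_map -` box l u) x \<partial>lborel)"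
    using measurable_sets[OF measurable_polar_map, of "box l u"]
    by (subst emeasure_distr) (auto simp: emeasure_density)
  also have "\<dots> = (\<integral>\<^sup>+x. ennreal (indicator S x * x $ 1) \<partial>lborel)"
    by (intro nn_integral_cong) (auto simp: S_def indicator_def)
  also have "\<dots> = ennreal (measure lebesgue (box l u))"
    by (rule nn_integral_has_integral_lborel[OF _ _ hi3]) (auto simp: S_def polar_dom_def indicator_def)
  also have "\<dots> = (\<Prod>b\<in>Basis. (u - l) \<bullet> b)"
    using le by (simp add: measure_completion measure_lborel_box_eq)
  finally show "emeasure (distr (density lborel (\<lambda>x. indicator polar_dom x * ennreal (x$1))) borel polar_map) (box l u) = (\<Prod>b\<in>Basis. (u - l) \<bullet> b)" .
qed simp

lemma lborel2_polar:
  "lborel = distr (density (lborel \<Otimes>\<^sub>M lborel) (\<lambda>x. ennreal (indicator {0<..} (fst x) * (indicator {0<..<2*pi} (snd x) * fst x))))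
      borel (\<lambda>x. x0 + fst x *\<^sub>R circ (snd x))"
proof -
  let ?d = "\<lambda>x::real^2. indicator polar_dom x * ennreal (x$1)"
  have d: "(\<lambda>x. ennreal (indicator {0<..} (fst x) * (indicator {0<..<2*pi} (snd x) * fst x))) = (\<lambda>x. ?d (vec2 x))"
    by (auto simp: fun_eq_iff indicator_def polar_dom_def)
  have "lborel = distr (distr (density (lborel :: (real^2) measure) ?d) borel polar_map) borel ((+) x0)"
    by (simp add: polar_measure lborel_distr_plus)
  also have "\<dots> = distr (density (lborel :: (real^2) measure) ?d) borel (\<lambda>x. x0 + polar_map x)"
    by (subst distr_distr) (auto simp: comp_def)
  also have "density (lborel :: (real^2) measure) ?d = distr (density lborel (\<lambda>x. ?d (vec2 x))) borel vec2"
    by (subst distr_vec2[symmetric], subst density_distr) auto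
  also have "distr \<dots> borel (\<lambda>x. x0 + polar_map x) = distr (density lborel (\<lambda>x. ?d (vec2 x))) borel (\<lambda>x. x0 + polar_map (vec2 x))"
    by (subst distr_distr) (auto simp: comp_def)
  also have "(\<lambda>x. x0 + polar_map (vec2 x)) = (\<lambda>x. x0 + fst x *\<^sub>R circ (snd x))"
    by (auto simp: polar_map_def)
  finally show ?thesis by (simp add: lborel_prod d)
qed

lemma nn_integral_polar:
  assumes [measurable]: "F \<in> borel_measurable borel"
  shows "(\<integral>\<^sup>+y. F y \<partial>lborel) =
    (\<integral>\<^sup>+r. (\<integral>\<^sup>+t. ennreal (indicator {0<..} r * (indicator {0<..<2*pi} t * r)) * F (x0 + r *\<^sub>R circ t) \<partial>lborel) \<partial>lborel)"
  apply (subst lborel2_polar[of x0])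
  apply (subst nn_integral_distr)
    apply simp
   apply simp
  apply (subst nn_integral_density)
    apply simp
   apply simp
  apply (subst lborel.nn_integral_fst[symmetric])
   apply simp
  apply simp
  done

lemma integral_polar:
  fixes F :: "real^2 \<Rightarrow> real"
  assumes F: "integrable lborel F"
  shows "(LINT y|lborel. F y) =
    (LINT r|lborel. (LINT t|lborel. indicator {0<..} r * (indicator {0<..<2*pi} t * r) * F (x0 + r *\<^sub>R circ t)))" (is ?th1)
    and "integrable lborel (\<lambda>r. LINT t|lborel. indicator {0<..} r * (indicator {0<..<2*pi} t * r) * F (x0 + r *\<^sub>R circ t))" (is ?th2)
proof -
  have [measurable]: "F \<in> borel_measurable borel" using borel_measurable_integrable[OF F] by simp
  let ?w = "\<lambda>x. indicator {0<..} (fst x) * (indicator {0<..<2*pi} (snd x) * fst x) :: real"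
  let ?G = "\<lambda>x. ?w x * F (x0 + fst x *\<^sub>R circ (snd x))"
  have nn: "AE x in lborel \<Otimes>\<^sub>M lborel. 0 \<le> ?w x"
    by (auto simp: indicator_def)
  have "integrable (distr (density (lborel \<Otimes>\<^sub>M lborel) (\<lambda>x. ennreal (?w x)))
      borel (\<lambda>x. x0 + fst x *\<^sub>R circ (snd x))) F"
    using F by (subst (asm) lborel2_polar[of x0])
  then have "integrable (density (lborel \<Otimes>\<^sub>M lborel) (\<lambda>x. ennreal (?w x))) (\<lambda>x. F (x0 + fst x *\<^sub>R circ (snd x)))"
    by (subst (asm) integrable_distr_eq) simp_all
  then have int: "integrable (lborel \<Otimes>\<^sub>M lborel) ?G"
    by (subst (asm) integrable_real_density[OF _ nn]) simp_all
  have "(LINT y|lborel. F y) = integral\<^sup>L (distr (density (lborel \<Otimes>\<^sub>M lborel) (\<lambda>x. ennreal (?w x)))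
      borel (\<lambda>x. x0 + fst x *\<^sub>R circ (snd x))) F"
    by (subst lborel2_polar[of x0]) (rule refl)
  also have "\<dots> = integral\<^sup>L (density (lborel \<Otimes>\<^sub>M lborel) (\<lambda>x. ennreal (?w x))) (\<lambda>x. F (x0 + fst x *\<^sub>R circ (snd x)))"
    by (subst integral_distr) simp_all
  also have "\<dots> = integral\<^sup>L (lborel \<Otimes>\<^sub>M lborel) ?G"
    by (subst integral_real_density[OF _ nn]) simp_all
  finally have "(LINT y|lborel. F y) = integral\<^sup>L (lborel \<Otimes>\<^sub>M lborel) ?G" .
  with lborel_pair.integral_fst'[OF int] lborel_pair.integrable_fst'[OF int] show ?th1 ?th2 by auto
qed

section \<open>Functions of class C2 on the plane\<close>

abbreviation e1 :: "real^2" where "e1 \<equiv> axis 1 1"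
abbreviation e2 :: "real^2" where "e2 \<equiv> axis 2 1"

definition perp :: "real^2 \<Rightarrow> real^2" where "perp v = vec2 (- (v$2), v$1)"

lemma perp_nth [simp]: "perp v $ 1 = - (v$2)" "perp v $ 2 = v$1"
  by (simp_all add: perp_def)

lemma vec2_expand: "(v::real^2) = v$1 *\<^sub>R e1 + v$2 *\<^sub>R e2"
  by (simp add: vec2_eq_iff axis_def)

lemma inner2: "(x::real^2) \<bullet> y = x$1 * y$1 + x$2 * y$2"
  by (simp add: inner_vec_def sum_2)

locale C2_plane =
  fixes u :: "real^2 \<Rightarrow> real" and Du :: "real^2 \<Rightarrow> real^2 \<Rightarrow> real"
    and D2u :: "real^2 \<Rightarrow> real^2 \<Rightarrow> real^2 \<Rightarrow> real"
  assumes der1: "(u has_derivative Du x) (at x)"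
    and der2: "((\<lambda>y. Du y v) has_derivative D2u x v) (at x)"
    and cont2: "continuous_on UNIV (\<lambda>x. D2u x v w)"
begin

lemma linear1: "linear (Du x)"
  using der1 has_derivative_linear by blast

lemma linear2: "linear (D2u x v)"
  using der2 has_derivative_linear by blast

lemma Du_expand: "Du x v = v$1 * Du x e1 + v$2 * Du x e2"
proof -
  have "Du x v = Du x (v$1 *\<^sub>R e1 + v$2 *\<^sub>R e2)" using vec2_expand[of v] by simp
  then show ?thesis by (simp add: linear_add[OF linear1] linear_scale[OF linear1])
qed

lemma D2u_expand2: "D2u x v w = w$1 * D2u x v e1 + w$2 * D2u x v e2"
proof -
  have "D2u x v w = D2u x v (w$1 *\<^sub>R e1 + w$2 *\<^sub>R e2)" using vec2_expand[of w] by simp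
  then show ?thesis by (simp add: linear_add[OF linear2] linear_scale[OF linear2])
qed

lemma D2u_expand1: "D2u x v w = v$1 * D2u x e1 w + v$2 * D2u x e2 w"
proof -
  have "((\<lambda>y. v$1 * Du y e1 + v$2 * Du y e2) has_derivative (\<lambda>w. v$1 * D2u x e1 w + v$2 * D2u x e2 w)) (at x)"
    by (intro has_derivative_add has_derivative_mult_right der2)
  then have "((\<lambda>y. Du y v) has_derivative (\<lambda>w. v$1 * D2u x e1 w + v$2 * D2u x e2 w)) (at x)"
    by (simp flip: Du_expand)
  from has_derivative_unique[OF der2 this] show ?thesis by (simp add: fun_eq_iff)
qed

lemma D2u_expand: "D2u x v w = v$1 * w$1 * D2u x e1 e1 + v$1 * w$2 * D2u x e1 e2
   + v$2 * w$1 * D2u x e2 e1 + v$2 * w$2 * D2u x e2 e2"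
  by (subst D2u_expand1, subst (1 2) D2u_expand2) (simp add: algebra_simps)

lemma cont_u: "continuous_on S u"
  by (intro continuous_at_imp_continuous_on ballI has_derivative_continuous[OF der1])

lemma cont_Du: "continuous_on S (\<lambda>x. Du x v)"
  by (intro continuous_at_imp_continuous_on ballI has_derivative_continuous[OF der2])

lemma continuous_u [continuous_intros]:
  "continuous_on S f \<Longrightarrow> continuous_on S (\<lambda>z. u (f z))"
  by (rule continuous_on_compose2[OF cont_u[of UNIV]]) auto

text \<open>Continuity in the point is known for each fixed direction; expanding in coordinates
  makes it joint. Differentiation under the circle integral needs this, since there the direction
  turns with the point.\<close>

lemma continuous_Du [continuous_intros]:
  "continuous_on S f \<Longrightarrow> continuous_on S g \<Longrightarrow> continuous_on S (\<lambda>z. Du (f z) (g z))"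
  by (subst Du_expand)
    (intro continuous_on_add continuous_on_mult continuous_on_component continuous_on_compose2[OF cont_Du[of UNIV]]; auto)

lemma continuous_D2u [continuous_intros]:
  "continuous_on S f \<Longrightarrow> continuous_on S g \<Longrightarrow> continuous_on S h \<Longrightarrow> continuous_on S (\<lambda>z. D2u (f z) (g z) (h z))"
  by (subst D2u_expand)
    (intro continuous_on_add continuous_on_mult continuous_on_component continuous_on_compose2[OF cont2]; auto)

lemma line_d1: "((\<lambda>t. u (x + t *\<^sub>R v)) has_real_derivative Du (x + t *\<^sub>R v) v) (at t)"
proof -
  have "((\<lambda>t. x + t *\<^sub>R v) has_derivative (\<lambda>s. s *\<^sub>R v)) (at t)"
    by (auto intro!: derivative_eq_intros)
  from has_derivative_compose[OF this der1] show ?thesis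
    by (simp add: has_field_derivative_def linear_scale[OF linear1] mult.commute[of _ "Du _ _"] cong: )
qed

lemma line_d2: "((\<lambda>t. Du (x + t *\<^sub>R v) w) has_real_derivative D2u (x + t *\<^sub>R v) w v) (at t)"
proof -
  have "((\<lambda>t. x + t *\<^sub>R v) has_derivative (\<lambda>s. s *\<^sub>R v)) (at t)"
    by (auto intro!: derivative_eq_intros)
  from has_derivative_compose[OF this der2] show ?thesis
    by (simp add: has_field_derivative_def linear_scale[OF linear2] mult.commute[of _ "D2u _ _ _"])
qed

lemma laplacian_eq: "laplacian u x = D2u x e1 e1 + D2u x e2 e2"
proof -
  have 1: "deriv (\<lambda>t. u (x + t *\<^sub>R v)) = (\<lambda>t. Du (x + t *\<^sub>R v) v)" for v
    using line_d1 by (auto intro!: DERIV_imp_deriv)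
  have 2: "deriv (\<lambda>t. Du (x + t *\<^sub>R v) v) 0 = D2u x v v" for v
    using line_d2[of x v v 0] by (auto intro!: DERIV_imp_deriv)
  show ?thesis unfolding laplacian_def 1 2 by (simp add: sum_2)
qed

text \<open>The trace in an orthonormal frame: the mixed terms of \<open>v\<close> and
  \<open>perp v\<close> cancel. The frame is radial and tangential on circles, normal and tangential
  for a line of reflection.\<close>

lemma laplacian_frame:
  assumes "norm v = 1"
  shows "laplacian u x = D2u x v v + D2u x (perp v) (perp v)"
proof -
  have *: "(v$1)\<^sup>2 + (v$2)\<^sup>2 = 1" using assms by (simp add: norm2)
  have "D2u x v v + D2u x (perp v) (perp v) = ((v$1)\<^sup>2 + (v$2)\<^sup>2) * (D2u x e1 e1 + D2u x e2 e2)"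
    by (subst (1 2) D2u_expand) (simp add: algebra_simps power2_eq_square)
  then show ?thesis by (simp add: * laplacian_eq)
qed

lemma cont_laplacian: "continuous_on S (laplacian u)"
proof -
  have "continuous_on S (\<lambda>x. D2u x e1 e1 + D2u x e2 e2)"
    by (intro continuous_on_add continuous_on_subset[OF cont2]) auto
  then show ?thesis by (simp add: laplacian_eq cong: continuous_on_cong)
qed

end

lemma C2_planeE:
  assumes "C2 u" obtains Du D2u where "C2_plane u Du D2u"
proof -
  from assms obtain Du D2u where
      "(\<forall>x. (u has_derivative Du x) (at x))"
      "(\<forall>x v. ((\<lambda>y. Du y v) has_derivative D2u x v) (at x))"
      "(\<forall>v w. continuous_on UNIV (\<lambda>x. D2u x v w))" unfolding C2_def by blast
  then show ?thesis by (intro that[of Du D2u]) (simp add: C2_plane_def)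
qed

section \<open>Green's formula on disks\<close>

text \<open>The Green function of the disk of radius R; at the pole \<open>s = 0\<close> the value is the junk \<open>ln 0 = 0\<close>.\<close>

definition ln_cut :: "real \<Rightarrow> real \<Rightarrow> real" where "ln_cut R s = max 0 (ln (R / s))"

lemma ln_cut_nonneg [simp]: "0 \<le> ln_cut R s" by (simp add: ln_cut_def)

lemma ln_cut_eq: "0 < s \<Longrightarrow> s \<le> R \<Longrightarrow> ln_cut R s = ln R - ln s"
  by (simp add: ln_cut_def ln_div)

lemma ln_cut_zero: "0 < R \<Longrightarrow> R \<le> s \<Longrightarrow> ln_cut R s = 0"
  by (simp add: ln_cut_def ln_div)

text \<open>The factor \<open>s\<close> is the polar weight, which tames the logarithmic pole; the
  bound comes from \<open>ln t \<le> t - 1\<close> at \<open>t = R / s\<close>.\<close>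

lemma ln_cut_mult_le: "0 < R \<Longrightarrow> 0 < s \<Longrightarrow> s * ln_cut R s \<le> R"
proof (cases "s \<le> R")
  case True
  assume *: "0 < R" "0 < s"
  have "ln (R / s) \<le> R / s - 1" using * by (intro ln_le_minus_one) simp
  then have "s * ln (R / s) \<le> s * (R / s - 1)" using * by (intro mult_left_mono) auto
  also have "\<dots> = R - s" using * by (simp add: field_simps)
  finally have "s * ln (R / s) \<le> R" using * by simp
  then show ?thesis using True * by (simp add: ln_cut_eq ln_div)
qed (simp add: ln_cut_zero)

lemma measurable_ln_cut [measurable]: "ln_cut R \<in> borel_measurable borel"
  unfolding ln_cut_def[abs_def] by measurable

text \<open>The integrand in polar coordinates is at most \<open>R\<close>, over a radius range of
  length \<open>R\<close> and an angle range of length 2 pi. The scaling with R^2 is what matters: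
  in the point-picking argument it cancels a density of order R^(-2) on a disk of radius R.\<close>

lemma ln_cut_integrable:
  fixes x :: "real^2"
  assumes R: "0 < R"
  shows "integrable lborel (\<lambda>y. ln_cut R (norm (y - x)))" (is ?th1)
    and "(LINT y|lborel. ln_cut R (norm (y - x))) \<le> 2 * pi * R\<^sup>2" (is ?th2)
proof -
  have "(\<integral>\<^sup>+y. ennreal (ln_cut R (norm (y - x))) \<partial>lborel) =
      (\<integral>\<^sup>+r. (\<integral>\<^sup>+t. ennreal (indicator {0<..} r * (indicator {0<..<2*pi} t * r)) * ennreal (ln_cut R (norm (x + r *\<^sub>R circ t - x))) \<partial>lborel) \<partial>lborel)"
    by (rule nn_integral_polar) simp
  also have "\<dots> \<le> (\<integral>\<^sup>+r. (\<integral>\<^sup>+t. ennreal R * indicator {0..R} r * indicator {0..2*pi} t \<partial>lborel) \<partial>lborel)"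
  proof (intro nn_integral_mono)
    fix r t :: real
    show "ennreal (indicator {0<..} r * (indicator {0<..<2*pi} t * r)) * ennreal (ln_cut R (norm (x + r *\<^sub>R circ t - x)))
       \<le> ennreal R * indicator {0..R} r * indicator {0..2*pi} t"
    proof (cases "0 < r \<and> r \<le> R \<and> 0 < t \<and> t < 2 * pi")
      case True
      then show ?thesis using ln_cut_mult_le[of R r] by (auto simp: ennreal_mult'[symmetric] intro!: ennreal_leI)
    next
      case False
      then show ?thesis using R by (auto simp: indicator_def ln_cut_zero)
    qed
  qed
  also have "\<dots> = ennreal (2 * pi * R\<^sup>2)"
    using R by (simp add: nn_integral_cmult nn_integral_multc ennreal_mult'[symmetric] power2_eq_square mult_ac)
  finally have le: "(\<integral>\<^sup>+y. ennreal (ln_cut R (norm (y - x))) \<partial>lborel) \<le> ennreal (2 * pi * R\<^sup>2)" .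
  show ?th1 using le
    by (intro integrableI_nonneg) (auto simp: le_less_trans[OF _ ennreal_less_top])
  then have "ennreal (LINT y|lborel. ln_cut R (norm (y - x))) \<le> ennreal (2 * pi * R\<^sup>2)"
    using le by (subst (asm) nn_integral_eq_integral) auto
  then show ?th2 by (simp add: ennreal_le_iff)
qed

lemma ln_cut_mult_integrable:
  fixes x :: "real^2"
  assumes R: "0 < R" and f [measurable]: "f \<in> borel_measurable borel"
    and M: "\<And>y. norm (y - x) < R \<Longrightarrow> \<bar>f y\<bar> \<le> M"
  shows "integrable lborel (\<lambda>y. ln_cut R (norm (y - x)) * f y)" (is ?th1)
    and "\<bar>LINT y|lborel. ln_cut R (norm (y - x)) * f y\<bar> \<le> 2 * pi * R\<^sup>2 * M" (is ?th2)
proof -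
  have M0: "0 \<le> M" using M[of x] R by simp
  have le: "\<bar>ln_cut R (norm (y - x)) * f y\<bar> \<le> ln_cut R (norm (y - x)) * M" for y
  proof (cases "norm (y - x) < R")
    case True then show ?thesis using M[OF True] by (simp add: abs_mult mult_left_mono)
  qed (use R in \<open>simp add: ln_cut_zero\<close>)
  show 1: ?th1
    by (rule Bochner_Integration.integrable_bound[of _ "\<lambda>y. ln_cut R (norm (y - x)) * M"])
      (use le M0 ln_cut_integrable(1)[OF R] in \<open>auto simp: abs_mult\<close>)
  have "\<bar>LINT y|lborel. ln_cut R (norm (y - x)) * f y\<bar> \<le> (LINT y|lborel. ln_cut R (norm (y - x)) * M)"
    by (rule order_trans[OF integral_abs_bound], rule integral_mono)
      (use 1 le ln_cut_integrable(1)[OF R] in auto)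
  also have "\<dots> \<le> 2 * pi * R\<^sup>2 * M"
    using ln_cut_integrable(2)[OF R, of x] M0 by (simp add: mult_right_mono)
  finally show ?th2 .
qed

lemma ln_cut_cont_integrable:
  fixes x :: "real^2" and f :: "real^2 \<Rightarrow> real"
  assumes R: "0 < R" and f: "continuous_on UNIV f"
  shows "integrable lborel (\<lambda>y. ln_cut R (norm (y - x)) * f y)"
proof -
  have "compact (f ` cball x R)" using f by (intro compact_continuous_image continuous_on_subset[OF f]) auto
  then have "bounded (f ` cball x R)" by (rule compact_imp_bounded)
  then obtain M where "\<forall>z\<in>f ` cball x R. norm z \<le> M" unfolding bounded_iff by blast
  then have M: "\<bar>f y\<bar> \<le> M" if "y \<in> cball x R" for y using that by simp
  show ?thesis
    by (rule ln_cut_mult_integrable(1)[OF R _ M])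
      (use f in \<open>auto intro: borel_measurable_continuous_onI simp: dist_norm norm_minus_commute\<close>)
qed

text \<open>Phrased as a Henstock integral over the whole line, so that uniqueness of the integral
  can match it with a value that the fundamental theorem of calculus supplies.\<close>

lemma integral_radial_polar:
  fixes x :: "real^2" and G :: "real^2 \<Rightarrow> real"
  assumes G: "continuous_on UNIV G" and int: "integrable lborel (\<lambda>y. w (norm (y - x)) * G y)"
  shows "((\<lambda>r. if 0 < r then w r * r * integral {0..2*pi} (\<lambda>t. G (x + r *\<^sub>R circ t)) else 0)
      has_integral (LINT y|lborel. w (norm (y - x)) * G y)) UNIV"
proof -
  have cont: "continuous_on {0..2*pi} (\<lambda>t. G (x + r *\<^sub>R circ t))" for r
    by (rule continuous_on_compose2[OF G]) (auto intro!: continuous_on_add continuous_on_scaleR continuous_circ continuous_on_const continuous_on_id)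
  have inner: "(LINT t|lborel. indicator {0<..} r * (indicator {0<..<2*pi} t * r) * (w (norm (x + r *\<^sub>R circ t - x)) * G (x + r *\<^sub>R circ t)))
     = (if 0 < r then w r * r * integral {0..2*pi} (\<lambda>t. G (x + r *\<^sub>R circ t)) else 0)" for r
  proof (cases "0 < r")
    case True
    have si: "set_integrable lborel {0..2*pi} (\<lambda>t. G (x + r *\<^sub>R circ t))"
      unfolding set_integrable_def by (rule borel_integrable_compact[OF _ cont]) auto
    then have si': "set_integrable lborel {0<..<2*pi} (\<lambda>t. G (x + r *\<^sub>R circ t))"
      by (rule set_integrable_subset) auto
    have "(LINT t|lborel. indicator {0<..} r * (indicator {0<..<2*pi} t * r) * (w (norm (x + r *\<^sub>R circ t - x)) * G (x + r *\<^sub>R circ t)))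
      = (LINT t|lborel. (w r * r) * (indicator {0<..<2*pi} t *\<^sub>R G (x + r *\<^sub>R circ t)))"
      using True by (intro Bochner_Integration.integral_cong) (auto simp: mult_ac)
    also have "\<dots> = w r * r * (LINT t:{0<..<2*pi}|lborel. G (x + r *\<^sub>R circ t))"
      by (simp add: set_lebesgue_integral_def)
    also have "(LINT t:{0<..<2*pi}|lborel. G (x + r *\<^sub>R circ t)) = integral {0<..<2*pi} (\<lambda>t. G (x + r *\<^sub>R circ t))"
      by (rule set_borel_integral_eq_integral(2)[OF si'])
    also have "\<dots> = integral {0..2*pi} (\<lambda>t. G (x + r *\<^sub>R circ t))"
      using integral_open_interval[of "0::real" "2*pi" "\<lambda>t. G (x + r *\<^sub>R circ t)"] by simp
    finally show ?thesis using True by simp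
  qed simp
  show ?thesis
    using has_integral_integral_lborel[OF integral_polar(2)[OF int, of x]] integral_polar(1)[OF int, of x]
    unfolding inner by simp
qed

lemma circ_deriv: "(circ has_vector_derivative perp (circ t)) (at t)"
proof -
  have 1: "circ = (\<lambda>t. cos t *\<^sub>R e1 + sin t *\<^sub>R e2)" by (auto simp: fun_eq_iff vec2_eq_iff axis_def)
  have "((\<lambda>t. cos t *\<^sub>R e1 + sin t *\<^sub>R e2) has_vector_derivative (- sin t) *\<^sub>R e1 + cos t *\<^sub>R e2) (at t)"
    by (auto intro!: derivative_eq_intros)
  moreover have "(- sin t) *\<^sub>R e1 + cos t *\<^sub>R e2 = perp (circ t)" by (simp add: vec2_eq_iff axis_def)
  ultimately show ?thesis using 1 by simp
qed

lemma tendsto_r_ln: "((\<lambda>s. (ln R - ln s) * s) \<longlongrightarrow> 0) (at_right (0::real))"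
  by real_asymp

section \<open>Circle integrals, radial flux and Green's formula\<close>

context C2_plane
begin

definition circle_int :: "real^2 \<Rightarrow> real \<Rightarrow> real" where
  "circle_int x r = integral {0..2*pi} (\<lambda>t. u (x + r *\<^sub>R circ t))"

definition circle_flux :: "real^2 \<Rightarrow> real \<Rightarrow> real" where
  "circle_flux x r = integral {0..2*pi} (\<lambda>t. Du (x + r *\<^sub>R circ t) (circ t))"

lemma circle_Du: "((\<lambda>t. Du (x + r *\<^sub>R circ t) v) has_real_derivative r * D2u (x + r *\<^sub>R circ t) v (perp (circ t))) (at t)"
proof -
  have "((\<lambda>t. x + r *\<^sub>R circ t) has_derivative (\<lambda>s. s *\<^sub>R (r *\<^sub>R perp (circ t)))) (at t)"
    using circ_deriv[of t] by (auto intro!: derivative_eq_intros simp: has_vector_derivative_def)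
  show ?thesis unfolding has_field_derivative_def
    by (rule has_derivative_eq_rhs[OF has_derivative_compose[OF \<open>((\<lambda>t. x + r *\<^sub>R circ t) has_derivative (\<lambda>s. s *\<^sub>R (r *\<^sub>R perp (circ t)))) (at t)\<close> der2[of v]]])
      (auto simp: fun_eq_iff linear_scale[OF linear2] mult_ac)
qed

text \<open>The integrand is the derivative in \<open>t\<close> of the tangential derivative of
  \<open>u\<close> along the circle, and that function is periodic.\<close>

lemma circle_tangential:
  "((\<lambda>t. r * D2u (x + r *\<^sub>R circ t) (perp (circ t)) (perp (circ t)) - Du (x + r *\<^sub>R circ t) (circ t)) has_integral 0) {0..2*pi}"
proof -
  let ?F = "\<lambda>t. - sin t * Du (x + r *\<^sub>R circ t) e1 + cos t * Du (x + r *\<^sub>R circ t) e2"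
  have "(?F has_real_derivative (r * D2u (x + r *\<^sub>R circ t) (perp (circ t)) (perp (circ t)) - Du (x + r *\<^sub>R circ t) (circ t))) (at t)" for t
    apply (rule DERIV_cong)
     apply (rule DERIV_add DERIV_mult DERIV_minus DERIV_sin DERIV_cos circle_Du)+
    apply (subst (3) D2u_expand1, subst Du_expand[of _ "circ t"])
    apply (simp add: algebra_simps)
    done
  then have "((\<lambda>t. r * D2u (x + r *\<^sub>R circ t) (perp (circ t)) (perp (circ t)) - Du (x + r *\<^sub>R circ t) (circ t)) has_integral ?F (2*pi) - ?F 0) {0..2*pi}"
    by (intro fundamental_theorem_of_calculus)
      (auto simp: has_real_derivative_iff_has_vector_derivative[symmetric] intro: DERIV_subset)
  moreover have "circ (2*pi) = circ 0" by (simp add: vec2_eq_iff)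
  ultimately show ?thesis by simp
qed

lemma circle_int_deriv: "(circle_int x has_real_derivative circle_flux x r) (at r)"
proof -
  have "((\<lambda>r. integral (cbox 0 (2*pi)) (\<lambda>t. u (x + r *\<^sub>R circ t))) has_real_derivative
     integral (cbox 0 (2*pi)) (\<lambda>t. Du (x + r *\<^sub>R circ t) (circ t))) (at r within UNIV)"
  proof (rule leibniz_rule_field_derivative)
    show "((\<lambda>x'. u (x + x' *\<^sub>R circ t)) has_real_derivative Du (x + s *\<^sub>R circ t) (circ t)) (at s within UNIV)" for s t
      using line_d1 by simp
    show "continuous_on (UNIV \<times> cbox 0 (2 * pi)) (\<lambda>(s, t). Du (x + s *\<^sub>R circ t) (circ t))"
      by (auto simp: split_beta intro!: continuous_intros)
  qed (auto intro!: integrable_continuous_real continuous_intros)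
  then show ?thesis by (simp add: circle_int_def[abs_def] circle_flux_def)
qed

text \<open>The divergence theorem, differentiated in the radius. \<open>circle_tangential\<close>
  trades the flux term for the tangential second derivative, which joins the radial one to form the
  Laplacian.\<close>

lemma circle_flux_deriv: "((\<lambda>r. r * circle_flux x r) has_real_derivative r * integral {0..2*pi} (\<lambda>t. laplacian u (x + r *\<^sub>R circ t))) (at r)"
proof -
  have *: "((\<lambda>r. integral (cbox 0 (2*pi)) (\<lambda>t. r * Du (x + r *\<^sub>R circ t) (circ t))) has_real_derivative
     integral (cbox 0 (2*pi)) (\<lambda>t. Du (x + r *\<^sub>R circ t) (circ t) + r * D2u (x + r *\<^sub>R circ t) (circ t) (circ t))) (at r within UNIV)"
  proof (rule leibniz_rule_field_derivative)
    show "((\<lambda>x'. x' * Du (x + x' *\<^sub>R circ t) (circ t)) has_real_derivative Du (x + s *\<^sub>R circ t) (circ t) + s * D2u (x + s *\<^sub>R circ t) (circ t) (circ t)) (at s within UNIV)" for s t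
      by (auto intro!: derivative_eq_intros line_d2)
    show "continuous_on (UNIV \<times> cbox 0 (2 * pi)) (\<lambda>(s, t). Du (x + s *\<^sub>R circ t) (circ t) + s * D2u (x + s *\<^sub>R circ t) (circ t) (circ t))"
      by (auto simp: split_beta intro!: continuous_intros)
  qed (auto intro!: integrable_continuous_real continuous_intros)
  have hi: "((\<lambda>t. Du (x + r *\<^sub>R circ t) (circ t) + r * D2u (x + r *\<^sub>R circ t) (circ t) (circ t)) has_integral
     integral {0..2*pi} (\<lambda>t. Du (x + r *\<^sub>R circ t) (circ t) + r * D2u (x + r *\<^sub>R circ t) (circ t) (circ t))) {0..2*pi}"
    by (intro integrable_integral integrable_continuous_real continuous_intros)
  have lap: "laplacian u (x + r *\<^sub>R circ t) = D2u (x + r *\<^sub>R circ t) (circ t) (circ t)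
      + D2u (x + r *\<^sub>R circ t) (perp (circ t)) (perp (circ t))" for t
    by (rule laplacian_frame) simp
  from has_integral_add[OF hi circle_tangential[of r x]]
  have "((\<lambda>t. r * laplacian u (x + r *\<^sub>R circ t)) has_integral
     integral {0..2*pi} (\<lambda>t. Du (x + r *\<^sub>R circ t) (circ t) + r * D2u (x + r *\<^sub>R circ t) (circ t) (circ t))) {0..2*pi}"
    by (simp add: lap algebra_simps)
  from integral_unique[OF this]
  show ?thesis using * by (simp add: circle_flux_def)
qed

lemma cont_circle_flux: "continuous_on UNIV (circle_flux x)"
proof -
  have "continuous_on UNIV (\<lambda>r. integral (cbox 0 (2*pi)) (\<lambda>t. Du (x + r *\<^sub>R circ t) (circ t)))"
    by (rule integral_continuous_on_param) (auto simp: split_beta intro!: continuous_intros)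
  then show ?thesis by (simp add: circle_flux_def[abs_def])
qed

lemma circle_green:
  assumes R: "0 < R"
  shows "((\<lambda>s. (ln R - ln s) * s * integral {0..2*pi} (\<lambda>t. laplacian u (x + s *\<^sub>R circ t)))
    has_integral circle_int x R - 2 * pi * u x) {0..R}"
proof -
  \<comment> \<open>When \<open>?G\<close> is differentiated, the 1/s from the logarithm cancels the
    derivative of \<open>circle_int\<close> and only the Laplacian term survives.\<close>
  let ?G = "\<lambda>s. circle_int x s + (ln R - ln s) * (s * circle_flux x s)"
  have C0: "circle_int x 0 = 2 * pi * u x" by (simp add: circle_int_def)
  have "((\<lambda>s. (ln R - ln s) * s * integral {0..2*pi} (\<lambda>t. laplacian u (x + s *\<^sub>R circ t)))
    has_integral ?G R - ?G 0) {0..R}"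
  proof (rule fundamental_theorem_of_calculus_interior)
    show "0 \<le> R" using R by simp
    show "(?G has_vector_derivative (ln R - ln s) * s * integral {0..2*pi} (\<lambda>t. laplacian u (x + s *\<^sub>R circ t))) (at s)"
      if "s \<in> {0<..<R}" for s
      unfolding has_real_derivative_iff_has_vector_derivative[symmetric]
      by (rule DERIV_cong[OF DERIV_add[OF circle_int_deriv DERIV_mult[OF DERIV_diff[OF DERIV_const DERIV_ln] circle_flux_deriv]]])
        (use that in \<open>simp_all add: field_simps\<close>)
    have "continuous (at s within {0..R}) ?G" if s: "s \<in> {0..R}" for s
    proof (cases "s = 0")
      \<comment> \<open>At the centre \<open>ln 0\<close> stands in \<open>?G\<close>, but with the
        factor \<open>s = 0\<close>; continuity there rests on \<open>s * ln s\<close> tending to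
        0.\<close>
      case True
      have c1: "(circle_flux x \<longlongrightarrow> circle_flux x 0) (at_right 0)"
        using cont_circle_flux[of x] by (simp add: continuous_on_eq_continuous_at isCont_def filterlim_at_split)
      have c: "(circle_int x \<longlongrightarrow> circle_int x 0) (at_right 0)"
        using DERIV_isCont[OF circle_int_deriv[of x 0]] by (simp add: isCont_def filterlim_at_split)
      have "(?G \<longlongrightarrow> circle_int x 0 + 0 * circle_flux x 0) (at_right 0)"
        by (intro tendsto_add c) (use tendsto_mult[OF tendsto_r_ln c1] in \<open>simp add: mult.assoc\<close>)
      then have "(?G \<longlongrightarrow> ?G 0) (at_right 0)" by simp
      then have "(?G \<longlongrightarrow> ?G 0) (at 0 within {0..R})"
        using R by (simp add: at_within_Icc_at_right)
      then show ?thesis using True by (simp add: continuous_within)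
    next
      case False
      with s have "0 < s" by simp
      then have "isCont ?G s"
        by (intro continuous_intros DERIV_isCont[OF circle_int_deriv] DERIV_isCont[OF circle_flux_deriv]) auto
      then show ?thesis using continuous_at_imp_continuous_at_within by blast
    qed
    then show "continuous_on {0..R} ?G" by (simp add: continuous_on_eq_continuous_within)
  qed
  then show ?thesis by (simp add: C0)
qed

theorem green_circle:
  assumes R: "0 < R"
  shows "circle_int x R = 2 * pi * u x + (LINT y|lborel. ln_cut R (norm (y - x)) * laplacian u y)"
proof -
  have A: "((\<lambda>r. if 0 < r then ln_cut R r * r * integral {0..2*pi} (\<lambda>t. laplacian u (x + r *\<^sub>R circ t)) else 0)
      has_integral (LINT y|lborel. ln_cut R (norm (y - x)) * laplacian u y)) UNIV"
    by (intro integral_radial_polar ln_cut_cont_integrable R cont_laplacian)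
  have B: "((\<lambda>r. if r \<in> {0..R} then (ln R - ln r) * r * integral {0..2*pi} (\<lambda>t. laplacian u (x + r *\<^sub>R circ t)) else 0)
      has_integral circle_int x R - 2 * pi * u x) UNIV"
    using circle_green[OF R] by (subst has_integral_restrict_UNIV)
  have eq: "(\<lambda>r. if r \<in> {0..R} then (ln R - ln r) * r * integral {0..2*pi} (\<lambda>t. laplacian u (x + r *\<^sub>R circ t)) else 0)
    = (\<lambda>r. if 0 < r then ln_cut R r * r * integral {0..2*pi} (\<lambda>t. laplacian u (x + r *\<^sub>R circ t)) else 0)"
    using R by (auto simp: fun_eq_iff ln_cut_eq ln_cut_zero)
  show ?thesis using has_integral_unique[OF A B[unfolded eq]] by linarith
qed

lemma cont_circle_int: "continuous_on S (circle_int x)"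
  using DERIV_isCont[OF circle_int_deriv] by (simp add: continuous_at_imp_continuous_on)

lemma ball_polar:
  assumes "0 \<le> \<rho>"
  shows "(LINT y:ball x \<rho>|lborel. u y) = integral {0..\<rho>} (\<lambda>r. r * circle_int x r)"
proof -
  have si: "set_integrable lborel (ball x \<rho>) u"
    by (rule set_integrable_subset[OF borel_integrable_compact[of "cball x \<rho>", folded set_integrable_def]]) (auto intro: cont_u)
  let ?w = "\<lambda>r. indicator {..<\<rho>} r :: real"
  have eq: "(\<lambda>y. ?w (norm (y - x)) * u y) = (\<lambda>y. indicator (ball x \<rho>) y *\<^sub>R u y)"
    by (auto simp: fun_eq_iff indicator_def dist_norm norm_minus_commute)
  have "((\<lambda>r. if 0 < r then ?w r * r * integral {0..2*pi} (\<lambda>t. u (x + r *\<^sub>R circ t)) else 0)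
      has_integral (LINT y|lborel. ?w (norm (y - x)) * u y)) UNIV"
    using si by (intro integral_radial_polar cont_u) (simp add: eq set_integrable_def)
  then have "((\<lambda>r. if r \<in> {0<..<\<rho>} then r * circle_int x r else 0)
      has_integral (LINT y:ball x \<rho>|lborel. u y)) UNIV"
    unfolding eq set_lebesgue_integral_def[symmetric]
    by (rule has_integral_eq[rotated]) (auto simp: circle_int_def indicator_def)
  then have "((\<lambda>r. r * circle_int x r) has_integral (LINT y:ball x \<rho>|lborel. u y)) {0<..<\<rho>}"
    by (subst (asm) has_integral_restrict_UNIV)
  then have "((\<lambda>r. r * circle_int x r) has_integral (LINT y:ball x \<rho>|lborel. u y)) {0..\<rho>}"
    by (simp add: has_integral_Icc_iff_Ioo)
  then show ?thesis by (simp add: integral_unique)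
qed

end

section \<open>Integral representation of the solution\<close>

text \<open>At distance at least 1 from the pole the ratio of the two distances is at most
  \<open>1 + d\<close>; the singularity sits inside the unit disk, where \<open>ln_cut 1\<close>
  equals it. This produces a dominating function that does not depend on the radius of the large
  disk.\<close>

lemma ln_ratio_bound:
  assumes "0 < s" "0 < s'" "s' \<le> s + d" "0 \<le> d"
  shows "ln s' - ln s \<le> ln (1 + d) + ln_cut 1 s"
proof (cases "1 \<le> s")
  case True
  have "s' \<le> s + d * 1" using assms by simp
  also have "\<dots> \<le> s + d * s" using True assms by (intro add_left_mono mult_left_mono) auto
  finally have "s' \<le> s * (1 + d)" by (simp add: algebra_simps)
  then have "ln s' \<le> ln (s * (1 + d))" using assms by simp
  also have "\<dots> = ln s + ln (1 + d)" using assms by (simp add: ln_mult)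
  finally show ?thesis using ln_cut_nonneg[of 1 s] by linarith
next
  case False
  then have "ln s' \<le> ln (1 + d)" using assms by simp
  moreover have "ln_cut 1 s = - ln s" using False assms by (simp add: ln_cut_eq)
  ultimately show ?thesis by simp
qed

text \<open>Truncation at 0 does not increase distances, and \<open>R\<close> cancels in the
  difference of the two untruncated logarithms.\<close>

lemma ln_cut_diff_le: "0 < R \<Longrightarrow> 0 < s \<Longrightarrow> 0 < s' \<Longrightarrow> \<bar>ln_cut R s - ln_cut R s'\<bar> \<le> \<bar>ln s' - ln s\<bar>"
  by (auto simp: ln_cut_def ln_div max_def)

lemma ln_cut_le_add: "1 \<le> R \<Longrightarrow> 0 \<le> s \<Longrightarrow> ln_cut R s \<le> ln R + ln_cut 1 s"
  by (cases "s = 0") (auto simp: ln_cut_def ln_div max_def)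

lemma measure_ball2: "0 \<le> r \<Longrightarrow> measure lborel (ball (x::real^2) r) = pi * r\<^sup>2"
  using content_ball[of r x] by (simp add: unit_ball_vol_2)

lemma emeasure_ball2: "0 \<le> r \<Longrightarrow> emeasure lborel (ball (x::real^2) r) = ennreal (pi * r\<^sup>2)"
  using emeasure_ball[of r x] by (simp add: unit_ball_vol_2)

text \<open>Double counting by Fubini: each point of \<open>S\<close> lies in the unit balls around
  a set of centres of area pi, all of them in \<open>S'\<close>.\<close>

lemma integral_le_unit_ball_averages:
  fixes h :: "real^2 \<Rightarrow> real"
  assumes h [measurable]: "h \<in> borel_measurable borel" and h0: "\<And>y. 0 \<le> h y"
    and int: "\<And>z. set_integrable lborel (ball z 1) h" and B: "\<And>z. (LINT y:ball z 1|lborel. h y) \<le> B"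
    and S [measurable]: "S \<in> sets borel" and S' [measurable]: "S' \<in> sets borel"
    and fin: "emeasure lborel S' < \<infinity>"
    and sub: "\<And>y. y \<in> S \<Longrightarrow> ball y 1 \<subseteq> S'"
  shows "set_integrable lborel S h" (is ?th1)
    and "pi * (LINT y:S|lborel. h y) \<le> B * measure lborel S'" (is ?th2)
proof -
  have "0 \<le> (LINT y:ball 0 1|lborel. h y)"
    unfolding set_lebesgue_integral_def using h0 by (intro Bochner_Integration.integral_nonneg) auto
  with B[of 0] have B0: "0 \<le> B" by linarith
  have inner: "(\<integral>\<^sup>+y. ennreal (h y) * indicator {y. dist y z < 1} y \<partial>lborel) \<le> ennreal B" for z
  proof -
    have "(\<integral>\<^sup>+y. ennreal (h y) * indicator {y. dist y z < 1} y \<partial>lborel) = (\<integral>\<^sup>+y. ennreal (indicator (ball z 1) y *\<^sub>R h y) \<partial>lborel)"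
      by (intro nn_integral_cong) (auto simp: indicator_def dist_commute)
    also have "\<dots> = ennreal (LINT y:ball z 1|lborel. h y)"
      unfolding set_lebesgue_integral_def using int[of z] h0
      by (intro nn_integral_eq_integral) (auto simp: set_integrable_def)
    finally show ?thesis using B by (simp add: ennreal_leI)
  qed
  have "ennreal pi * (\<integral>\<^sup>+y. ennreal (h y) * indicator S y \<partial>lborel)
     = (\<integral>\<^sup>+y. ennreal (h y) * indicator S y * ennreal pi \<partial>lborel)"
    by (subst nn_integral_multc) (auto simp: mult.commute)
  also have "\<dots> = (\<integral>\<^sup>+y. ennreal (h y) * indicator S y * (\<integral>\<^sup>+z. indicator (ball y 1) z \<partial>lborel) \<partial>lborel)"
    by (intro nn_integral_cong) (simp add: emeasure_ball2)
  also have "\<dots> = (\<integral>\<^sup>+y. (\<integral>\<^sup>+z. ennreal (h y) * indicator S y * indicator (ball y 1) z \<partial>lborel) \<partial>lborel)"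
    by (intro nn_integral_cong nn_integral_cmult[symmetric]) (auto intro!: borel_measurable_indicator)
  also have "\<dots> \<le> (\<integral>\<^sup>+y. (\<integral>\<^sup>+z. ennreal (h y) * indicator {z. dist z (y::real^2) < 1} z * indicator S' z \<partial>lborel) \<partial>lborel)"
  proof (intro nn_integral_mono)
    fix y z :: "real^2"
    show "ennreal (h y) * indicator S y * indicator (ball y 1) z
      \<le> ennreal (h y) * indicator {z. dist z y < 1} z * indicator S' z"
      using sub[of y] by (auto simp: indicator_def dist_commute subset_eq)
  qed
  also have "\<dots> = (\<integral>\<^sup>+z. (\<integral>\<^sup>+y. ennreal (h y) * indicator {z. dist z (y::real^2) < 1} z * indicator S' z \<partial>lborel) \<partial>lborel)"
    by (rule lborel_pair.Fubini') (simp add: indicator_def)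
  also have "\<dots> = (\<integral>\<^sup>+z. (\<integral>\<^sup>+y. ennreal (h y) * indicator {y. dist y z < 1} y \<partial>lborel) * indicator S' z \<partial>lborel)"
    by (subst nn_integral_multc[symmetric]) (auto intro!: nn_integral_cong simp: indicator_def dist_commute)
  also have "\<dots> \<le> (\<integral>\<^sup>+z. ennreal B * indicator S' z \<partial>lborel)"
    by (intro nn_integral_mono mult_right_mono inner) auto
  also have "\<dots> = ennreal B * emeasure lborel S'" by (simp add: nn_integral_cmult_indicator)
  also have "\<dots> = ennreal (B * measure lborel S')" using fin B0
    by (simp add: emeasure_eq_ennreal_measure ennreal_mult)
  finally have le: "ennreal pi * (\<integral>\<^sup>+y. ennreal (h y) * indicator S y \<partial>lborel) \<le> ennreal (B * measure lborel S')" .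
  have eq: "(\<integral>\<^sup>+y. ennreal (h y) * indicator S y \<partial>lborel) = (\<integral>\<^sup>+y. ennreal (indicator S y *\<^sub>R h y) \<partial>lborel)"
    by (intro nn_integral_cong) (auto simp: indicator_def)
  have "(\<integral>\<^sup>+y. ennreal (h y) * indicator S y \<partial>lborel) \<noteq> \<infinity>"
    using le by (auto simp: ennreal_mult_eq_top_iff top_unique)
  then show 1: ?th1 unfolding set_integrable_def using h0
    by (intro integrableI_nonneg) (auto simp: eq less_top)
  have "(\<integral>\<^sup>+y. ennreal (h y) * indicator S y \<partial>lborel) = ennreal (LINT y:S|lborel. h y)"
    unfolding eq set_lebesgue_integral_def using 1 h0
    by (intro nn_integral_eq_integral) (auto simp: set_integrable_def)
  with le have "ennreal (pi * (LINT y:S|lborel. h y)) \<le> ennreal (B * measure lborel S')"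
    by (simp add: ennreal_mult')
  then show ?th2 using B0 by (subst (asm) ennreal_le_iff) auto
qed

locale liouville = C2_plane +
  fixes K :: "real^2 \<Rightarrow> real" and f :: "real^2 \<Rightarrow> real" and B :: real
  assumes K_cont: "continuous_on UNIV K"
    and f_def: "\<And>x. f x = K x * exp (2 * u x)"
    and pde: "\<And>x. laplacian u x = - f x"
    and f_int: "integrable lborel f"
    and u_plus: "\<And>y. (LINT x:ball y 1|lborel. max (u x) 0) \<le> B"
begin

lemma f_cont: "continuous_on S f"
proof -
  have "continuous_on S (\<lambda>x. K x * exp (2 * u x))"
    by (intro continuous_intros continuous_on_subset[OF K_cont] cont_u) auto
  then show ?thesis by (simp add: f_def[abs_def] cong: continuous_on_cong)
qed

lemma f_meas [measurable]: "f \<in> borel_measurable borel"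
  using f_cont by (rule borel_measurable_continuous_onI)

lemma u_meas [measurable]: "u \<in> borel_measurable borel"
  using cont_u by (rule borel_measurable_continuous_onI)

definition log_pot :: "real^2 \<Rightarrow> real \<Rightarrow> real" where
  "log_pot x R = (LINT y|lborel. ln_cut R (norm (y - x)) * f y)"

lemma circle_int_eq: "0 < R \<Longrightarrow> circle_int x R = 2 * pi * u x - log_pot x R"
  by (simp add: green_circle log_pot_def pde)

lemma ln_cut_f_integrable: "0 < R \<Longrightarrow> integrable lborel (\<lambda>y. ln_cut R (norm (y - x)) * f y)"
  by (rule ln_cut_cont_integrable[OF _ f_cont])

lemma ln_cut_absf_integrable: "0 < R \<Longrightarrow> integrable lborel (\<lambda>y. ln_cut R (norm (y - x)) * \<bar>f y\<bar>)"
  by (rule ln_cut_cont_integrable) (auto intro!: continuous_intros f_cont)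

definition log_ratio :: "real^2 \<Rightarrow> real^2 \<Rightarrow> real^2 \<Rightarrow> real" where
  "log_ratio x x' y = ln (norm (y - x')) - ln (norm (y - x))"

lemma log_ratio_meas [measurable]: "log_ratio x x' \<in> borel_measurable borel"
  unfolding log_ratio_def[abs_def] by measurable

lemma log_ratio_bound:
  assumes "y \<noteq> x" "y \<noteq> x'"
  shows "\<bar>log_ratio x x' y\<bar> \<le> ln (1 + norm (x - x')) + ln_cut 1 (norm (y - x)) + ln_cut 1 (norm (y - x'))"
proof -
  have "norm (y - x') \<le> norm (y - x) + norm (x - x')"
    using norm_triangle_ineq[of "y - x" "x - x'"] by simp
  then have 1: "log_ratio x x' y \<le> ln (1 + norm (x - x')) + ln_cut 1 (norm (y - x))"
    unfolding log_ratio_def using assms by (intro ln_ratio_bound) auto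
  have "norm (y - x) \<le> norm (y - x') + norm (x - x')"
    using norm_triangle_ineq[of "y - x'" "x' - x"] by (simp add: norm_minus_commute)
  then have 2: "- log_ratio x x' y \<le> ln (1 + norm (x - x')) + ln_cut 1 (norm (y - x'))"
    unfolding log_ratio_def minus_diff_eq using assms by (intro ln_ratio_bound) auto
  show ?thesis using 1 2 ln_cut_nonneg[of 1 "norm (y - x)"] ln_cut_nonneg[of 1 "norm (y - x')"] by linarith
qed

definition log_ratio_dom :: "real^2 \<Rightarrow> real^2 \<Rightarrow> real^2 \<Rightarrow> real" where
  "log_ratio_dom x x' y = ln (1 + norm (x - x')) * \<bar>f y\<bar> + ln_cut 1 (norm (y - x)) * \<bar>f y\<bar> + ln_cut 1 (norm (y - x')) * \<bar>f y\<bar>"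

lemma log_ratio_dom_int: "integrable lborel (log_ratio_dom x x')"
  unfolding log_ratio_dom_def[abs_def]
  by (intro Bochner_Integration.integrable_add integrable_mult_right ln_cut_absf_integrable integrable_abs f_int) auto

lemma log_ratio_f_bound: "y \<noteq> x \<Longrightarrow> y \<noteq> x' \<Longrightarrow> \<bar>log_ratio x x' y\<bar> * \<bar>f y\<bar> \<le> log_ratio_dom x x' y"
  using mult_right_mono[OF log_ratio_bound[of y x x'], of "\<bar>f y\<bar>"] by (simp add: log_ratio_dom_def algebra_simps)

lemma AE_neq2: "AE y in lborel. y \<noteq> (x::real^2) \<and> y \<noteq> x'"
  using AE_lborel_singleton[of x] AE_lborel_singleton[of x'] by auto

lemma log_ratio_f_int: "integrable lborel (\<lambda>y. log_ratio x x' y * f y)"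
proof (rule Bochner_Integration.integrable_bound[OF log_ratio_dom_int[of x x']])
  show "AE y in lborel. norm (log_ratio x x' y * f y) \<le> norm (log_ratio_dom x x' y)"
    using AE_neq2[of x x']
  proof eventually_elim
    case (elim y)
    then show ?case using log_ratio_f_bound[of y x x'] by (simp add: abs_mult)
  qed
qed simp

text \<open>A single potential may grow like ln R times the mass. In the difference for two centres
  the ln R cancels, and the remaining kernel is dominated uniformly in R.\<close>

lemma log_pot_diff_tendsto: "((\<lambda>R. log_pot x R - log_pot x' R) \<longlongrightarrow> (LINT y|lborel. log_ratio x x' y * f y)) at_top"
proof -
  have eq: "eventually (\<lambda>R. (LINT y|lborel. (ln_cut R (norm (y - x)) - ln_cut R (norm (y - x'))) * f y) = log_pot x R - log_pot x' R) at_top"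
    using eventually_gt_at_top[of 0]
  proof eventually_elim
    case (elim R)
    then show ?case unfolding log_pot_def using ln_cut_f_integrable[OF elim]
      by (simp add: left_diff_distrib)
  qed
  have "((\<lambda>R. LINT y|lborel. (ln_cut R (norm (y - x)) - ln_cut R (norm (y - x'))) * f y) \<longlongrightarrow> (LINT y|lborel. log_ratio x x' y * f y)) at_top"
  proof (rule integral_dominated_convergence_at_top)
    show "integrable lborel (log_ratio_dom x x')" by (rule log_ratio_dom_int)
    show "\<forall>\<^sub>F R in at_top. AE y in lborel. norm ((ln_cut R (norm (y - x)) - ln_cut R (norm (y - x'))) * f y) \<le> log_ratio_dom x x' y"
      using eventually_gt_at_top[of 0]
    proof eventually_elim
      case (elim R)
      show ?case using AE_neq2[of x x']
      proof eventually_elim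
        case (elim y)
        have "\<bar>ln_cut R (norm (y - x)) - ln_cut R (norm (y - x'))\<bar> \<le> \<bar>log_ratio x x' y\<bar>"
          using ln_cut_diff_le[of R "norm (y - x)" "norm (y - x')"] elim \<open>0 < R\<close> by (simp add: log_ratio_def)
        then have "norm ((ln_cut R (norm (y - x)) - ln_cut R (norm (y - x'))) * f y) \<le> \<bar>log_ratio x x' y\<bar> * \<bar>f y\<bar>"
          by (simp add: abs_mult mult_right_mono)
        also have "\<dots> \<le> log_ratio_dom x x' y" using elim by (intro log_ratio_f_bound) auto
        finally show ?case .
      qed
    qed
    show "AE y in lborel. ((\<lambda>R. (ln_cut R (norm (y - x)) - ln_cut R (norm (y - x'))) * f y) \<longlongrightarrow> log_ratio x x' y * f y) at_top"
      using AE_neq2[of x x']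
    proof eventually_elim
      case (elim y)
      have "eventually (\<lambda>R. (ln_cut R (norm (y - x)) - ln_cut R (norm (y - x'))) * f y = log_ratio x x' y * f y) at_top"
        using eventually_ge_at_top[of "max (norm (y - x)) (norm (y - x'))"]
        by eventually_elim (use elim in \<open>simp add: ln_cut_eq log_ratio_def\<close>)
      then show ?case by (rule tendsto_eventually)
    qed
  qed auto
  then show ?thesis by (rule Lim_transform_eventually[OF _ eq])
qed

text \<open>The annulus is thickened by 1 on both sides to contain the unit balls around its points;
  the thickened one has area pi * 4 * rho * (d + 1). The point is that this is linear in
  rho.\<close>

lemma uplus_annulus:
  assumes "0 \<le> d" "d + 1 \<le> \<rho>"
  shows "set_integrable lborel (ball x (\<rho> + d) - ball x (\<rho> - d)) (\<lambda>y. max (u y) 0)"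
    and "(LINT y:(ball x (\<rho> + d) - ball x (\<rho> - d))|lborel. max (u y) 0) \<le> B * (4 * \<rho> * (d + 1))"
proof -
  let ?S' = "ball x (\<rho> + d + 1) - ball x (\<rho> - d - 1)"
  have si: "set_integrable lborel (ball z 1) (\<lambda>y. max (u y) 0)" for z
    by (rule set_integrable_subset[OF borel_integrable_compact[of "cball z 1", folded set_integrable_def]])
      (auto intro!: continuous_intros cont_u)
  have sub: "ball y 1 \<subseteq> ?S'" if y: "y \<in> ball x (\<rho> + d) - ball x (\<rho> - d)" for y
  proof
    fix z assume "z \<in> ball y 1"
    then show "z \<in> ?S'" using y dist_triangle[of x z y] dist_triangle[of x y z] by (auto simp: dist_commute)
  qed
  have m: "emeasure lborel ?S' < \<infinity>"
    by (rule le_less_trans[OF emeasure_mono[of _ "ball x (\<rho> + d + 1)"]]) (use assms in \<open>auto simp: emeasure_ball2\<close>)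
  have "measure lborel ?S' = pi * (\<rho> + d + 1)\<^sup>2 - pi * (\<rho> - d - 1)\<^sup>2"
    using assms by (subst measure_Diff) (auto simp: measure_ball2 emeasure_ball2 subset_ball)
  also have "\<dots> = pi * (4 * \<rho> * (d + 1))" by (simp add: power2_eq_square algebra_simps)
  finally have ms: "measure lborel ?S' = pi * (4 * \<rho> * (d + 1))" .
  note * = integral_le_unit_ball_averages[of "\<lambda>y. max (u y) 0" B "ball x (\<rho> + d) - ball x (\<rho> - d)" ?S', OF _ _ si u_plus _ _ m sub]
  show "set_integrable lborel (ball x (\<rho> + d) - ball x (\<rho> - d)) (\<lambda>y. max (u y) 0)" by (rule *) auto
  have "pi * (LINT y:(ball x (\<rho> + d) - ball x (\<rho> - d))|lborel. max (u y) 0) \<le> B * measure lborel ?S'" by (rule *(2)) auto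
  then have "pi * (LINT y:(ball x (\<rho> + d) - ball x (\<rho> - d))|lborel. max (u y) 0) \<le> pi * (B * (4 * \<rho> * (d + 1)))"
    by (simp add: ms mult_ac)
  then show "(LINT y:(ball x (\<rho> + d) - ball x (\<rho> - d))|lborel. max (u y) 0) \<le> B * (4 * \<rho> * (d + 1))"
    using pi_gt_zero by (simp only: mult_le_cancel_left_pos)
qed

lemma mean_diff_tendsto:
  "((\<lambda>R. circle_int x R - circle_int x' R) \<longlongrightarrow> 2 * pi * (u x - u x') - (LINT y|lborel. log_ratio x x' y * f y)) at_top"
proof (rule Lim_transform_eventually)
  show "((\<lambda>R. 2 * pi * (u x - u x') - (log_pot x R - log_pot x' R)) \<longlongrightarrow> 2 * pi * (u x - u x') - (LINT y|lborel. log_ratio x x' y * f y)) at_top"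
    by (intro tendsto_diff tendsto_const log_pot_diff_tendsto)
  show "\<forall>\<^sub>F R in at_top. 2 * pi * (u x - u x') - (log_pot x R - log_pot x' R) = circle_int x R - circle_int x' R"
    using eventually_gt_at_top[of 0] by eventually_elim (simp add: circle_int_eq algebra_simps)
qed

text \<open>The hypotheses control \<open>u\<close> locally only from above. For circle integrals a
  lower bound comes from Green's formula, where the kernel is at most \<open>ln r\<close> plus the
  unit-scale kernel and \<open>f\<close> is integrable.\<close>

lemma circle_int_lower: "\<exists>c\<ge>0. \<forall>r\<ge>1. - c * (1 + ln r) \<le> circle_int x r"
proof -
  define N M where "N = (LINT y|lborel. \<bar>f y\<bar>)" and "M = (LINT y|lborel. ln_cut 1 (norm (y - x)) * \<bar>f y\<bar>)"
  have N0: "0 \<le> N" and M0: "0 \<le> M" by (auto simp: N_def M_def)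
  define U where "U = 2 * pi * \<bar>u x\<bar>"
  have U0: "0 \<le> U" and U: "- U \<le> 2 * pi * u x"
    using abs_ge_minus_self[of "2 * pi * u x"] by (auto simp: U_def abs_mult)
  have "- (N + M + U) * (1 + ln r) \<le> circle_int x r" if r: "1 \<le> r" for r
  proof -
    have "log_pot x r \<le> (LINT y|lborel. ln r * \<bar>f y\<bar> + ln_cut 1 (norm (y - x)) * \<bar>f y\<bar>)"
      unfolding log_pot_def
    proof (intro integral_mono ln_cut_f_integrable Bochner_Integration.integrable_add integrable_mult_right ln_cut_absf_integrable integrable_abs f_int)
      fix y
      have "ln_cut r (norm (y - x)) * f y \<le> ln_cut r (norm (y - x)) * \<bar>f y\<bar>" by (intro mult_left_mono) auto
      also have "\<dots> \<le> (ln r + ln_cut 1 (norm (y - x))) * \<bar>f y\<bar>" using r by (intro mult_right_mono ln_cut_le_add) auto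
      finally show "ln_cut r (norm (y - x)) * f y \<le> ln r * \<bar>f y\<bar> + ln_cut 1 (norm (y - x)) * \<bar>f y\<bar>" by (simp add: algebra_simps)
    qed (use r in auto)
    also have "\<dots> = ln r * N + M" unfolding N_def M_def
      by (subst Bochner_Integration.integral_add) (auto intro!: integrable_mult_right ln_cut_absf_integrable integrable_abs f_int)
    finally have t: "log_pot x r \<le> ln r * N + M" .
    have l: "0 \<le> ln r" using r by simp
    have "0 \<le> ln r * M" "0 \<le> ln r * U" using l M0 U0 by auto
    moreover have "- (N + M + U) * (1 + ln r) = - N - M - U - ln r * N - ln r * M - ln r * U"
      by (simp add: algebra_simps)
    moreover have "circle_int x r = 2 * pi * u x - log_pot x r" using r by (intro circle_int_eq) simp
    ultimately show ?thesis using U t N0 by linarith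
  qed
  then show ?thesis using N0 M0 U0 by (intro exI[of _ "N + M + U"]) auto
qed

lemma ball_si: "set_integrable lborel (ball x \<rho>) u"
  by (rule set_integrable_subset[OF borel_integrable_compact[of "cball x \<rho>", folded set_integrable_def]]) (auto intro: cont_u)

text \<open>The two balls differ only inside the annulus, and there \<open>|u|\<close> is
  \<open>2 * max (u y) 0 - u y\<close>. The first term is bounded through the averages of the
  positive part, the second through circle integrals.\<close>

lemma ball_diff:
  assumes d: "d = norm (x - x')" and \<rho>: "d + 1 \<le> \<rho>"
  shows "(LINT y:ball x \<rho>|lborel. u y) - (LINT y:ball x' \<rho>|lborel. u y)
    \<le> 2 * (B * (4 * \<rho> * (d + 1))) - integral {\<rho> - d..\<rho> + d} (\<lambda>r. r * circle_int x r)"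
proof -
  let ?A = "ball x (\<rho> + d) - ball x (\<rho> - d)"
  have d0: "0 \<le> d" using d by simp
  note up = uplus_annulus[OF d0 \<rho>, of x]
  have siA: "set_integrable lborel ?A u" by (rule set_integrable_subset[OF ball_si[of x "\<rho> + d"]]) auto
  have "(LINT y:ball x \<rho>|lborel. u y) - (LINT y:ball x' \<rho>|lborel. u y)
     = (LINT y|lborel. indicator (ball x \<rho>) y *\<^sub>R u y - indicator (ball x' \<rho>) y *\<^sub>R u y)"
    unfolding set_lebesgue_integral_def using ball_si[of x \<rho>] ball_si[of x' \<rho>]
    by (subst Bochner_Integration.integral_diff) (auto simp: set_integrable_def)
  also have "\<dots> \<le> (LINT y|lborel. 2 * (indicator ?A y *\<^sub>R max (u y) 0) - indicator ?A y *\<^sub>R u y)"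
  proof (rule integral_mono)
    show "integrable lborel (\<lambda>y. indicator (ball x \<rho>) y *\<^sub>R u y - indicator (ball x' \<rho>) y *\<^sub>R u y)"
      using ball_si[of x \<rho>] ball_si[of x' \<rho>] by (auto simp: set_integrable_def)
    show "integrable lborel (\<lambda>y. 2 * (indicator ?A y *\<^sub>R max (u y) 0) - indicator ?A y *\<^sub>R u y)"
      using up(1) siA unfolding set_integrable_def by (intro Bochner_Integration.integrable_diff integrable_mult_right)
    fix y
    have "dist x y \<le> dist x' y + d" "dist x' y \<le> dist x y + d"
      using dist_triangle[of x y x'] dist_triangle[of x' y x] by (auto simp: d dist_norm norm_minus_commute)
    then show "indicator (ball x \<rho>) y *\<^sub>R u y - indicator (ball x' \<rho>) y *\<^sub>R u y
       \<le> 2 * (indicator ?A y *\<^sub>R max (u y) 0) - indicator ?A y *\<^sub>R u y"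
      using d0 by (auto simp: indicator_def max_def)
  qed
  also have "\<dots> = 2 * (LINT y:?A|lborel. max (u y) 0) - (LINT y:?A|lborel. u y)"
    unfolding set_lebesgue_integral_def using up(1) siA unfolding set_integrable_def
    by (subst Bochner_Integration.integral_diff) auto
  also have "(LINT y:?A|lborel. u y) = (LINT y:ball x (\<rho> + d)|lborel. u y) - (LINT y:ball x (\<rho> - d)|lborel. u y)"
  proof -
    have "(\<lambda>y. indicator ?A y *\<^sub>R u y) = (\<lambda>y. indicator (ball x (\<rho> + d)) y *\<^sub>R u y - indicator (ball x (\<rho> - d)) y *\<^sub>R u y)"
      using d0 by (auto simp: fun_eq_iff indicator_def)
    then show ?thesis unfolding set_lebesgue_integral_def using ball_si[of x "\<rho> + d"] ball_si[of x "\<rho> - d"]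
      by (auto simp: set_integrable_def)
  qed
  also have "\<dots> = integral {\<rho> - d..\<rho> + d} (\<lambda>r. r * circle_int x r)"
  proof -
    have "integral {0..\<rho> - d} (\<lambda>r. r * circle_int x r) + integral {\<rho> - d..\<rho> + d} (\<lambda>r. r * circle_int x r) = integral {0..\<rho> + d} (\<lambda>r. r * circle_int x r)"
      using d0 \<rho> by (intro Henstock_Kurzweil_Integration.integral_combine integrable_continuous_real continuous_intros cont_circle_int) auto
    then show ?thesis using d0 \<rho> by (simp add: ball_polar)
  qed
  finally show ?thesis using up(2) by simp
qed

lemma annulus_lower:
  assumes c: "0 \<le> c" "\<And>r. 1 \<le> r \<Longrightarrow> - c * (1 + ln r) \<le> circle_int x r" and d0: "0 \<le> d" and \<rho>: "d + 1 \<le> \<rho>"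
  shows "- (2 * d * ((\<rho> + d) * (c * (1 + ln (\<rho> + d))))) \<le> integral {\<rho> - d..\<rho> + d} (\<lambda>r. r * circle_int x r)"
proof -
  have "integral {\<rho> - d..\<rho> + d} (\<lambda>r. - ((\<rho> + d) * (c * (1 + ln (\<rho> + d))))) \<le> integral {\<rho> - d..\<rho> + d} (\<lambda>r. r * circle_int x r)"
  proof (rule integral_le)
    show "(\<lambda>r. r * circle_int x r) integrable_on {\<rho> - d..\<rho> + d}"
      by (intro integrable_continuous_real continuous_intros cont_circle_int)
    fix r assume r: "r \<in> {\<rho> - d..\<rho> + d}"
    then have r1: "1 \<le> r" using \<rho> by simp
    have "r * (c * (1 + ln r)) \<le> (\<rho> + d) * (c * (1 + ln (\<rho> + d)))"
      using r r1 c(1) d0 \<rho> by (intro mult_mono mult_left_mono add_left_mono) auto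
    moreover have "r * (- c * (1 + ln r)) \<le> r * circle_int x r" using r1 c(2) by (intro mult_left_mono) auto
    ultimately show "- ((\<rho> + d) * (c * (1 + ln (\<rho> + d)))) \<le> r * circle_int x r" by simp
  qed auto
  moreover have "integral {\<rho> - d..\<rho> + d} (\<lambda>r. - ((\<rho> + d) * (c * (1 + ln (\<rho> + d)))))
      = - (2 * d * ((\<rho> + d) * (c * (1 + ln (\<rho> + d)))))"
    unfolding integral_const_real using d0 by simp
  ultimately show ?thesis by linarith
qed

text \<open>Only one inequality is needed, since the two centres may be exchanged. If the circle integrals of u
  around the two centres differed by a positive amount in the limit, the ball integrals would differ by
  the order of the area, but they differ at most by the integral over an annulus of bounded width.\<close>

lemma representation_le: "2 * pi * (u x - u x') \<le> (LINT y|lborel. log_ratio x x' y * f y)"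
proof (rule ccontr)
  define D where "D = 2 * pi * (u x - u x') - (LINT y|lborel. log_ratio x x' y * f y)"
  assume "\<not> ?thesis"
  then have D: "0 < D" by (simp add: D_def)
  have "eventually (\<lambda>R. D / 2 < circle_int x R - circle_int x' R) at_top"
    using order_tendstoD(1)[OF mean_diff_tendsto[of x x', folded D_def], of "D / 2"] D by simp
  then obtain R0 where R0: "\<And>R. R0 \<le> R \<Longrightarrow> D / 2 < circle_int x R - circle_int x' R"
    by (auto simp: eventually_at_top_linorder)
  define R1 where "R1 = max R0 1"
  obtain c where c: "0 \<le> c" "\<And>r. 1 \<le> r \<Longrightarrow> - c * (1 + ln r) \<le> circle_int x r" using circle_int_lower[of x] by blast
  define d where "d = norm (x - x')"
  define c0 where "c0 = integral {0..R1} (\<lambda>r. r * circle_int x r - r * circle_int x' r)"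
  have d0: "0 \<le> d" by (simp add: d_def)
  have main: "c0 + D / 4 * (\<rho>\<^sup>2 - R1\<^sup>2) \<le> 2 * (B * (4 * \<rho> * (d + 1))) + 2 * d * ((\<rho> + d) * (c * (1 + ln (\<rho> + d))))"
    if \<rho>: "d + 1 \<le> \<rho>" "R1 \<le> \<rho>" for \<rho>
  proof -
    have \<rho>0: "0 \<le> \<rho>" using \<rho>(1) d0 by simp
    have int: "(\<lambda>r. r * circle_int x r - r * circle_int x' r) integrable_on {a..b}" for a b
      by (intro integrable_continuous_real continuous_intros cont_circle_int)
    have hi: "((\<lambda>r. D / 2 * r) has_integral D / 4 * \<rho>\<^sup>2 - D / 4 * R1\<^sup>2) {R1..\<rho>}"
      by (rule fundamental_theorem_of_calculus)
        (use \<rho> in \<open>auto intro!: derivative_eq_intros simp: has_real_derivative_iff_has_vector_derivative[symmetric] power2_eq_square\<close>)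
    have "D / 4 * (\<rho>\<^sup>2 - R1\<^sup>2) = integral {R1..\<rho>} (\<lambda>r. D / 2 * r)"
      using integral_unique[OF hi] by (simp add: algebra_simps)
    also have "\<dots> \<le> integral {R1..\<rho>} (\<lambda>r. r * circle_int x r - r * circle_int x' r)"
    proof (rule integral_le[OF _ int])
      show "(\<lambda>r. D / 2 * r) integrable_on {R1..\<rho>}" using hi by blast
      fix r assume r: "r \<in> {R1..\<rho>}"
      then have "r * (D / 2) \<le> r * (circle_int x r - circle_int x' r)"
        using R0[of r] by (intro mult_left_mono) (auto simp: R1_def)
      then show "D / 2 * r \<le> r * circle_int x r - r * circle_int x' r" by (simp add: algebra_simps)
    qed
    finally have "c0 + D / 4 * (\<rho>\<^sup>2 - R1\<^sup>2) \<le> integral {0..R1} (\<lambda>r. r * circle_int x r - r * circle_int x' r) + integral {R1..\<rho>} (\<lambda>r. r * circle_int x r - r * circle_int x' r)"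
      by (simp add: c0_def)
    also have "\<dots> = integral {0..\<rho>} (\<lambda>r. r * circle_int x r - r * circle_int x' r)"
      using \<rho> by (intro Henstock_Kurzweil_Integration.integral_combine int) (auto simp: R1_def)
    also have "\<dots> = integral {0..\<rho>} (\<lambda>r. r * circle_int x r) - integral {0..\<rho>} (\<lambda>r. r * circle_int x' r)"
      by (intro Henstock_Kurzweil_Integration.integral_diff integrable_continuous_real continuous_intros cont_circle_int)
    also have "\<dots> = (LINT y:ball x \<rho>|lborel. u y) - (LINT y:ball x' \<rho>|lborel. u y)"
      using \<rho>0 by (simp add: ball_polar)
    also have "\<dots> \<le> 2 * (B * (4 * \<rho> * (d + 1))) - integral {\<rho> - d..\<rho> + d} (\<lambda>r. r * circle_int x r)"
      by (rule ball_diff[OF d_def \<rho>(1)])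
    also have "\<dots> \<le> 2 * (B * (4 * \<rho> * (d + 1))) + 2 * d * ((\<rho> + d) * (c * (1 + ln (\<rho> + d))))"
      using annulus_lower[OF c d0 \<rho>(1)] by simp
    finally show ?thesis .
  qed
  \<comment> \<open>Quadratic growth in rho competes with order rho * ln rho, the logarithm coming
    from \<open>circle_int_lower\<close>.\<close>
  have "eventually (\<lambda>\<rho>. c0 + D / 4 * (\<rho>\<^sup>2 - R1\<^sup>2) > 2 * (B * (4 * \<rho> * (d + 1))) + 2 * d * ((\<rho> + d) * (c * (1 + ln (\<rho> + d))))) at_top"
    using D by real_asymp
  from eventually_happens'[OF trivial_limit_at_top_linorder eventually_conj[OF this
      eventually_conj[OF eventually_ge_at_top[of "d + 1"] eventually_ge_at_top[of R1]]]]
  obtain \<rho> where "2 * (B * (4 * \<rho> * (d + 1))) + 2 * d * ((\<rho> + d) * (c * (1 + ln (\<rho> + d)))) < c0 + D / 4 * (\<rho>\<^sup>2 - R1\<^sup>2)"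
     "d + 1 \<le> \<rho>" "R1 \<le> \<rho>" by blast
  with main[of \<rho>] show False by linarith
qed

theorem representation: "2 * pi * (u x - u x') = (LINT y|lborel. log_ratio x x' y * f y)"
proof -
  have "(\<lambda>y. log_ratio x' x y * f y) = (\<lambda>y. - (log_ratio x x' y * f y))" by (simp add: log_ratio_def fun_eq_iff algebra_simps)
  then have "2 * pi * (u x' - u x) \<le> - (LINT y|lborel. log_ratio x x' y * f y)"
    using representation_le[of x' x] by simp
  with representation_le[of x x'] show ?thesis by (simp add: algebra_simps)
qed

end

section \<open>Asymptotics at infinity\<close>

lemma ln_cut_mono: "0 < a \<Longrightarrow> a \<le> b \<Longrightarrow> 0 \<le> s \<Longrightarrow> ln_cut a s \<le> ln_cut b s"
  by (cases "s = 0") (auto simp: ln_cut_def ln_div max_def)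

text \<open>Passing from scale 1 to scale \<open>a\<close> costs \<open>- ln a\<close> on the unit
  disk. With \<open>a = exp (- u z)\<close> that cost is \<open>u z\<close>.\<close>

lemma ln_cut_split: "0 < a \<Longrightarrow> a \<le> 1 \<Longrightarrow> 0 < s \<Longrightarrow> ln_cut 1 s \<le> ln_cut a s + (if s < 1 then - ln a else 0)"
  by (auto simp: ln_cut_def ln_div max_def)

lemma integral_tail_small:
  fixes h :: "real^2 \<Rightarrow> real"
  assumes h: "integrable lborel h" and e: "0 < e"
  obtains R where "1 \<le> R" "(LINT y|lborel. indicator {y. R \<le> norm y} y * \<bar>h y\<bar>) < e"
proof -
  have [measurable]: "h \<in> borel_measurable borel" using borel_measurable_integrable[OF h] by simp
  have "(\<lambda>n::nat. LINT y|lborel. indicator {y. real n \<le> norm y} y * \<bar>h y\<bar>) \<longlonglongrightarrow> integral\<^sup>L lborel (\<lambda>y::real^2. 0::real)"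
  proof (rule integral_dominated_convergence)
    show "integrable lborel (\<lambda>y. \<bar>h y\<bar>)" using h by simp
    show "AE y in lborel. (\<lambda>n::nat. indicator {y. real n \<le> norm y} y * \<bar>h y\<bar>) \<longlonglongrightarrow> 0"
    proof (rule AE_I2)
      fix y :: "real^2"
      obtain N :: nat where N: "norm y < real N" using reals_Archimedean2 by blast
      have "eventually (\<lambda>n::nat. indicator {y. real n \<le> norm y} y * \<bar>h y\<bar> = 0) sequentially"
        using eventually_ge_at_top[of N] by eventually_elim (use N in \<open>auto simp: indicator_def\<close>)
      then show "(\<lambda>n::nat. indicator {y. real n \<le> norm y} y * \<bar>h y\<bar>) \<longlonglongrightarrow> 0"
        by (rule tendsto_eventually)
    qed
  qed (auto simp: indicator_def)
  then have "(\<lambda>n::nat. LINT y|lborel. indicator {y. real n \<le> norm y} y * \<bar>h y\<bar>) \<longlonglongrightarrow> 0" by simp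
  from order_tendstoD(2)[OF this e]
  obtain N where N: "\<And>n. N \<le> n \<Longrightarrow> (LINT y|lborel. indicator {y. real n \<le> norm y} y * \<bar>h y\<bar>) < e"
    by (auto simp: eventually_sequentially)
  show ?thesis by (rule that[of "real (max N 1)"]) (use N[of "max N 1"] in auto)
qed

context liouville
begin

text \<open>Green's formula at radius r, weighted by r and integrated over [0,1], turns circle
  integrals into the integral over the unit ball, which is at most \<open>B\<close>. The weight
  integrates to 1/2, hence the \<open>2 * B\<close>. Passing to the positive part of
  \<open>f\<close> first allows the kernel of radius r to be enlarged to that of radius 1.\<close>

lemma u_le: "2 * pi * u z \<le> 2 * B + (LINT y|lborel. ln_cut 1 (norm (y - z)) * max (f y) 0)"
proof -
  define S where "S = (LINT y|lborel. ln_cut 1 (norm (y - z)) * max (f y) 0)"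
  have int: "0 < R \<Longrightarrow> integrable lborel (\<lambda>y. ln_cut R (norm (y - z)) * max (f y) 0)" for R
    by (rule ln_cut_cont_integrable) (auto intro!: continuous_intros f_cont)
  have "(2 * pi * u z - S) / 2 = integral {0..1} (\<lambda>r. r * (2 * pi * u z - S))"
  proof -
    have "((\<lambda>r. r * (2 * pi * u z - S)) has_integral (2 * pi * u z - S) / 2 * 1\<^sup>2 - (2 * pi * u z - S) / 2 * 0\<^sup>2) {0..1}"
      by (rule fundamental_theorem_of_calculus)
        (auto intro!: derivative_eq_intros simp: has_real_derivative_iff_has_vector_derivative[symmetric])
    then show ?thesis by (simp add: integral_unique)
  qed
  also have "\<dots> \<le> integral {0..1} (\<lambda>r. r * circle_int z r)"
  proof (rule integral_le)
    show "(\<lambda>r. r * (2 * pi * u z - S)) integrable_on {0..1}" by (intro integrable_continuous_real continuous_intros)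
    show "(\<lambda>r. r * circle_int z r) integrable_on {0..1}" by (intro integrable_continuous_real continuous_intros cont_circle_int)
    fix r :: real assume r: "r \<in> {0..1}"
    show "r * (2 * pi * u z - S) \<le> r * circle_int z r"
    proof (cases "r = 0")
      case False
      with r have r0: "0 < r" by simp
      have "log_pot z r \<le> S" unfolding log_pot_def S_def
      proof (intro integral_mono ln_cut_f_integrable int)
        fix y
        have "ln_cut r (norm (y - z)) * f y \<le> ln_cut r (norm (y - z)) * max (f y) 0" by (intro mult_left_mono) auto
        also have "\<dots> \<le> ln_cut 1 (norm (y - z)) * max (f y) 0" using r r0 by (intro mult_right_mono ln_cut_mono) auto
        finally show "ln_cut r (norm (y - z)) * f y \<le> ln_cut 1 (norm (y - z)) * max (f y) 0" .
      qed (use r0 in auto)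
      then show ?thesis using r0 by (intro mult_left_mono) (auto simp: circle_int_eq)
    qed simp
  qed
  also have "\<dots> = (LINT y:ball z 1|lborel. u y)" by (simp add: ball_polar)
  also have "\<dots> \<le> (LINT y:ball z 1|lborel. max (u y) 0)"
  proof -
    have "set_integrable lborel (ball z 1) (\<lambda>y. max (u y) 0)"
      by (rule set_integrable_subset[OF borel_integrable_compact[of "cball z 1", folded set_integrable_def]])
        (auto intro!: continuous_intros cont_u)
    then show ?thesis using ball_si[of z 1] unfolding set_lebesgue_integral_def set_integrable_def
      by (intro integral_mono) (auto simp: indicator_def)
  qed
  also have "\<dots> \<le> B" by (rule u_plus)
  finally show ?thesis by (simp add: S_def)
qed

end

locale liouville_mono = liouville +
  fixes q :: real
  assumes K_mono: "\<And>x y. norm x \<ge> norm y \<Longrightarrow> K x \<le> K y"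
    and q0: "0 < q" and q_int: "integrable lborel (\<lambda>x. \<bar>K x\<bar> * (1 + norm x) powr (- q))"
    and q_mass: "pi * q < (LINT x|lborel. f x)"
begin

text \<open>The maximum of the positive part of \<open>K\<close>, because \<open>K\<close> is
  largest at the origin.\<close>

definition K_plus where "K_plus = max (K 0) 0"

lemma f_plus_le: "max (f y) 0 \<le> K_plus * exp (2 * u y)"
  using K_mono[of 0 y] by (auto simp: f_def K_plus_def max_def intro: mult_right_mono)

text \<open>Point picking: at a maximum of \<open>exp (u z) * (1 - norm (z - x0))\<close>, u is almost maximal on a ball of
  radius \<open>exp (- u z)\<close>, on which the potential is harmless; outside it the kernel is at most \<open>u z\<close>,
  and the mass near infinity is small enough to absorb that term.\<close>

lemma u_bounded_far: "\<exists>R U. \<forall>x. R \<le> norm x \<longrightarrow> u x \<le> U"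
proof -
  \<comment> \<open>The threshold pi is half of the coefficient 2 pi of \<open>u z\<close> in
    \<open>u_le\<close>: the term \<open>u z * pi\<close> can be absorbed and
    \<open>pi * u z\<close> remains.\<close>
  obtain R where R: "(LINT y|lborel. indicator {y. R \<le> norm y} y * \<bar>f y\<bar>) < pi"
    using integral_tail_small[OF f_int pi_gt_zero] by blast
  define U1 where "U1 = (2 * B + 8 * pi * K_plus) / pi"
  have "u x0 \<le> max U1 (ln 2)" if x0: "R + 2 \<le> norm x0" for x0
  proof -
    let ?\<phi> = "\<lambda>z. exp (u z) * (1 - norm (z - x0))"
    have "\<exists>z\<in>cball x0 1. \<forall>y\<in>cball x0 1. ?\<phi> y \<le> ?\<phi> z"
      by (intro continuous_attains_sup) (auto intro!: continuous_intros cont_u)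
    then obtain z where z: "z \<in> cball x0 1" and max: "\<And>y. y \<in> cball x0 1 \<Longrightarrow> ?\<phi> y \<le> ?\<phi> z" by blast
    define \<sigma> where "\<sigma> = 1 - norm (z - x0)"
    define Q where "Q = exp (u z) * \<sigma>"
    have s: "0 \<le> \<sigma>" "\<sigma> \<le> 1" using z by (auto simp: \<sigma>_def dist_norm norm_minus_commute)
    have xQ: "exp (u x0) \<le> Q" using max[of x0] by (simp add: Q_def \<sigma>_def)
    show ?thesis
    proof (cases "Q \<le> 2")
      case True
      then have "exp (u x0) \<le> 2" using xQ by simp
      then have "u x0 \<le> ln 2" by (simp add: ln_ge_iff)
      then show ?thesis by simp
    next
      case False
      then have s0: "0 < \<sigma>" using s by (cases "\<sigma> = 0") (auto simp: Q_def)
      define r where "r = exp (- u z)"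
      have r0: "0 < r" by (simp add: r_def)
      have rQ: "r = \<sigma> / Q" using s0 by (simp add: r_def Q_def exp_minus field_simps)
      \<comment> \<open>With \<open>r\<close> at most half of \<open>\<sigma>\<close>, the weight
        \<open>1 - norm (y - x0)\<close> loses at most a factor 2 on the ball of radius
        \<open>r\<close> about \<open>z\<close>; by maximality \<open>exp (u y)\<close> is then at
        most twice \<open>exp (u z)\<close> there.\<close>
      have r1: "r \<le> \<sigma> / 2" unfolding rQ using False s0 by (intro divide_left_mono) auto
      have M: "\<bar>max (f y) 0\<bar> \<le> 4 * K_plus / r\<^sup>2" if y: "norm (y - z) < r" for y
      proof -
        have "norm (y - x0) \<le> norm (y - z) + norm (z - x0)" using norm_triangle_ineq[of "y - z" "z - x0"] by simp
        then have y1: "\<sigma> / 2 \<le> 1 - norm (y - x0)" using y r1 by (simp add: \<sigma>_def)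
        then have "y \<in> cball x0 1" using s0 by (simp add: dist_norm norm_minus_commute)
        from max[OF this] have "exp (u y) * (1 - norm (y - x0)) \<le> exp (u z) * \<sigma>" by (simp add: \<sigma>_def)
        moreover have "exp (u y) * (\<sigma> / 2) \<le> exp (u y) * (1 - norm (y - x0))" using y1 by (intro mult_left_mono) auto
        moreover have "exp (u y) * (\<sigma> / 2) = exp (u y) * \<sigma> / 2" by simp
        ultimately have "exp (u y) * \<sigma> \<le> (2 * exp (u z)) * \<sigma>" by linarith
        then have "exp (u y) \<le> 2 / r" using s0 by (simp add: r_def exp_minus field_simps)
        then have "(exp (u y))\<^sup>2 \<le> (2 / r)\<^sup>2" by (intro power_mono) auto
        then have "exp (2 * u y) \<le> 4 / r\<^sup>2" by (simp add: exp_double power_divide)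
        then have "K_plus * exp (2 * u y) \<le> K_plus * (4 / r\<^sup>2)" by (intro mult_left_mono) (auto simp: K_plus_def)
        also have "\<dots> = 4 * K_plus / r\<^sup>2" by simp
        finally have "max (f y) 0 \<le> 4 * K_plus / r\<^sup>2" using f_plus_le[of y] by linarith
        moreover have "\<bar>max (f y) 0\<bar> = max (f y) 0" by simp
        ultimately show ?thesis by linarith
      qed
      have [measurable]: "(\<lambda>y. max (f y) 0) \<in> borel_measurable borel" by measurable

      have I1: "integrable lborel (\<lambda>y. ln_cut r (norm (y - z)) * max (f y) 0)"
        by (rule ln_cut_cont_integrable[OF r0]) (auto intro!: continuous_intros f_cont)
      have I2: "integrable lborel (\<lambda>y. ln_cut 1 (norm (y - z)) * max (f y) 0)"
        by (rule ln_cut_cont_integrable) (auto intro!: continuous_intros f_cont)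
      have I3: "integrable lborel (\<lambda>y. indicator {y. R \<le> norm y} y * \<bar>f y\<bar>)"
        by (rule Bochner_Integration.integrable_bound[OF f_int]) (auto simp: indicator_def)
      have "exp (- u z) \<le> 1" using r1 s unfolding r_def by linarith
      then have uz: "0 \<le> u z" by simp
      have "(LINT y|lborel. ln_cut 1 (norm (y - z)) * max (f y) 0)
         \<le> (LINT y|lborel. ln_cut r (norm (y - z)) * max (f y) 0 + u z * (indicator {y. R \<le> norm y} y * \<bar>f y\<bar>))"
      proof (rule integral_mono_AE)
        show "AE y in lborel. ln_cut 1 (norm (y - z)) * max (f y) 0 \<le> ln_cut r (norm (y - z)) * max (f y) 0 + u z * (indicator {y. R \<le> norm y} y * \<bar>f y\<bar>)"
          using AE_lborel_singleton[of z]
        proof eventually_elim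
          case (elim y)
          have "ln_cut 1 (norm (y - z)) \<le> ln_cut r (norm (y - z)) + (if norm (y - z) < 1 then - ln r else 0)"
            using r0 r1 s(2) elim by (intro ln_cut_split) auto
          also have "- ln r = u z" by (simp add: r_def)
          also have "(if norm (y - z) < 1 then u z else 0) \<le> u z * indicator {y. R \<le> norm y} y"
          proof (cases "norm (y - z) < 1")
            case True
            have "norm x0 \<le> norm (x0 - z) + norm (z - y) + norm y"
              using norm_triangle_ineq[of "x0 - z" z] norm_triangle_ineq[of "z - y" y] by simp
            then have "R \<le> norm y" using True x0 z by (simp add: dist_norm norm_minus_commute)
            then show ?thesis using uz by simp
          qed (use uz in auto)
          finally have "ln_cut 1 (norm (y - z)) * max (f y) 0 \<le> (ln_cut r (norm (y - z)) + u z * indicator {y. R \<le> norm y} y) * max (f y) 0"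
            by (intro mult_right_mono) auto
          also have "\<dots> = ln_cut r (norm (y - z)) * max (f y) 0 + u z * indicator {y. R \<le> norm y} y * max (f y) 0"
            by (simp add: algebra_simps)
          also have "\<dots> \<le> ln_cut r (norm (y - z)) * max (f y) 0 + u z * indicator {y. R \<le> norm y} y * \<bar>f y\<bar>"
            using uz by (intro add_left_mono mult_left_mono) auto
          finally show ?case by (simp add: mult.assoc)
        qed
      qed (use I1 I2 I3 in auto)
      also have "\<dots> = (LINT y|lborel. ln_cut r (norm (y - z)) * max (f y) 0) + u z * (LINT y|lborel. indicator {y. R \<le> norm y} y * \<bar>f y\<bar>)"
        using I1 I3 by simp
      \<comment> \<open>The choice \<open>r = exp (- u z)\<close> makes the bound on the density of
        order 1/r^2, which the kernel integral of order r^2 cancels.\<close>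
      also have "\<dots> \<le> 2 * pi * r\<^sup>2 * (4 * K_plus / r\<^sup>2) + u z * pi"
        using ln_cut_mult_integrable(2)[OF r0 _ M] R uz by (intro add_mono mult_left_mono) auto
      also have "\<dots> = 8 * pi * K_plus + u z * pi" using r0 by simp
      finally have "2 * pi * u z \<le> 2 * B + (8 * pi * K_plus + u z * pi)" using u_le[of z] by linarith
      then have "u z \<le> U1" unfolding U1_def using pi_gt_zero by (simp add: pos_le_divide_eq algebra_simps)
      moreover have "exp (u x0) \<le> exp (u z)" using xQ mult_left_mono[OF s(2) exp_ge_zero[of "u z"]] unfolding Q_def by linarith
      ultimately show ?thesis by simp
    qed
  qed
  then show ?thesis by blast
qed

lemma u_bounded: "\<exists>U. \<forall>x. u x \<le> U"
proof -
  obtain R U where RU: "\<And>x. R \<le> norm x \<Longrightarrow> u x \<le> U" using u_bounded_far by blast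
  have "bounded (u ` cball 0 R)" by (intro compact_imp_bounded compact_continuous_image cont_u) auto
  then obtain M where M': "\<forall>z\<in>u ` cball 0 R. norm z \<le> M" unfolding bounded_iff by blast
  have M: "\<bar>u x\<bar> \<le> M" if "norm x \<le> R" for x using M' that by simp
  have "u x \<le> max U M" for x using RU[of x] M[of x] by (cases "R \<le> norm x") auto
  then show ?thesis by blast
qed

lemma f_le: "\<exists>G\<ge>0. \<forall>x. f x \<le> G"
proof -
  obtain U where U: "\<And>x. u x \<le> U" using u_bounded by blast
  have "f x \<le> K_plus * exp (2 * U)" for x
  proof -
    have "f x \<le> K_plus * exp (2 * u x)" using f_plus_le[of x] by simp
    also have "\<dots> \<le> K_plus * exp (2 * U)" using U[of x] by (intro mult_left_mono) (auto simp: K_plus_def)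
    finally show ?thesis .
  qed
  then show ?thesis by (intro exI[of _ "K_plus * exp (2 * U)"]) (auto simp: K_plus_def)
qed

end

section \<open>The logarithmic kernel seen from a distant point\<close>

lemma log_kernel_near:
  assumes "2 * R1 \<le> norm x" "norm y < R1"
  shows "\<bar>ln (norm (x::real^2)) - ln (norm (y - x))\<bar> \<le> ln 2"
proof -
  have x: "0 < norm x" using assms norm_ge_zero[of y] by linarith
  have 1: "norm (y - x) \<le> norm x * 2" "norm x \<le> norm (y - x) * 2"
    using norm_triangle_ineq4[of y x] norm_triangle_ineq2[of x y] assms by (auto simp: norm_minus_commute)
  then have y: "0 < norm (y - x)" using x by linarith
  have "ln (norm (y - x)) \<le> ln (norm x * 2)" "ln (norm x) \<le> ln (norm (y - x) * 2)"
    using 1 x y by auto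
  then show ?thesis using x y by (simp add: ln_mult)
qed

text \<open>Once the pole at \<open>x\<close> is removed by \<open>ln_cut 1\<close>, the growth in
  \<open>y\<close> cancels. The constant 3 is 1 + 2, where
  \<open>ln (1 + norm x) \<le> 2 * ln (norm x)\<close> holds because \<open>norm x\<close> is at
  least 2.\<close>

lemma log_kernel_far:
  assumes x: "2 \<le> norm (x::real^2)" and y: "1 \<le> norm y" "y \<noteq> x"
  shows "\<bar>ln (norm x) + ln (norm y) - ln (norm (y - x)) - ln_cut 1 (norm (y - x))\<bar> \<le> 3 * ln (norm x)"
proof -
  define s where "s = norm (y - x)"
  have s0: "0 < s" using y by (simp add: s_def)
  have tri: "norm y \<le> norm x + s" using norm_triangle_ineq[of x "y - x"] by (simp add: s_def)
  have l0: "0 \<le> ln (norm x)" "0 \<le> ln (norm y)" using x y by auto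
  have "1 + norm x \<le> norm x * norm x"
    using mult_right_mono[of 2 "norm x" "norm x"] x by linarith
  then have "ln (1 + norm x) \<le> ln (norm x * norm x)" using x by (subst ln_le_cancel_iff) auto
  moreover have "x \<noteq> 0" using x by auto
  ultimately have lx: "ln (1 + norm x) \<le> 2 * ln (norm x)" by (simp add: ln_mult)
  show ?thesis
  proof (cases "s < 1")
    case True
    have "ln (norm y) \<le> ln (1 + norm x)" using tri True y by (subst ln_le_cancel_iff) auto
    moreover have "ln_cut 1 s = - ln s" using True s0 by (simp add: ln_cut_eq)
    ultimately show ?thesis using lx l0 by (simp add: s_def[symmetric])
  next
    case False
    have "norm x + s \<le> s * (1 + norm x)" using mult_right_mono[of 1 s "norm x"] False by (simp add: algebra_simps)
    then have "ln (norm y) \<le> ln (s * (1 + norm x))" using tri y s0 by (subst ln_le_cancel_iff) auto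
    also have "\<dots> = ln s + ln (1 + norm x)" using s0 x by (subst ln_mult) auto
    finally have up: "ln (norm y) \<le> ln s + ln (1 + norm x)" .
    have "s \<le> norm x + norm y" using norm_triangle_ineq4[of y x] by (simp add: s_def)
    also have "\<dots> \<le> norm x * norm x * norm y"
    proof -
      have a: "norm x * 1 \<le> norm x * norm y" using y by (intro mult_left_mono) auto
      have b: "1 * norm y \<le> norm x * norm y" using x by (intro mult_right_mono) auto
      have c: "2 * (norm x * norm y) \<le> norm x * (norm x * norm y)" using x by (intro mult_right_mono) auto
      from a b c show ?thesis by (simp add: mult.assoc)
    qed
    finally have "ln s \<le> ln (norm x * norm x * norm y)" using s0 x y by (subst ln_le_cancel_iff) auto
    also have "\<dots> = 2 * ln (norm x) + ln (norm y)"
    proof -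
      have "x \<noteq> 0" "y \<noteq> 0" using x y by auto
      then show ?thesis by (simp add: ln_mult)
    qed
    finally have "ln s \<le> 2 * ln (norm x) + ln (norm y)" .
    moreover have "ln_cut 1 s = 0" using False by (simp add: ln_cut_zero)
    ultimately show ?thesis using up lx l0 by (simp add: s_def[symmetric])
  qed
qed

text \<open>One-sided on purpose: near the pole at \<open>x\<close> the kernel is positive and
  \<open>g\<close> is bounded only from above. Points \<open>y\<close> near the origin contribute a
  bounded error to the leading term, points far out at most \<open>3 * ln (norm x)\<close> times a
  small tail mass. It serves first for \<open>f\<close> and later for \<open>-f\<close>.\<close>

lemma log_potential_upper:
  fixes g :: "real^2 \<Rightarrow> real"
  assumes cont: "continuous_on UNIV g" and int: "integrable lborel g" and G: "0 \<le> G" "\<And>y. g y \<le> G"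
    and kint: "\<And>x. integrable lborel (\<lambda>y. (ln (norm y) - ln (norm (y - x))) * g y)" and e: "0 < e"
  shows "\<exists>C R. 2 \<le> R \<and> (\<forall>x. R \<le> norm x \<longrightarrow>
    (LINT y|lborel. (ln (norm y) - ln (norm (y - x))) * g y) \<le> (- (LINT y|lborel. g y) + e) * ln (norm x) + C)"
proof -
  \<comment> \<open>A third of \<open>e\<close>, to compensate the factor 3 of
    \<open>log_kernel_far\<close>.\<close>
  obtain R1 where R1: "1 \<le> R1" and tail: "(LINT y|lborel. indicator {y. R1 \<le> norm y} y * \<bar>g y\<bar>) < e / 3"
    using integral_tail_small[OF int, of "e / 3"] e by auto
  have [measurable]: "g \<in> borel_measurable borel" using cont by (rule borel_measurable_continuous_onI)
  define c1 where "c1 = (ln 2 + ln R1) * (LINT y|lborel. \<bar>g y\<bar>)"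
  define c2 where "c2 = (LINT y|lborel. ln_cut 1 (norm (y - 0)) * \<bar>g y\<bar>)"
  have I2: "integrable lborel (\<lambda>y. ln_cut 1 (norm (y - 0)) * \<bar>g y\<bar>)"
    by (rule ln_cut_cont_integrable) (auto intro!: continuous_intros cont)
  have I3: "integrable lborel (\<lambda>y. indicator {y. R1 \<le> norm y} y * \<bar>g y\<bar>)"
    by (rule Bochner_Integration.integrable_bound[OF int]) (auto simp: indicator_def)
  have "(LINT y|lborel. (ln (norm y) - ln (norm (y - x))) * g y) \<le> (- (LINT y|lborel. g y) + e) * ln (norm x) + (c1 + c2 + 2 * pi * G)"
    if x: "2 * R1 \<le> norm x" for x
  proof -
    have x2: "2 \<le> norm x" using x R1 by simp
    have lx: "0 \<le> ln (norm x)" using x2 by simp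
    have I4: "integrable lborel (\<lambda>y. ln_cut 1 (norm (y - x)) * G)" using ln_cut_integrable(1)[of 1 x] by simp
    let ?b = "\<lambda>y. (ln 2 + ln R1) * \<bar>g y\<bar> + ln_cut 1 (norm (y - 0)) * \<bar>g y\<bar>
       + 3 * ln (norm x) * (indicator {y. R1 \<le> norm y} y * \<bar>g y\<bar>) + ln_cut 1 (norm (y - x)) * G"
    have "(LINT y|lborel. (ln (norm y) - ln (norm (y - x))) * g y) + ln (norm x) * (LINT y|lborel. g y)
      = (LINT y|lborel. (ln (norm y) - ln (norm (y - x))) * g y + ln (norm x) * g y)"
      using kint[of x] int by simp
    also have "\<dots> \<le> (LINT y|lborel. ?b y)"
    proof (rule integral_mono_AE)
      show "integrable lborel (\<lambda>y. (ln (norm y) - ln (norm (y - x))) * g y + ln (norm x) * g y)" using kint[of x] int by simp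
      show "integrable lborel ?b" using int I2 I3 I4 by simp
      show "AE y in lborel. (ln (norm y) - ln (norm (y - x))) * g y + ln (norm x) * g y \<le> ?b y"
        using AE_lborel_singleton[of x] AE_lborel_singleton[of 0]
      proof eventually_elim
        case (elim y)
        have eq: "(ln (norm y) - ln (norm (y - x))) * g y + ln (norm x) * g y = (ln (norm x) + ln (norm y) - ln (norm (y - x))) * g y"
          by (simp add: algebra_simps)
        have l: "0 \<le> ln R1" "0 \<le> ln (2::real)" using R1 by auto
        show ?case
        proof (cases "norm y < R1")
          case True
          have "\<bar>ln (norm y)\<bar> \<le> ln R1 + ln_cut 1 (norm y)"
          proof (cases "1 \<le> norm y")
            case t: True
            then have "ln (norm y) \<le> ln R1" using True by (subst ln_le_cancel_iff) auto
            then show ?thesis using t by (simp add: add_increasing2)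
          next
            case f: False
            then have "ln_cut 1 (norm y) = - ln (norm y)" using elim by (simp add: ln_cut_eq)
            moreover have "ln (norm y) \<le> 0" using f elim by simp
            ultimately show ?thesis using l by simp
          qed
          with log_kernel_near[OF x True]
          have kb: "\<bar>ln (norm x) + ln (norm y) - ln (norm (y - x))\<bar> \<le> ln 2 + ln R1 + ln_cut 1 (norm y)" by linarith
          have "(ln (norm x) + ln (norm y) - ln (norm (y - x))) * g y \<le> (ln 2 + ln R1 + ln_cut 1 (norm y)) * \<bar>g y\<bar>"
            by (rule order_trans[OF abs_ge_self]) (use kb in \<open>simp add: abs_mult mult_right_mono\<close>)
          moreover have "0 \<le> ln_cut 1 (norm (y - x)) * G" using G by simp
          ultimately show ?thesis unfolding eq using True by (simp add: algebra_simps)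
        next
          case False
          let ?K1 = "ln (norm x) + ln (norm y) - ln (norm (y - x)) - ln_cut 1 (norm (y - x))"
          have "(ln (norm x) + ln (norm y) - ln (norm (y - x))) * g y = ?K1 * g y + ln_cut 1 (norm (y - x)) * g y"
            by (simp add: algebra_simps)
          moreover have "?K1 * g y \<le> 3 * ln (norm x) * \<bar>g y\<bar>"
            by (rule order_trans[OF abs_ge_self])
              (use log_kernel_far[OF x2, of y] False R1 elim in \<open>simp add: abs_mult mult_right_mono\<close>)
          moreover have "ln_cut 1 (norm (y - x)) * g y \<le> ln_cut 1 (norm (y - x)) * G" using G by (intro mult_left_mono) auto
          moreover have "0 \<le> (ln 2 + ln R1) * \<bar>g y\<bar>" "0 \<le> ln_cut 1 (norm (y - 0)) * \<bar>g y\<bar>" using l by auto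
          moreover have ind: "indicator {y. R1 \<le> norm y} y = (1::real)" using False by simp
          ultimately show ?thesis unfolding eq ind mult_1_left by linarith
        qed
      qed
    qed
    also have "\<dots> = c1 + c2 + 3 * ln (norm x) * (LINT y|lborel. indicator {y. R1 \<le> norm y} y * \<bar>g y\<bar>) + (LINT y|lborel. ln_cut 1 (norm (y - x)) * G)"
      unfolding c1_def c2_def using int I2 I3 I4 by simp
    also have "\<dots> \<le> c1 + c2 + 3 * ln (norm x) * (e / 3) + 2 * pi * G"
    proof (intro add_mono order_refl mult_left_mono)
      show "(LINT y|lborel. ln_cut 1 (norm (y - x)) * G) \<le> 2 * pi * G"
        using mult_right_mono[OF ln_cut_integrable(2)[of 1 x] G(1)] by simp
    qed (use tail lx in auto)
    finally show ?thesis by (simp add: algebra_simps)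
  qed
  then show ?thesis using R1 by (intro exI[of _ "c1 + c2 + 2 * pi * G"] exI[of _ "2 * R1"]) auto
qed

context liouville_mono
begin

definition total_mass where "total_mass = (LINT x|lborel. f x)"

lemma k0_int: "integrable lborel (\<lambda>y. (ln (norm y) - ln (norm (y - x))) * f y)"
  using log_ratio_f_int[of x 0] by (simp add: log_ratio_def)

lemma u_formula: "2 * pi * u x = 2 * pi * u 0 + (LINT y|lborel. (ln (norm y) - ln (norm (y - x))) * f y)"
  using representation[of x 0] by (simp add: log_ratio_def algebra_simps)

lemma u_upper:
  assumes e: "0 < e"
  shows "\<exists>C R. 2 \<le> R \<and> (\<forall>x. R \<le> norm x \<longrightarrow> u x \<le> (- total_mass / (2 * pi) + e) * ln (norm x) + C)"
proof -
  obtain G where G: "0 \<le> G" "\<And>x. f x \<le> G" using f_le by blast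
  obtain C R where R: "2 \<le> R" and CR: "\<And>x. R \<le> norm x \<Longrightarrow>
    (LINT y|lborel. (ln (norm y) - ln (norm (y - x))) * f y) \<le> (- total_mass + 2 * pi * e) * ln (norm x) + C"
    using log_potential_upper[OF f_cont f_int G k0_int, of "2 * pi * e"] e unfolding total_mass_def by auto
  have "u x \<le> (- total_mass / (2 * pi) + e) * ln (norm x) + (u 0 + C / (2 * pi))" if "R \<le> norm x" for x
  proof -
    have "2 * pi * ((- total_mass / (2 * pi) + e) * ln (norm x) + (u 0 + C / (2 * pi)))
       = (- total_mass + 2 * pi * e) * ln (norm x) + 2 * pi * u 0 + C" by (simp add: field_simps)
    then have "2 * pi * u x \<le> 2 * pi * ((- total_mass / (2 * pi) + e) * ln (norm x) + (u 0 + C / (2 * pi)))"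
      using u_formula[of x] CR[OF that] by linarith
    then show ?thesis using pi_gt_zero by (simp only: mult_le_cancel_left_pos mult_pos_pos zero_less_numeral)
  qed
  then show ?thesis using R by blast
qed

text \<open>Chebyshev's argument: the weighted integral of \<open>|K|\<close> is at least the value
  at \<open>x\<close> times the weight times the area of \<open>S\<close>. On
  \<open>ball 0 (2 * r)\<close> the weight is at least \<open>(4 * r) powr (- q)\<close>, since 1 +
  2r is at most 4r.\<close>

lemma K_bound_aux:
  assumes r: "1 \<le> r" and S [measurable]: "S \<in> sets borel" and sub: "S \<subseteq> ball 0 (2 * r)"
    and m: "r\<^sup>2 \<le> measure lborel S" and K: "\<And>y. y \<in> S \<Longrightarrow> \<bar>K x\<bar> \<le> \<bar>K y\<bar>"
  shows "\<bar>K x\<bar> \<le> (LINT x|lborel. \<bar>K x\<bar> * (1 + norm x) powr (- q)) * 4 powr q * r powr (q - 2)"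
proof -
  let ?M = "LINT x|lborel. \<bar>K x\<bar> * (1 + norm x) powr (- q)"
  have fin: "emeasure lborel S < \<infinity>"
    by (rule le_less_trans[OF emeasure_mono[OF sub]]) (use r in \<open>auto simp: emeasure_ball2\<close>)
  have "\<bar>K x\<bar> * (4 * r) powr (- q) * r\<^sup>2 \<le> \<bar>K x\<bar> * (4 * r) powr (- q) * measure lborel S"
    using m by (intro mult_left_mono) auto
  also have "\<dots> = (LINT y|lborel. \<bar>K x\<bar> * (4 * r) powr (- q) * indicator S y)"
    by simp
  also have "\<dots> \<le> ?M"
  proof (rule integral_mono[OF _ q_int])
    show "integrable lborel (\<lambda>y. \<bar>K x\<bar> * (4 * r) powr (- q) * indicator S y)" using fin by simp
    fix y
    show "\<bar>K x\<bar> * (4 * r) powr (- q) * indicator S y \<le> \<bar>K y\<bar> * (1 + norm y) powr (- q)"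
    proof (cases "y \<in> S")
      case True
      then have "norm y < 2 * r" using sub by auto
      then have "(4 * r) powr (- q) \<le> (1 + norm y) powr (- q)" using r q0 norm_ge_zero[of y]
        by (intro powr_mono2') linarith+
      then show ?thesis using K[OF True] True by (simp add: mult_mono)
    qed simp
  qed
  finally have le: "\<bar>K x\<bar> * (4 * r) powr (- q) * r\<^sup>2 \<le> ?M" .
  have "\<bar>K x\<bar> = \<bar>K x\<bar> * (4 * r) powr (- q) * r\<^sup>2 * (4 powr q * r powr (q - 2))"
  proof -
    have "r\<^sup>2 = r powr 2" using r by simp
    then have "(4 * r) powr (- q) * r\<^sup>2 * (4 powr q * r powr (q - 2)) = (4 powr (- q) * 4 powr q) * (r powr (- q) * r powr 2 * r powr (q - 2))"
      using r by (simp add: powr_mult)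
    also have "4 powr (- q) * 4 powr q = (1::real)" by (simp flip: powr_add)
    also have "r powr (- q) * r powr 2 * r powr (q - 2) = r powr (- q + 2 + (q - 2))" by (simp only: powr_add)
    also have "r powr (- q + 2 + (q - 2)) = 1" using r by simp
    finally show ?thesis by (simp add: mult.assoc)
  qed
  also have "\<dots> \<le> ?M * (4 powr q * r powr (q - 2))" using le by (intro mult_right_mono) auto
  finally show ?thesis by (simp add: mult.assoc)
qed

text \<open>Since K decreases radially, its modulus is monotone near infinity, whichever sign K has there;
  so integrability of K against a power of the distance becomes a pointwise bound.\<close>

lemma K_bound: "\<exists>C R. 0 \<le> C \<and> 1 \<le> R \<and> (\<forall>x. R \<le> norm x \<longrightarrow> \<bar>K x\<bar> \<le> C * norm x powr (q - 2))"
proof -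
  let ?C = "(LINT x|lborel. \<bar>K x\<bar> * (1 + norm x) powr (- q)) * 4 powr q"
  have C0: "0 \<le> ?C" by (intro mult_nonneg_nonneg Bochner_Integration.integral_nonneg) auto
  have meas: "measure lborel (ball (0::real^2) b - ball 0 a) = pi * (b\<^sup>2 - a\<^sup>2)" if "0 \<le> a" "a \<le> b" for a b
    using that by (subst measure_Diff) (auto simp: measure_ball2 emeasure_ball2 subset_ball algebra_simps)
  have pi4: "1 \<le> pi * (3 / 4)" using pi_gt3 by simp
  \<comment> \<open>If \<open>K\<close> is positive everywhere, \<open>|K|\<close> is larger on the
    annulus just inside \<open>x\<close>; otherwise \<open>K\<close> is nonpositive from some
    \<open>x1\<close> outwards and \<open>|K|\<close> is larger on the annulus just outside. Both
    annuli have area at least \<open>(norm x)\<^sup>2\<close>.\<close>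
  show ?thesis
  proof (cases "\<forall>x. 0 < K x")
    case True
    have "\<bar>K x\<bar> \<le> ?C * norm x powr (q - 2)" if x: "1 \<le> norm x" for x
    proof (rule K_bound_aux[OF x, of "ball 0 (norm x) - ball 0 (norm x / 2)"])
      have "measure lborel (ball (0::real^2) (norm x) - ball 0 (norm x / 2)) = pi * (3 / 4) * (norm x)\<^sup>2"
        using x by (subst meas) (auto simp: power2_eq_square)
      then show "(norm x)\<^sup>2 \<le> measure lborel (ball (0::real^2) (norm x) - ball 0 (norm x / 2))"
        using mult_right_mono[OF pi4, of "(norm x)\<^sup>2"] by simp
      fix y :: "real^2" assume "y \<in> ball 0 (norm x) - ball 0 (norm x / 2)"
      then have "K x \<le> K y" by (intro K_mono) auto
      then show "\<bar>K x\<bar> \<le> \<bar>K y\<bar>" using True[rule_format, of x] by simp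
    qed (use x in auto)
    then show ?thesis using C0 by (intro exI[of _ ?C] exI[of _ 1]) auto
  next
    case False
    then obtain x1 where x1: "K x1 \<le> 0" by (auto simp: not_less)
    have "\<bar>K x\<bar> \<le> ?C * norm x powr (q - 2)" if "max 1 (norm x1) \<le> norm x" for x
    proof (rule K_bound_aux[of "norm x" "ball 0 (2 * norm x) - ball 0 (norm x)"])
      have x: "1 \<le> norm x" "norm x1 \<le> norm x" using that by auto
      then show "1 \<le> norm x" by simp
      have "measure lborel (ball (0::real^2) (2 * norm x) - ball 0 (norm x)) = pi * 3 * (norm x)\<^sup>2"
        by (subst meas) (auto simp: power2_eq_square)
      then show "(norm x)\<^sup>2 \<le> measure lborel (ball (0::real^2) (2 * norm x) - ball 0 (norm x))"
        using mult_right_mono[of 1 "pi * 3" "(norm x)\<^sup>2"] pi_gt3 by simp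
      fix y :: "real^2" assume "y \<in> ball 0 (2 * norm x) - ball 0 (norm x)"
      then have "K y \<le> K x" by (intro K_mono) auto
      moreover have "K x \<le> 0" using K_mono[OF x(2)] x1 by simp
      ultimately show "\<bar>K x\<bar> \<le> \<bar>K y\<bar>" by simp
    qed auto
    then show ?thesis using C0 by (intro exI[of _ ?C] exI[of _ "max 1 (norm x1)"]) auto
  qed
qed

text \<open>The gap between mass/pi and \<open>q\<close> is \<open>2 * \<gamma>\<close>. One half of
  it pays for the error in \<open>u_upper\<close>, the other half is the decay beyond the exponent
  -2.\<close>

lemma Kexp_decay: "\<exists>\<gamma> C R. 0 < \<gamma> \<and> 0 \<le> C \<and> 2 \<le> R \<and> (\<forall>x. R \<le> norm x \<longrightarrow> \<bar>K x\<bar> * exp (2 * u x) \<le> C * norm x powr (- 2 - \<gamma>))"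
proof -
  define \<gamma> where "\<gamma> = (total_mass / pi - q) / 2"
  have g: "0 < \<gamma>" using q_mass unfolding \<gamma>_def total_mass_def by (simp add: field_simps)
  obtain C1 R1 where 1: "2 \<le> R1" "\<And>x. R1 \<le> norm x \<Longrightarrow> u x \<le> (- total_mass / (2 * pi) + \<gamma> / 2) * ln (norm x) + C1"
    using u_upper[of "\<gamma> / 2"] g by auto
  obtain C2 R2 where 2: "0 \<le> C2" "\<And>x. R2 \<le> norm x \<Longrightarrow> \<bar>K x\<bar> \<le> C2 * norm x powr (q - 2)"
    using K_bound by blast
  have "\<bar>K x\<bar> * exp (2 * u x) \<le> C2 * exp (2 * C1) * norm x powr (- 2 - \<gamma>)" if x: "max R1 R2 \<le> norm x" for x
  proof -
    have x0: "0 < norm x" using x 1(1) by linarith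
    have "exp (2 * u x) \<le> exp (2 * ((- total_mass / (2 * pi) + \<gamma> / 2) * ln (norm x) + C1))"
      using 1(2)[of x] x by simp
    also have "\<dots> = exp (2 * C1) * norm x powr (2 * (- total_mass / (2 * pi) + \<gamma> / 2))"
      using x0 by (simp add: powr_def algebra_simps flip: exp_add)
    finally have e: "exp (2 * u x) \<le> exp (2 * C1) * norm x powr (2 * (- total_mass / (2 * pi) + \<gamma> / 2))" .
    have "\<bar>K x\<bar> * exp (2 * u x) \<le> (C2 * norm x powr (q - 2)) * (exp (2 * C1) * norm x powr (2 * (- total_mass / (2 * pi) + \<gamma> / 2)))"
      using 2 x by (intro mult_mono e) auto
    also have "\<dots> = C2 * exp (2 * C1) * norm x powr (q - 2 + 2 * (- total_mass / (2 * pi) + \<gamma> / 2))"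
      by (simp add: powr_add)
    also have "q - 2 + 2 * (- total_mass / (2 * pi) + \<gamma> / 2) = - 2 - \<gamma>" by (simp add: \<gamma>_def field_simps)
    finally show ?thesis .
  qed
  then show ?thesis using g 1(1) 2(1) by (intro exI[of _ \<gamma>] exI[of _ "C2 * exp (2 * C1)"] exI[of _ "max R1 R2"]) auto
qed

text \<open>Unlike the upper bound, this cannot come from a bound on \<open>K\<close>, which may
  tend to minus infinity; it comes from the decay at infinity and compactness.\<close>

lemma f_ge: "\<exists>G\<ge>0. \<forall>x. - f x \<le> G"
proof -
  obtain \<gamma> C R where 1: "0 < \<gamma>" "0 \<le> C" "2 \<le> R" "\<And>x. R \<le> norm x \<Longrightarrow> \<bar>K x\<bar> * exp (2 * u x) \<le> C * norm x powr (- 2 - \<gamma>)"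
    using Kexp_decay by blast
  have "bounded (f ` cball 0 R)" by (intro compact_imp_bounded compact_continuous_image f_cont) auto
  then obtain M where M': "\<forall>z\<in>f ` cball 0 R. norm z \<le> M" unfolding bounded_iff by blast
  have M: "\<bar>f x\<bar> \<le> M" if "norm x \<le> R" for x using M' that by simp
  have "- f x \<le> max C M" for x
  proof (cases "R \<le> norm x")
    case True
    have "- f x \<le> \<bar>K x\<bar> * exp (2 * u x)" using abs_ge_minus_self[of "f x"] by (simp add: f_def abs_mult)
    also have "\<dots> \<le> C * norm x powr (- 2 - \<gamma>)" using 1(4)[OF True] .
    also have "\<dots> \<le> C * 1"
    proof (rule mult_left_mono[OF _ 1(2)])
      have "norm x powr (- 2 - \<gamma>) \<le> norm x powr 0" using 1(1,3) True by (intro powr_mono) auto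
      also have "\<dots> = 1" using 1(3) True by auto
      finally show "norm x powr (- 2 - \<gamma>) \<le> 1" .
    qed
    finally show ?thesis by simp
  next
    case False
    then show ?thesis using M[of x] by simp
  qed
  moreover have "0 \<le> max C M" using 1(2) by simp
  ultimately show ?thesis by blast
qed

text \<open>The upper half is \<open>u_upper\<close>. For the lower half \<open>f_ge\<close> makes
  \<open>log_potential_upper\<close> applicable to \<open>-f\<close>.\<close>

theorem u_asymptotics:
  assumes e: "0 < e"
  shows "\<exists>C R. 2 \<le> R \<and> (\<forall>x. R \<le> norm x \<longrightarrow> \<bar>u x + total_mass / (2 * pi) * ln (norm x)\<bar> \<le> e * ln (norm x) + C)"
proof -
  obtain C1 R1 where 1: "2 \<le> R1" "\<And>x. R1 \<le> norm x \<Longrightarrow> u x \<le> (- total_mass / (2 * pi) + e) * ln (norm x) + C1"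
    using u_upper[OF e] by blast
  obtain G where G: "0 \<le> G" "\<And>x. - f x \<le> G" using f_ge by blast
  have "integrable lborel (\<lambda>y. - ((ln (norm y) - ln (norm (y - x))) * f y))" for x
    using k0_int[of x] by simp
  then have int: "integrable lborel (\<lambda>y. (ln (norm y) - ln (norm (y - x))) * - f y)" for x
    by (simp only: mult_minus_right)
  have "continuous_on UNIV (\<lambda>y. - f y)" "integrable lborel (\<lambda>y. - f y)"
    using f_cont f_int by (auto intro: continuous_intros)
  from log_potential_upper[OF this G int, of "2 * pi * e"] e
  obtain C R where R: "2 \<le> R" and CR: "\<And>x. R \<le> norm x \<Longrightarrow>
    - (LINT y|lborel. (ln (norm y) - ln (norm (y - x))) * f y) \<le> (total_mass + 2 * pi * e) * ln (norm x) + C"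
    unfolding total_mass_def by auto
  have low: "- u x \<le> (total_mass / (2 * pi) + e) * ln (norm x) + (- u 0 + C / (2 * pi))" if "R \<le> norm x" for x
  proof -
    have "2 * pi * ((total_mass / (2 * pi) + e) * ln (norm x) + (- u 0 + C / (2 * pi)))
       = (total_mass + 2 * pi * e) * ln (norm x) - 2 * pi * u 0 + C" by (simp add: field_simps)
    then have "2 * pi * (- u x) \<le> 2 * pi * ((total_mass / (2 * pi) + e) * ln (norm x) + (- u 0 + C / (2 * pi)))"
      using u_formula[of x] CR[OF that] by linarith
    then show ?thesis using pi_gt_zero by (simp only: mult_le_cancel_left_pos mult_pos_pos zero_less_numeral)
  qed
  have "\<bar>u x + total_mass / (2 * pi) * ln (norm x)\<bar> \<le> e * ln (norm x) + max C1 (- u 0 + C / (2 * pi))"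
    if "max R1 R \<le> norm x" for x
  proof -
    have "u x + total_mass / (2 * pi) * ln (norm x) \<le> e * ln (norm x) + C1"
      using 1(2)[of x] that by (simp add: algebra_simps)
    moreover have "- (u x + total_mass / (2 * pi) * ln (norm x)) \<le> e * ln (norm x) + (- u 0 + C / (2 * pi))"
      using low[of x] that by (simp add: algebra_simps)
    ultimately show ?thesis
      using max.cobounded1[of C1 "- u 0 + C / (2 * pi)"] max.cobounded2[of "- u 0 + C / (2 * pi)" C1] by linarith
  qed
  then show ?thesis using R by (intro exI[of _ "max C1 (- u 0 + C / (2 * pi))"] exI[of _ "max R1 R"]) auto
qed

end

section \<open>Reflections and the Hopf lemma\<close>

definition reflect :: "real^2 \<Rightarrow> real \<Rightarrow> real^2 \<Rightarrow> real^2" where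
  "reflect e l x = x + (2 * (l - x \<bullet> e)) *\<^sub>R e"

lemma inner_self_unit: "norm (e::real^2) = 1 \<Longrightarrow> e \<bullet> e = 1"
  by (simp add: dot_square_norm)

lemma perp_inner [simp]: "perp e \<bullet> e = 0" "e \<bullet> perp e = 0"
  by (simp_all add: inner2)

lemma reflect_inner: "norm e = 1 \<Longrightarrow> reflect e l x \<bullet> e = 2 * l - x \<bullet> e"
  by (simp add: reflect_def inner_add_left inner_self_unit)

lemma reflect_reflect: "norm e = 1 \<Longrightarrow> reflect e l (reflect e l x) = x"
  by (subst reflect_def, subst reflect_inner) (simp_all add: reflect_def flip: scaleR_add_left)

lemma reflect_fixed: "x \<bullet> e = l \<Longrightarrow> reflect e l x = x"
  by (simp add: reflect_def)

lemma norm_add_scale_sq: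
  fixes a v :: "'a::real_inner"
  assumes "norm v = 1" shows "(norm (a + t *\<^sub>R v))\<^sup>2 = (norm a)\<^sup>2 + 2 * t * (a \<bullet> v) + t\<^sup>2"
proof -
  have "v \<bullet> v = 1" using assms by (simp add: dot_square_norm)
  then show ?thesis unfolding power2_norm_eq_inner
    by (simp add: inner_add_left inner_add_right inner_commute[of v a] power2_eq_square distrib_left)
qed

lemma norm_reflect_sq: "norm e = 1 \<Longrightarrow> (norm (reflect e l x))\<^sup>2 = (norm x)\<^sup>2 + 4 * l * (l - x \<bullet> e)"
  unfolding reflect_def by (subst norm_add_scale_sq) (auto simp: algebra_simps power2_eq_square[of "2 * _"] power2_eq_square)

lemma norm_reflect_le:
  assumes "norm e = 1" "0 \<le> l" "l \<le> x \<bullet> e" shows "norm (reflect e l x) \<le> norm x"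
proof -
  have "l * (l - x \<bullet> e) \<le> 0" using assms by (intro mult_nonneg_nonpos) auto
  then have "(norm (reflect e l x))\<^sup>2 \<le> (norm x)\<^sup>2" using norm_reflect_sq[OF assms(1), of l x] by simp
  then show ?thesis by (rule power2_le_imp_le) simp
qed

lemma norm_reflect_bounds:
  assumes e: "norm e = 1"
  shows "norm (reflect e l x) \<le> norm x + 2 * \<bar>l\<bar>" "norm x \<le> norm (reflect e l x) + 2 * \<bar>l\<bar>"
proof -
  have 1: "norm (reflect e l x) \<le> norm x + 2 * \<bar>l\<bar>" for x
  proof -
    have "(norm (reflect e 0 x))\<^sup>2 = (norm x)\<^sup>2" using norm_reflect_sq[OF e, of 0 x] by simp
    then have "norm (reflect e 0 x) = norm x" by (simp add: power2_eq_iff_nonneg)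
    moreover have "reflect e l x = reflect e 0 x + (2 * l) *\<^sub>R e" by (simp add: reflect_def algebra_simps)
    ultimately show ?thesis using norm_triangle_ineq[of "reflect e 0 x" "(2 * l) *\<^sub>R e"] e by simp
  qed
  show "norm (reflect e l x) \<le> norm x + 2 * \<bar>l\<bar>" by (rule 1)
  show "norm x \<le> norm (reflect e l x) + 2 * \<bar>l\<bar>" using 1[of "reflect e l x"] by (simp add: reflect_reflect e)
qed

lemma reflect_add_scale: "reflect e l (x + t *\<^sub>R v) = reflect e l x + t *\<^sub>R (v - (2 * (v \<bullet> e)) *\<^sub>R e)"
  by (simp add: reflect_def inner_add_left algebra_simps)

lemma continuous_reflect [continuous_intros]:
  "continuous_on S f \<Longrightarrow> continuous_on S g \<Longrightarrow> continuous_on S (\<lambda>z. reflect e (f z) (g z))"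
  unfolding reflect_def by (intro continuous_intros)

lemma frame_parseval:
  assumes "norm e = 1" shows "(y \<bullet> e)\<^sup>2 + (y \<bullet> perp e)\<^sup>2 = (norm y)\<^sup>2"
proof -
  have "(e$1)\<^sup>2 + (e$2)\<^sup>2 = 1" using assms by (simp add: norm2)
  then have "(norm y)\<^sup>2 = ((y$1)\<^sup>2 + (y$2)\<^sup>2) * ((e$1)\<^sup>2 + (e$2)\<^sup>2)" by (simp add: norm2)
  then show ?thesis by (simp add: inner2 power2_eq_square algebra_simps)
qed

lemma norm_perp: "norm (perp e) = norm e"
  by (simp add: norm2 add.commute)

lemma second_derivative_test:
  fixes \<phi> :: "real \<Rightarrow> real"
  assumes d1: "\<And>t. (\<phi> has_real_derivative \<phi>' t) (at t)" and d2: "(\<phi>' has_real_derivative c) (at 0)"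
    and d: "0 < \<delta>" and min: "\<And>t. \<bar>t\<bar> < \<delta> \<Longrightarrow> \<phi> 0 \<le> \<phi> t"
  shows "0 \<le> c"
proof (rule ccontr)
  assume "\<not> 0 \<le> c"
  then have c: "c < 0" by simp
  have z: "\<phi>' 0 = 0" by (rule DERIV_local_min[OF d1[of 0] d]) (use min in auto)
  obtain \<delta>2 where d2': "0 < \<delta>2" "\<And>h. 0 < h \<Longrightarrow> h < \<delta>2 \<Longrightarrow> \<phi>' h < \<phi>' 0"
    using DERIV_neg_dec_right[OF d2 c] by auto
  define t where "t = min \<delta> \<delta>2 / 2"
  have t: "0 < t" "t < \<delta>" "t < \<delta>2" using d d2'(1) by (auto simp: t_def min_def)
  obtain s where s: "0 < s" "s < t" "\<phi> t - \<phi> 0 = (t - 0) * \<phi>' s"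
    using MVT2[OF t(1) d1] by blast
  have "\<phi>' s < 0" using d2'(2)[of s] s t z by simp
  then have "t * \<phi>' s < 0" by (rule mult_pos_neg[OF t(1)])
  then have "\<phi> t < \<phi> 0" using s(3) by simp
  then show False using min[of t] t by simp
qed

text \<open>Convexity, with the tangent taken at \<open>a\<close>: the exponential on the right is
  the one whose size is under control where the lemma is applied, whichever of \<open>a\<close> and
  \<open>b\<close> is larger.\<close>

lemma exp_diff_le: "exp (2 * a) - exp (2 * b) \<le> 2 * exp (2 * a) * (a - (b::real))"
proof -
  have "1 + 2 * (b - a) \<le> exp (2 * (b - a))" by (rule exp_ge_add_one_self)
  then have "exp (2 * a) * (1 + 2 * (b - a)) \<le> exp (2 * a) * exp (2 * (b - a))" by (intro mult_left_mono) auto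
  also have "\<dots> = exp (2 * b)" by (simp flip: exp_add)
  finally show ?thesis by (simp add: algebra_simps)
qed

lemma derivative_ge_of_linear_lower_bound:
  assumes d: "(\<phi> has_real_derivative D) (at 0)" and "\<phi> 0 = (0::real)"
    and c: "\<And>t. t \<in> {0..1/2} \<Longrightarrow> c * t \<le> \<phi> t"
  shows "c \<le> D"
proof (rule tendsto_lowerbound)
  show "((\<lambda>t. \<phi> t / t) \<longlongrightarrow> D) (at_right 0)"
    using d assms(2) by (simp add: has_field_derivative_iff filterlim_at_split)
  show "\<forall>\<^sub>F t in at_right 0. c \<le> \<phi> t / t"
    using eventually_at_right_real[of 0 "1/2::real", OF half_gt_zero[OF zero_less_one]]
  proof eventually_elim
    case (elim t)
    then show ?case using c[of t] by (simp add: pos_le_divide_eq)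
  qed
qed simp

context C2_plane
begin

definition refl_diff :: "real^2 \<Rightarrow> real \<Rightarrow> real^2 \<Rightarrow> real" where
  "refl_diff e l x = u (reflect e l x) - u x"

lemma continuous_refl_diff [continuous_intros]:
  "continuous_on S f \<Longrightarrow> continuous_on S g \<Longrightarrow> continuous_on S (\<lambda>z. refl_diff e (f z) (g z))"
  unfolding refl_diff_def by (intro continuous_intros)

lemma refl_diff_zero: "x \<bullet> e = l \<Longrightarrow> refl_diff e l x = 0"
  by (simp add: refl_diff_def reflect_fixed)

lemma refl_diff_reflect: "norm e = 1 \<Longrightarrow> refl_diff e l (reflect e l x) = - refl_diff e l x"
  by (simp add: refl_diff_def reflect_reflect)

lemma refl_diff_line: "((\<lambda>t. refl_diff e l (x + t *\<^sub>R v)) has_real_derivative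
   Du (reflect e l (x + t *\<^sub>R v)) (v - (2 * (v \<bullet> e)) *\<^sub>R e) - Du (x + t *\<^sub>R v) v) (at t)"
  unfolding refl_diff_def reflect_add_scale by (intro DERIV_diff line_d1)

text \<open>The left side is the Laplacian of \<open>H\<close> composed with the squared distance to
  \<open>z\<close>, and a local minimum has a nonnegative Laplacian. It serves for the Hopf barrier,
  for the supersolution near infinity and, with \<open>H = 0\<close>, for exact symmetry.\<close>

lemma refl_diff_comparison:
  assumes e: "norm e = 1"
    and H1: "\<And>s. 0 \<le> s \<Longrightarrow> (H has_real_derivative H1 s) (at s)"
    and H2: "\<And>s. 0 \<le> s \<Longrightarrow> (H1 has_real_derivative H2 s) (at s)"
    and d: "0 < \<delta>"
    and min: "\<And>x. dist x x0 < \<delta> \<Longrightarrow> refl_diff e l x0 - H ((norm (x0 - z))\<^sup>2) \<le> refl_diff e l x - H ((norm (x - z))\<^sup>2)"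
  shows "4 * H1 ((norm (x0 - z))\<^sup>2) + 4 * (norm (x0 - z))\<^sup>2 * H2 ((norm (x0 - z))\<^sup>2)
    \<le> laplacian u (reflect e l x0) - laplacian u x0"
proof -
  \<comment> \<open>The reflection acts on \<open>v\<close> by the sign \<open>\<sigma>\<close>,
    which is -1 for \<open>e\<close> and 1 for \<open>perp e\<close>. In a second derivative the
    sign appears squared, so the mirrored function has the Hessian diagonal of \<open>u\<close> at
    the mirror point.\<close>
  have dir: "2 * H1 ((norm (x0 - z))\<^sup>2) + 4 * ((x0 - z) \<bullet> v)\<^sup>2 * H2 ((norm (x0 - z))\<^sup>2)
     \<le> D2u (reflect e l x0) v v - D2u x0 v v"
    if v: "norm v = 1" and vr: "v - (2 * (v \<bullet> e)) *\<^sub>R e = \<sigma> *\<^sub>R v" and sg: "\<sigma> = 1 \<or> \<sigma> = -1" for v \<sigma>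
  proof -
    let ?s = "\<lambda>t. (norm (x0 - z))\<^sup>2 + 2 * t * ((x0 - z) \<bullet> v) + t\<^sup>2"
    have s_eq: "(norm (x0 + t *\<^sub>R v - z))\<^sup>2 = ?s t" for t
    proof -
      have "(norm ((x0 - z) + t *\<^sub>R v))\<^sup>2 = ?s t"
        by (rule norm_add_scale_sq[OF v])
      then show ?thesis by (simp add: algebra_simps)
    qed
    have s0: "0 \<le> ?s t" for t using s_eq[of t] by (metis zero_le_power2)
    have sd: "(?s has_real_derivative (2 * ((x0 - z) \<bullet> v) + 2 * t)) (at t)" for t
      by (auto intro!: derivative_eq_intros)
    let ?\<phi> = "\<lambda>t. refl_diff e l (x0 + t *\<^sub>R v) - H (?s t)"
    let ?\<phi>1 = "\<lambda>t. (\<sigma> * Du (reflect e l x0 + t *\<^sub>R (\<sigma> *\<^sub>R v)) v - Du (x0 + t *\<^sub>R v) v) - H1 (?s t) * (2 * ((x0 - z) \<bullet> v) + 2 * t)"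
    have "(?\<phi> has_real_derivative ?\<phi>1 t) (at t)" for t
    proof (rule DERIV_diff)
      show "((\<lambda>t. refl_diff e l (x0 + t *\<^sub>R v)) has_real_derivative \<sigma> * Du (reflect e l x0 + t *\<^sub>R (\<sigma> *\<^sub>R v)) v - Du (x0 + t *\<^sub>R v) v) (at t)"
        using refl_diff_line[of e l x0 v t] unfolding reflect_add_scale vr by (simp add: linear_scale[OF linear1])
      show "((\<lambda>t. H (?s t)) has_real_derivative H1 (?s t) * (2 * ((x0 - z) \<bullet> v) + 2 * t)) (at t)"
        by (rule DERIV_chain2[OF H1[OF s0] sd])
    qed
    moreover have "(?\<phi>1 has_real_derivative ((\<sigma> * (\<sigma> * D2u (reflect e l x0) v v) - D2u x0 v v)
        - (2 * H1 ((norm (x0 - z))\<^sup>2) + 4 * ((x0 - z) \<bullet> v)\<^sup>2 * H2 ((norm (x0 - z))\<^sup>2)))) (at 0)"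
    proof (rule DERIV_diff)
      have "((\<lambda>t. Du (reflect e l x0 + t *\<^sub>R (\<sigma> *\<^sub>R v)) v) has_real_derivative \<sigma> * D2u (reflect e l x0) v v) (at 0)"
        using line_d2[of "reflect e l x0" "\<sigma> *\<^sub>R v" v 0] by (simp add: linear_scale[OF linear2])
      moreover have "((\<lambda>t. Du (x0 + t *\<^sub>R v) v) has_real_derivative D2u x0 v v) (at 0)"
        using line_d2[of x0 v v 0] by simp
      ultimately show "((\<lambda>t. \<sigma> * Du (reflect e l x0 + t *\<^sub>R (\<sigma> *\<^sub>R v)) v - Du (x0 + t *\<^sub>R v) v) has_real_derivative
          \<sigma> * (\<sigma> * D2u (reflect e l x0) v v) - D2u x0 v v) (at 0)"
        by (intro DERIV_diff DERIV_cmult)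
      have "((\<lambda>t. H1 (?s t)) has_real_derivative H2 ((norm (x0 - z))\<^sup>2) * (2 * ((x0 - z) \<bullet> v))) (at 0)"
        using DERIV_chain2[of H1 "H2 (?s 0)" "?s" 0 "2 * ((x0 - z) \<bullet> v) + 2 * 0" UNIV, OF H2[OF s0[of 0]] sd[of 0]] by simp
      moreover have "((\<lambda>t. 2 * ((x0 - z) \<bullet> v) + 2 * t) has_real_derivative 2) (at 0)"
        by (auto intro!: derivative_eq_intros)
      ultimately show "((\<lambda>t. H1 (?s t) * (2 * ((x0 - z) \<bullet> v) + 2 * t)) has_real_derivative
          (2 * H1 ((norm (x0 - z))\<^sup>2) + 4 * ((x0 - z) \<bullet> v)\<^sup>2 * H2 ((norm (x0 - z))\<^sup>2))) (at 0)"
        by (rule DERIV_cong[OF DERIV_mult]) (simp add: power2_eq_square)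
    qed
    moreover note d
    moreover have "?\<phi> 0 \<le> ?\<phi> t" if "\<bar>t\<bar> < \<delta>" for t
      using min[of "x0 + t *\<^sub>R v"] that v s_eq[of t] by (simp add: dist_norm)
    ultimately have "0 \<le> (\<sigma> * (\<sigma> * D2u (reflect e l x0) v v) - D2u x0 v v)
        - (2 * H1 ((norm (x0 - z))\<^sup>2) + 4 * ((x0 - z) \<bullet> v)\<^sup>2 * H2 ((norm (x0 - z))\<^sup>2))"
      by (rule second_derivative_test)
    moreover have "\<sigma> * (\<sigma> * D2u (reflect e l x0) v v) = D2u (reflect e l x0) v v" using sg by auto
    ultimately show ?thesis by simp
  qed
  have 1: "2 * H1 ((norm (x0 - z))\<^sup>2) + 4 * ((x0 - z) \<bullet> e)\<^sup>2 * H2 ((norm (x0 - z))\<^sup>2)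
     \<le> D2u (reflect e l x0) e e - D2u x0 e e"
    by (rule dir[of e "-1"]) (use e in \<open>auto simp: inner_self_unit algebra_simps scaleR_2\<close>)
  have 2: "2 * H1 ((norm (x0 - z))\<^sup>2) + 4 * ((x0 - z) \<bullet> perp e)\<^sup>2 * H2 ((norm (x0 - z))\<^sup>2)
     \<le> D2u (reflect e l x0) (perp e) (perp e) - D2u x0 (perp e) (perp e)"
    by (rule dir[of "perp e" 1]) (use e in \<open>auto simp: norm_perp\<close>)
  have "4 * (norm (x0 - z))\<^sup>2 * H2 ((norm (x0 - z))\<^sup>2)
     = 4 * ((x0 - z) \<bullet> e)\<^sup>2 * H2 ((norm (x0 - z))\<^sup>2) + 4 * ((x0 - z) \<bullet> perp e)\<^sup>2 * H2 ((norm (x0 - z))\<^sup>2)"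
    by (simp add: frame_parseval[OF e, symmetric] algebra_simps)
  then show ?thesis using 1 2 laplacian_frame[OF e, of "reflect e l x0"] laplacian_frame[OF e, of x0] by linarith
qed

end

locale moving_planes = C2_plane +
  fixes K :: "real^2 \<Rightarrow> real"
  assumes K_cont: "continuous_on UNIV K"
    and pde: "\<And>x. laplacian u x = - (K x * exp (2 * u x))"
begin

definition K_refl_ge :: "real^2 \<Rightarrow> real \<Rightarrow> bool" where
  "K_refl_ge e l \<longleftrightarrow> (\<forall>x. l \<le> x \<bullet> e \<longrightarrow> K x \<le> K (reflect e l x))"

lemma laplacian_refl_diff_le:
  assumes "K_refl_ge e l" "l \<le> x \<bullet> e"
  shows "laplacian u (reflect e l x) - laplacian u x \<le> K x * (exp (2 * u x) - exp (2 * u (reflect e l x)))"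
  using mult_right_mono[of "K x" "K (reflect e l x)" "exp (2 * u (reflect e l x))"] assms
  by (simp add: K_refl_ge_def pde algebra_simps)

text \<open>Quantitative Hopf lemma with the barrier
  \<open>exp (- \<alpha> * s) - exp (- \<alpha> * r\<^sup>2)\<close>, \<open>s\<close> the squared
  distance to the centre. The contact point may lie on the line of reflection or off it, so the same
  estimate yields the strong maximum principle and the boundary derivative. The range up to 1/2 is
  where the radius stays in the annulus that carries the barrier.\<close>

lemma hopf_ball:
  assumes e: "norm e = 1" and Kc: "K_refl_ge e l"
    and pos: "\<And>x. l \<le> x \<bullet> e \<Longrightarrow> 0 \<le> refl_diff e l x"
    and r: "0 < r" and sub: "\<And>x. x \<in> cball z r \<Longrightarrow> l \<le> x \<bullet> e"
    and inside: "\<And>x. x \<in> ball z r \<Longrightarrow> 0 < refl_diff e l x"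
    and x0: "dist z x0 = r"
  shows "\<exists>c>0. \<forall>t\<in>{0..1/2}. c * t \<le> refl_diff e l (x0 + t *\<^sub>R (z - x0))"
proof -
  have "bounded ((\<lambda>x. 2 * \<bar>K x\<bar> * exp (2 * u (reflect e l x))) ` cball z r)"
    by (intro compact_imp_bounded compact_continuous_image continuous_intros continuous_on_subset[OF K_cont]) auto
  then obtain M where M': "\<forall>y\<in>(\<lambda>x. 2 * \<bar>K x\<bar> * exp (2 * u (reflect e l x))) ` cball z r. norm y \<le> M"
    unfolding bounded_iff by blast
  have M: "2 * \<bar>K x\<bar> * exp (2 * u (reflect e l x)) \<le> M" if "x \<in> cball z r" for x
    using M' that by (auto simp: abs_mult)
  have "0 \<le> 2 * \<bar>K z\<bar> * exp (2 * u (reflect e l z))" by simp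
  also have "\<dots> \<le> M" using r by (intro M) simp
  finally have M0: "0 \<le> M" .
  \<comment> \<open>Because the difference is nonnegative here, the zero-order coefficient may be
    replaced by its modulus and bounded by \<open>M\<close>.\<close>
  have lapM: "laplacian u (reflect e l x) - laplacian u x \<le> M * refl_diff e l x" if x: "x \<in> cball z r" for x
  proof -
    have wx: "0 \<le> refl_diff e l x" using pos sub x by blast
    have "laplacian u (reflect e l x) - laplacian u x \<le> K x * (exp (2 * u x) - exp (2 * u (reflect e l x)))"
      using laplacian_refl_diff_le[OF Kc sub[OF x]] .
    also have "\<dots> \<le> \<bar>K x\<bar> * (exp (2 * u (reflect e l x)) - exp (2 * u x))"
      using wx abs_ge_minus_self[of "K x"] mult_right_mono[of "- K x" "\<bar>K x\<bar>" "exp (2 * u (reflect e l x)) - exp (2 * u x)"]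
      by (simp add: refl_diff_def algebra_simps)
    also have "\<dots> \<le> \<bar>K x\<bar> * (2 * exp (2 * u (reflect e l x)) * refl_diff e l x)"
      using exp_diff_le[of "u (reflect e l x)" "u x"] by (intro mult_left_mono) (auto simp: refl_diff_def)
    also have "\<dots> = (2 * \<bar>K x\<bar> * exp (2 * u (reflect e l x))) * refl_diff e l x" by simp
    also have "\<dots> \<le> M * refl_diff e l x" using M[OF x] wx by (intro mult_right_mono)
    finally show ?thesis .
  qed
  \<comment> \<open>Large enough that \<open>\<alpha> * r\<^sup>2\<close> is at least M + 5 and
    \<open>\<alpha>\<close> at least 1; then \<open>\<alpha> * (\<alpha> * r\<^sup>2 - 4)\<close> is
    at least M + 1, the strict subsolution property of the barrier.\<close>
  define \<alpha> where "\<alpha> = (M + 5) / r\<^sup>2 + M + 5"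
  have a: "0 < \<alpha>" "M < \<alpha>\<^sup>2 * r\<^sup>2 - 4 * \<alpha>"
  proof -
    show a0: "0 < \<alpha>" unfolding \<alpha>_def using M0 r by (intro add_nonneg_pos) (auto intro!: add_nonneg_nonneg divide_nonneg_pos)
    have "(M + 5) / r\<^sup>2 * r\<^sup>2 = M + 5" using r by simp
    moreover have "0 \<le> (M + 5) * r\<^sup>2" using M0 by simp
    ultimately have "M + 5 \<le> \<alpha> * r\<^sup>2" unfolding \<alpha>_def by (simp add: distrib_right)
    then have "\<alpha> * (M + 5) \<le> \<alpha> * (\<alpha> * r\<^sup>2)" using a0 by (intro mult_left_mono) auto
    moreover have "1 * (M + 1) \<le> \<alpha> * (M + 1)" using M0 r unfolding \<alpha>_def by (intro mult_right_mono) auto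
    ultimately show "M < \<alpha>\<^sup>2 * r\<^sup>2 - 4 * \<alpha>" by (simp add: power2_eq_square algebra_simps)
  qed
  have "\<exists>y\<in>sphere z (r/2). \<forall>x\<in>sphere z (r/2). refl_diff e l y \<le> refl_diff e l x"
    using r by (intro continuous_attains_inf continuous_intros) auto
  then obtain y where y: "y \<in> sphere z (r/2)" and ymin: "\<And>x. x \<in> sphere z (r/2) \<Longrightarrow> refl_diff e l y \<le> refl_diff e l x" by blast
  define \<epsilon> where "\<epsilon> = refl_diff e l y"
  have eps: "0 < \<epsilon>" unfolding \<epsilon>_def using y r by (intro inside) auto
  define H where "H = (\<lambda>s. \<epsilon> * (exp (- \<alpha> * s) - exp (- \<alpha> * r\<^sup>2)))"
  define H1 where "H1 = (\<lambda>s. - (\<epsilon> * \<alpha> * exp (- \<alpha> * s)))"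
  define H2 where "H2 = (\<lambda>s. \<epsilon> * \<alpha>\<^sup>2 * exp (- \<alpha> * s))"
  have dH1: "(H has_real_derivative H1 s) (at s)" for s
    unfolding H_def H1_def by (auto intro!: derivative_eq_intros)
  have dH2: "(H1 has_real_derivative H2 s) (at s)" for s
    unfolding H1_def H2_def by (auto intro!: derivative_eq_intros simp: power2_eq_square)
  define Ann where "Ann = cball z r - ball z (r/2)"
  have ge: "H ((norm (x - z))\<^sup>2) \<le> refl_diff e l x" if x: "x \<in> Ann" for x
  proof -
    have cA: "compact Ann" unfolding Ann_def by (intro compact_diff) auto
    have "\<exists>y\<in>Ann. \<forall>x\<in>Ann. refl_diff e l y - H ((norm (y - z))\<^sup>2) \<le> refl_diff e l x - H ((norm (x - z))\<^sup>2)"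
      unfolding H_def using x by (intro continuous_attains_inf cA continuous_intros) auto
    then obtain x1 where x1: "x1 \<in> Ann"
      and xmin: "\<And>x. x \<in> Ann \<Longrightarrow> refl_diff e l x1 - H ((norm (x1 - z))\<^sup>2) \<le> refl_diff e l x - H ((norm (x - z))\<^sup>2)" by blast
    \<comment> \<open>A negative minimum is impossible on the outer circle, where the barrier
      vanishes, and on the inner one, where the barrier is at most \<open>\<epsilon>\<close>. In the
      interior it contradicts the choice of \<open>\<alpha>\<close>, as the squared distance is at
      least r^2/4.\<close>
    have "0 \<le> refl_diff e l x1 - H ((norm (x1 - z))\<^sup>2)"
    proof (rule ccontr)
      assume neg: "\<not> 0 \<le> refl_diff e l x1 - H ((norm (x1 - z))\<^sup>2)"
      have x1c: "x1 \<in> cball z r" using x1 by (simp add: Ann_def)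
      have n1: "norm (x1 - z) \<noteq> r"
      proof
        assume "norm (x1 - z) = r"
        then have "H ((norm (x1 - z))\<^sup>2) = 0" by (simp add: H_def)
        with neg pos[OF sub[OF x1c]] show False by simp
      qed
      have n2: "norm (x1 - z) \<noteq> r / 2"
      proof
        assume h: "norm (x1 - z) = r / 2"
        have "exp (- \<alpha> * (norm (x1 - z))\<^sup>2) \<le> 1" using a by simp
        then have "exp (- \<alpha> * (norm (x1 - z))\<^sup>2) - exp (- \<alpha> * r\<^sup>2) \<le> 1" using exp_ge_zero[of "- \<alpha> * r\<^sup>2"] by linarith
        then have "H ((norm (x1 - z))\<^sup>2) \<le> \<epsilon> * 1" unfolding H_def using eps by (intro mult_left_mono) auto
        moreover have "\<epsilon> \<le> refl_diff e l x1" unfolding \<epsilon>_def using h by (intro ymin) (auto simp: dist_norm norm_minus_commute)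
        ultimately show False using neg by simp
      qed
      have x1n: "r / 2 < norm (x1 - z)" "norm (x1 - z) < r"
        using x1 n1 n2 by (auto simp: Ann_def dist_norm norm_minus_commute)
      define \<delta> where "\<delta> = min (norm (x1 - z) - r / 2) (r - norm (x1 - z))"
      have d0: "0 < \<delta>" using x1n by (simp add: \<delta>_def)
      have "4 * H1 ((norm (x1 - z))\<^sup>2) + 4 * (norm (x1 - z))\<^sup>2 * H2 ((norm (x1 - z))\<^sup>2)
          \<le> laplacian u (reflect e l x1) - laplacian u x1"
      proof (rule refl_diff_comparison[OF e dH1 dH2 d0])
        fix x assume "dist x x1 < \<delta>"
        then have "x \<in> Ann" using norm_triangle_ineq[of "x - x1" "x1 - z"] norm_triangle_ineq[of "x1 - x" "x - z"]
          by (auto simp: Ann_def \<delta>_def dist_norm norm_minus_commute)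
        then show "refl_diff e l x1 - H ((norm (x1 - z))\<^sup>2) \<le> refl_diff e l x - H ((norm (x - z))\<^sup>2)" by (rule xmin)
      qed
      also have "\<dots> \<le> M * refl_diff e l x1" by (rule lapM[OF x1c])
      also have "\<dots> \<le> M * H ((norm (x1 - z))\<^sup>2)" using neg M0 by (intro mult_left_mono) auto
      also have "\<dots> \<le> M * (\<epsilon> * exp (- \<alpha> * (norm (x1 - z))\<^sup>2))" unfolding H_def using eps M0
        by (intro mult_left_mono) auto
      finally have le: "(\<epsilon> * exp (- \<alpha> * (norm (x1 - z))\<^sup>2)) * (4 * \<alpha>\<^sup>2 * (norm (x1 - z))\<^sup>2 - 4 * \<alpha>)
          \<le> (\<epsilon> * exp (- \<alpha> * (norm (x1 - z))\<^sup>2)) * M"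
        unfolding H1_def H2_def by (simp add: algebra_simps power2_eq_square)
      have "0 < \<epsilon> * exp (- \<alpha> * (norm (x1 - z))\<^sup>2)" using eps by simp
      then have "4 * \<alpha>\<^sup>2 * (norm (x1 - z))\<^sup>2 - 4 * \<alpha> \<le> M" using le by (simp only: mult_le_cancel_left_pos)
      moreover have "(r / 2)\<^sup>2 \<le> (norm (x1 - z))\<^sup>2" using x1n r by (intro power_mono) auto
      then have "4 * \<alpha>\<^sup>2 * (r / 2)\<^sup>2 \<le> 4 * \<alpha>\<^sup>2 * (norm (x1 - z))\<^sup>2" by (intro mult_left_mono) auto
      moreover have "4 * \<alpha>\<^sup>2 * (r / 2)\<^sup>2 = \<alpha>\<^sup>2 * r\<^sup>2" by (simp add: power2_eq_square)
      ultimately show False using a(2) by linarith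
    qed
    with xmin[OF x] show ?thesis by linarith
  qed
  define c where "c = \<epsilon> * exp (- \<alpha> * r\<^sup>2) * (\<alpha> * r\<^sup>2)"
  have c0: "0 < c" unfolding c_def using eps a(1) r by simp
  have "c * t \<le> refl_diff e l (x0 + t *\<^sub>R (z - x0))" if t: "t \<in> {0..1/2}" for t
  proof -
    let ?x = "x0 + t *\<^sub>R (z - x0)"
    have "?x - z = (1 - t) *\<^sub>R (x0 - z)" by (simp add: algebra_simps)
    then have n: "norm (?x - z) = (1 - t) * r" using t x0 by (simp add: dist_norm norm_minus_commute)
    have "(1 - t) * r \<le> 1 * r" "1 / 2 * r \<le> (1 - t) * r" using t r by (intro mult_right_mono; simp)+
    then have "?x \<in> Ann" unfolding Ann_def using n by (auto simp: dist_norm norm_minus_commute)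
    from ge[OF this] have "H (((1 - t) * r)\<^sup>2) \<le> refl_diff e l ?x" by (simp add: n)
    \<comment> \<open>The exponent changes by
      \<open>\<alpha> * r\<^sup>2 * (2 * t - t\<^sup>2)\<close>, which is at least
      \<open>\<alpha> * r\<^sup>2 * t\<close>; the bound exp a >= 1 + a then gives linear growth
      with slope \<open>c\<close>.\<close>
    moreover have "c * t \<le> H (((1 - t) * r)\<^sup>2)"
    proof -
      have "\<alpha> * r\<^sup>2 * t \<le> \<alpha> * r\<^sup>2 * (2 * t - t\<^sup>2)"
      proof (intro mult_left_mono)
        show "t \<le> 2 * t - t\<^sup>2" using t mult_left_mono[of t 1 t] by (simp add: power2_eq_square)
      qed (use a r in auto)
      then have "1 + \<alpha> * r\<^sup>2 * t \<le> 1 + \<alpha> * r\<^sup>2 * (2 * t - t\<^sup>2)" by simp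
      also have "\<dots> \<le> exp (\<alpha> * r\<^sup>2 * (2 * t - t\<^sup>2))" by (rule exp_ge_add_one_self)
      finally have "\<epsilon> * exp (- \<alpha> * r\<^sup>2) * (1 + \<alpha> * r\<^sup>2 * t) \<le> \<epsilon> * exp (- \<alpha> * r\<^sup>2) * exp (\<alpha> * r\<^sup>2 * (2 * t - t\<^sup>2))"
        using eps by (intro mult_left_mono) auto
      also have "\<dots> = \<epsilon> * exp (- \<alpha> * ((1 - t) * r)\<^sup>2)"
        by (simp add: mult.assoc power2_eq_square algebra_simps flip: exp_add)
      finally show ?thesis unfolding c_def H_def by (simp add: algebra_simps)
    qed
    ultimately show ?thesis by linarith
  qed
  with c0 show ?thesis by blast
qed

end

section \<open>Negative minima of the reflected difference\<close>

context moving_planes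
begin

text \<open>Off the line a zero is an interior minimum of a nonnegative function, so the derivative
  along the radius vanishes; \<open>hopf_ball\<close> makes it positive.\<close>

lemma no_interior_zero:
  assumes e: "norm e = 1" and Kc: "K_refl_ge e l" and pos: "\<And>x. l \<le> x \<bullet> e \<Longrightarrow> 0 \<le> refl_diff e l x"
    and r: "0 < r" and sub: "\<And>x. x \<in> cball z r \<Longrightarrow> l \<le> x \<bullet> e"
    and inside: "\<And>x. x \<in> ball z r \<Longrightarrow> 0 < refl_diff e l x"
    and x0: "dist z x0 = r" and int: "l < x0 \<bullet> e" and zero: "refl_diff e l x0 = 0"
  shows False
proof -
  obtain c where c: "0 < c" "\<And>t. t \<in> {0..1/2} \<Longrightarrow> c * t \<le> refl_diff e l (x0 + t *\<^sub>R (z - x0))"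
    using hopf_ball[OF e Kc pos r sub inside x0] by blast
  let ?\<phi> = "\<lambda>t. refl_diff e l (x0 + t *\<^sub>R (z - x0))"
  obtain D where D: "(?\<phi> has_real_derivative D) (at 0)" using refl_diff_line[of e l x0 "z - x0" 0] by blast
  have "c \<le> D" by (rule derivative_ge_of_linear_lower_bound[OF D _ c(2)]) (use zero in auto)
  define \<delta> where "\<delta> = (x0 \<bullet> e - l) / r"
  have d: "0 < \<delta>" using int r by (simp add: \<delta>_def)
  have "D = 0"
  proof (rule DERIV_local_min[OF D d])
    show "\<forall>y. \<bar>0 - y\<bar> < \<delta> \<longrightarrow> ?\<phi> 0 \<le> ?\<phi> y"
    proof (intro allI impI)
      fix t assume t: "\<bar>0 - t\<bar> < \<delta>"
      have "\<bar>t * ((z - x0) \<bullet> e)\<bar> \<le> \<bar>t\<bar> * (norm (z - x0) * norm e)"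
        using Cauchy_Schwarz_ineq2[of "z - x0" e] by (simp add: abs_mult mult_left_mono)
      also have "\<dots> = \<bar>t\<bar> * r" using x0 e by (simp add: dist_norm)
      also have "\<dots> \<le> \<delta> * r" using t r by (intro mult_right_mono) auto
      also have "\<dots> = x0 \<bullet> e - l" using r by (simp add: \<delta>_def)
      finally have "l \<le> (x0 + t *\<^sub>R (z - x0)) \<bullet> e" by (simp add: inner_add_left abs_le_iff)
      then show "?\<phi> 0 \<le> ?\<phi> t" using pos zero by simp
    qed
  qed
  with \<open>c \<le> D\<close> c(1) show False by simp
qed

text \<open>Otherwise the half plane, being connected, contains a frontier point of the positivity
  set. A ball about a nearby positive point, grown until it first meets a zero, is the configuration
  excluded by \<open>no_interior_zero\<close>.\<close>

lemma strong_maximum_principle: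
  assumes e: "norm e = 1" and Kc: "K_refl_ge e l" and pos: "\<And>x. l \<le> x \<bullet> e \<Longrightarrow> 0 \<le> refl_diff e l x"
    and p: "l < p \<bullet> e" "0 < refl_diff e l p" and x: "l < x \<bullet> e"
  shows "0 < refl_diff e l x"
proof (rule ccontr)
  assume nx: "\<not> 0 < refl_diff e l x"
  let ?S = "{x. l < x \<bullet> e}"
  have halfspace: "?S = {x. l < e \<bullet> x}" by (simp add: inner_commute)
  define P where "P = {x \<in> ?S. 0 < refl_diff e l x}"
  have conn: "connected ?S" unfolding halfspace using convex_halfspace_gt[of l e] by (simp add: convex_connected)
  have opS: "open ?S" unfolding halfspace by (rule open_halfspace_gt)
  have opP: "open P" unfolding P_def
    using continuous_open_preimage[OF _ opS open_greaterThan[of 0], of "refl_diff e l"]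
    by (simp add: Int_def vimage_def continuous_refl_diff[OF continuous_on_const continuous_on_id])
  have "?S \<inter> P \<noteq> {}" "?S - P \<noteq> {}" using p x nx by (auto simp: P_def)
  then have "?S \<inter> frontier P \<noteq> {}" by (rule connected_Int_frontier[OF conn])
  then obtain y where y: "l < y \<bullet> e" "y \<in> frontier P" by blast
  have yP: "y \<notin> P" "y \<in> closure P" using y(2) opP by (auto simp: frontier_def interior_open)
  have wy: "refl_diff e l y = 0" using pos[of y] y(1) yP(1) by (auto simp: P_def)
  \<comment> \<open>Half the distance of \<open>y\<close> from the line: a positive point
    \<open>z\<close> within \<open>d\<close> of \<open>y\<close> is farther than \<open>d\<close>
    from the line, so \<open>cball z d\<close> stays in the half plane and still contains the zero
    \<open>y\<close>.\<close>
  define d where "d = (y \<bullet> e - l) / 2"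
  have d: "0 < d" using y by (simp add: d_def)
  obtain z where z: "z \<in> P" "dist z y < d" using yP(2) d by (auto simp: closure_approachable)
  have near: "\<bar>a \<bullet> e - b \<bullet> e\<bar> \<le> dist a b" for a b
    using Cauchy_Schwarz_ineq2[of "a - b" e] e by (simp add: dist_norm inner_diff_left)
  have "y \<bullet> e - z \<bullet> e \<le> dist z y" using near[of z y] by (simp add: abs_le_iff)
  also have "\<dots> < d" by (rule z(2))
  also have "d = y \<bullet> e - l - d" by (simp add: d_def field_simps)
  finally have zS: "l + d < z \<bullet> e" by simp
  define Z where "Z = cball z d \<inter> {x. refl_diff e l x = 0}"
  have cZ: "compact Z" unfolding Z_def
    by (intro compact_Int_closed compact_cball closed_Collect_eq continuous_intros)
  have yZ: "y \<in> Z" using z wy by (auto simp: Z_def)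
  obtain x0 where x0: "x0 \<in> Z" and x0min: "\<And>x. x \<in> Z \<Longrightarrow> dist z x0 \<le> dist z x"
    using distance_attains_inf[of Z z] compact_imp_closed[OF cZ] yZ by blast
  define r where "r = dist z x0"
  have r0: "0 < r" using z(1) x0 by (auto simp: r_def P_def Z_def)
  have rd: "r < d" using x0min[OF yZ] z(2) by (simp add: r_def)
  show False
  proof (rule no_interior_zero[OF e Kc pos r0, of z x0])
    fix x assume "x \<in> cball z r"
    then show "l \<le> x \<bullet> e" using near[of z x] rd zS by simp
  next
    fix x assume x: "x \<in> ball z r"
    then have "l \<le> x \<bullet> e" using near[of z x] rd zS by simp
    then have "0 \<le> refl_diff e l x" by (rule pos)
    moreover have "refl_diff e l x \<noteq> 0"
    proof
      assume "refl_diff e l x = 0"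
      then have "x \<in> Z" using x rd by (auto simp: Z_def)
      with x0min[of x] x show False by (simp add: r_def)
    qed
    ultimately show "0 < refl_diff e l x" by simp
  next
    show "dist z x0 = r" by (simp add: r_def)
    show "l < x0 \<bullet> e" using near[of z x0] rd zS by (simp add: r_def)
    show "refl_diff e l x0 = 0" using x0 by (simp add: Z_def)
  qed
qed

text \<open>On the line the derivative of the reflected difference in direction \<open>e\<close> is
  \<open>- 2 * Du x0 e\<close>, and the Hopf estimate on the unit disk touching the line at
  \<open>x0\<close> makes it positive.\<close>

lemma hopf_boundary:
  assumes e: "norm e = 1" and Kc: "K_refl_ge e l" and pos: "\<And>x. l < x \<bullet> e \<Longrightarrow> 0 < refl_diff e l x"
    and x0: "x0 \<bullet> e = l"
  shows "Du x0 e < 0"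
proof -
  let ?z = "x0 + e"
  have ze: "?z \<bullet> e = l + 1" using x0 e by (simp add: inner_add_left inner_self_unit)
  have near: "\<bar>a \<bullet> e - b \<bullet> e\<bar> \<le> dist a b" for a b
    using Cauchy_Schwarz_ineq2[of "a - b" e] e by (simp add: dist_norm inner_diff_left)
  have pos': "0 \<le> refl_diff e l x" if "l \<le> x \<bullet> e" for x
    using pos[of x] refl_diff_zero[of x e l] that by (cases "l = x \<bullet> e") auto
  have "\<exists>c>0. \<forall>t\<in>{0..1/2}. c * t \<le> refl_diff e l (x0 + t *\<^sub>R (?z - x0))"
  proof (rule hopf_ball[OF e Kc pos'])
    fix x assume "x \<in> cball ?z 1"
    then show "l \<le> x \<bullet> e" using near[of ?z x] ze by simp
  next
    fix x assume "x \<in> ball ?z 1"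
    then have "l < x \<bullet> e" using near[of ?z x] ze by simp
    then show "0 < refl_diff e l x" by (rule pos)
  qed (use e in \<open>auto simp: dist_norm\<close>)
  then obtain c where c: "0 < c" "\<And>t. t \<in> {0..1/2} \<Longrightarrow> c * t \<le> refl_diff e l (x0 + t *\<^sub>R e)" by auto
  have "((\<lambda>t. refl_diff e l (x0 + t *\<^sub>R e)) has_real_derivative - 2 * Du x0 e) (at 0)"
  proof -
    have 1: "e - (2 * (e \<bullet> e)) *\<^sub>R e = (-1) *\<^sub>R e" using e by (simp add: inner_self_unit scaleR_2)
    show ?thesis using refl_diff_line[of e l x0 e 0] unfolding 1
      by (simp add: reflect_fixed[OF x0] linear_neg[OF linear1])
  qed
  from derivative_ge_of_linear_lower_bound[OF this _ c(2)] have "c \<le> - 2 * Du x0 e"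
    by (simp add: refl_diff_zero x0)
  with c(1) show ?thesis by simp
qed

text \<open>A limit point of the \<open>X n\<close> must lie on the limiting line, as the difference
  is positive beyond it. Between \<open>X n\<close> and its mirror image the mean value theorem
  finds a point with nonnegative derivative in direction \<open>e\<close>; these points converge to
  the same limit, where \<open>hopf_boundary\<close> makes that derivative negative.\<close>

lemma no_bad_sequence:
  assumes e: "norm e = 1" and Kc: "K_refl_ge e l" and pos: "\<And>x. l < x \<bullet> e \<Longrightarrow> 0 < refl_diff e l x"
    and mu: "\<mu> \<longlonglongrightarrow> l" and X: "\<And>n::nat. \<mu> n < X n \<bullet> e" "\<And>n. norm (X n) \<le> R" "\<And>n. refl_diff e (\<mu> n) (X n) < 0"
  shows False
proof -
  have "compact (cball (0::real^2) R)" by simp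
  then obtain y s where s: "strict_mono (s::nat \<Rightarrow> nat)" and y: "(X \<circ> s) \<longlonglongrightarrow> y"
    using X(2) unfolding compact_def by (metis mem_cball_0)
  have mus: "(\<lambda>n. \<mu> (s n)) \<longlonglongrightarrow> l" using LIMSEQ_subseq_LIMSEQ[OF mu s] by (simp add: o_def)
  have ys: "(\<lambda>n. X (s n)) \<longlonglongrightarrow> y" using y by (simp add: o_def)
  have ye: "(\<lambda>n. X (s n) \<bullet> e) \<longlonglongrightarrow> y \<bullet> e" by (intro tendsto_intros ys)
  have ly: "l \<le> y \<bullet> e" by (rule LIMSEQ_le[OF mus ye]) (use X(1) less_imp_le in blast)
  have cw: "continuous_on UNIV (\<lambda>z. refl_diff e (fst z) (snd z))" by (intro continuous_intros)
  have "(\<lambda>n. refl_diff e (fst (\<mu> (s n), X (s n))) (snd (\<mu> (s n), X (s n)))) \<longlonglongrightarrow> refl_diff e (fst (l, y)) (snd (l, y))"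
    by (rule continuous_on_tendsto_compose[OF cw]) (auto intro!: tendsto_intros mus ys)
  then have "(\<lambda>n. refl_diff e (\<mu> (s n)) (X (s n))) \<longlonglongrightarrow> refl_diff e l y" by simp
  then have wy: "refl_diff e l y \<le> 0" by (rule LIMSEQ_le_const2) (use X(3) less_imp_le in blast)
  have yl: "y \<bullet> e = l" using ly pos[of y] wy by (cases "y \<bullet> e = l") auto
  have "\<exists>\<xi>. 0 \<le> \<xi> \<and> \<xi> \<le> 2 * (X n \<bullet> e - \<mu> n) \<and> 0 \<le> Du (X n + (- \<xi>) *\<^sub>R e) e" for n
  proof -
    define \<tau> where "\<tau> = 2 * (X n \<bullet> e - \<mu> n)"
    have t: "0 < \<tau>" using X(1)[of n] by (simp add: \<tau>_def)
    have rx: "reflect e (\<mu> n) (X n) = X n + (- \<tau>) *\<^sub>R e" by (simp add: reflect_def \<tau>_def algebra_simps)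
    have "\<exists>z>-\<tau>. z < 0 \<and> u (X n + 0 *\<^sub>R e) - u (X n + (- \<tau>) *\<^sub>R e) = (0 - (- \<tau>)) * Du (X n + z *\<^sub>R e) e"
      by (rule MVT2[where f="\<lambda>t. u (X n + t *\<^sub>R e)"]) (use t line_d1 in auto)
    then obtain z where z: "-\<tau> < z" "z < 0" "u (X n) - u (X n + (- \<tau>) *\<^sub>R e) = \<tau> * Du (X n + z *\<^sub>R e) e" by auto
    have "0 < \<tau> * Du (X n + z *\<^sub>R e) e" using X(3)[of n] z(3) unfolding refl_diff_def rx by simp
    then have "0 \<le> Du (X n + (- (- z)) *\<^sub>R e) e" using t by (simp add: zero_less_mult_iff)
    then show ?thesis using z unfolding \<tau>_def by (intro exI[of _ "- z"]) auto
  qed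
  then obtain \<xi> where \<xi>: "\<And>n. 0 \<le> \<xi> n" "\<And>n. \<xi> n \<le> 2 * (X n \<bullet> e - \<mu> n)" "\<And>n. 0 \<le> Du (X n + (- \<xi> n) *\<^sub>R e) e" by metis
  have lim0: "(\<lambda>n. 2 * (X (s n) \<bullet> e - \<mu> (s n))) \<longlonglongrightarrow> 2 * (y \<bullet> e - l)" by (intro tendsto_intros ye mus)
  have "(\<lambda>n. \<xi> (s n)) \<longlonglongrightarrow> 0"
    by (rule tendsto_sandwich[OF always_eventually always_eventually tendsto_const lim0[unfolded yl diff_self mult_zero_right]])
      (intro allI \<xi>)+
  then have "(\<lambda>n. X (s n) + (- \<xi> (s n)) *\<^sub>R e) \<longlonglongrightarrow> y + (- 0) *\<^sub>R e" by (intro tendsto_intros ys)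
  then have l2: "(\<lambda>n. X (s n) + (- \<xi> (s n)) *\<^sub>R e) \<longlonglongrightarrow> y" by simp
  have "(\<lambda>n. Du (X (s n) + (- \<xi> (s n)) *\<^sub>R e) e) \<longlonglongrightarrow> Du y e"
    by (rule continuous_on_tendsto_compose[OF cont_Du[of UNIV e] l2]) auto
  then have "0 \<le> Du y e" by (rule LIMSEQ_le_const) (use \<xi>(3) in blast)
  moreover have "Du y e < 0" by (rule hopf_boundary[OF e Kc pos yl])
  ultimately show False by simp
qed

end

sublocale liouville_mono \<subseteq> moving_planes u Du D2u K
  by unfold_locales (auto simp: K_cont pde f_def)

text \<open>With s = |x|^2, the right side is minus the Laplacian of ln(1+s)/2 + 2 -
  (1+s)^(-\<gamma>/4). The logarithm contributes a term of order s^(-2) with the wrong sign; the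
  power contributes (\<gamma>^2/4) s^(-1-\<gamma>/4) to leading order. This dominates because
  \<gamma>/4 is less than 1, and it also beats the left side, of order s^(-1-\<gamma>/2) ln
  s.\<close>

lemma comparison_supersolution:
  fixes \<gamma> A :: real
  assumes g: "0 < \<gamma>" "\<gamma> \<le> 1"
  shows "\<exists>R\<ge>1. \<forall>s\<ge>R. 2 * A * s powr (- 1 - \<gamma> / 2) * (ln (1 + s) / 2 + 2 - (1 + s) powr (- (\<gamma> / 4)))
     < - (4 * (1 / (2 * (1 + s)) + \<gamma> / 4 * (1 + s) powr (- (\<gamma> / 4) - 1))
        + 4 * s * (- 1 / (2 * (1 + s)\<^sup>2) - \<gamma> / 4 * (\<gamma> / 4 + 1) * (1 + s) powr (- (\<gamma> / 4) - 2)))"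
proof -
  have "\<forall>\<^sub>F s in at_top. 2 * A * s powr (- 1 - \<gamma> / 2) * (ln (1 + s) / 2 + 2 - (1 + s) powr (- (\<gamma> / 4)))
     < - (4 * (1 / (2 * (1 + s)) + \<gamma> / 4 * (1 + s) powr (- (\<gamma> / 4) - 1))
        + 4 * s * (- 1 / (2 * (1 + s)\<^sup>2) - \<gamma> / 4 * (\<gamma> / 4 + 1) * (1 + s) powr (- (\<gamma> / 4) - 2)))"
    using g by real_asymp
  then obtain R where R: "\<forall>s\<ge>R. 2 * A * s powr (- 1 - \<gamma> / 2) * (ln (1 + s) / 2 + 2 - (1 + s) powr (- (\<gamma> / 4)))
     < - (4 * (1 / (2 * (1 + s)) + \<gamma> / 4 * (1 + s) powr (- (\<gamma> / 4) - 1))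
        + 4 * s * (- 1 / (2 * (1 + s)\<^sup>2) - \<gamma> / 4 * (\<gamma> / 4 + 1) * (1 + s) powr (- (\<gamma> / 4) - 2)))"
    unfolding eventually_at_top_linorder by blast
  show ?thesis by (rule exI[of _ "max R 1"]) (use R in auto)
qed

context liouville_mono
begin

lemma total_mass_pos: "0 < total_mass"
  using q_mass q0 mult_pos_pos[OF pi_gt_zero q0] unfolding total_mass_def by linarith

text \<open>Far out, \<open>x\<close> and its mirror image have norms within a factor 2, so the
  leading logarithms of \<open>u\<close> cancel up to a constant and only the error terms
  remain.\<close>

lemma refl_diff_small:
  assumes e: "norm e = 1" and eta: "0 < \<eta>"
  shows "\<exists>R. \<forall>x. R \<le> norm x \<longrightarrow> \<bar>refl_diff e l x\<bar> \<le> \<eta> * ln (norm x)"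
proof -
  define b where "b = total_mass / (2 * pi)"
  have b: "0 \<le> b" using total_mass_pos by (simp add: b_def)
  obtain C R1 where R1: "2 \<le> R1" and CR: "\<And>x. R1 \<le> norm x \<Longrightarrow> \<bar>u x + b * ln (norm x)\<bar> \<le> \<eta> / 4 * ln (norm x) + C"
    using u_asymptotics[of "\<eta> / 4"] eta unfolding b_def by auto
  have "\<forall>\<^sub>F s in at_top. \<eta> / 4 * ln 2 + 2 * C + b * ln 2 \<le> \<eta> / 2 * ln s" using eta by real_asymp
  then obtain R2 where R2: "\<And>s. R2 \<le> s \<Longrightarrow> \<eta> / 4 * ln 2 + 2 * C + b * ln 2 \<le> \<eta> / 2 * ln s"
    unfolding eventually_at_top_linorder by blast
  have "\<bar>refl_diff e l x\<bar> \<le> \<eta> * ln (norm x)" if x: "max (2 * R1 + 4 * \<bar>l\<bar>) R2 \<le> norm x" for x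
  proof -
    let ?x = "reflect e l x"
    note nb = norm_reflect_bounds[OF e, where l=l and x=x]
    have xl: "2 * R1 + 4 * \<bar>l\<bar> \<le> norm x" "R2 \<le> norm x" using x by auto
    have n: "norm ?x \<le> norm x * 2" "norm x \<le> norm ?x * 2" using nb xl R1 by linarith+
    have x0: "R1 \<le> norm x" "R1 \<le> norm ?x" using nb xl R1 by linarith+
    then have p: "0 < norm x" "0 < norm ?x" using R1 by linarith+
    have "ln (norm ?x) \<le> ln (norm x * 2)" "ln (norm x) \<le> ln (norm ?x * 2)" using n p by auto
    then have lb: "ln (norm ?x) \<le> ln (norm x) + ln 2" "ln (norm x) \<le> ln (norm ?x) + ln 2" using p by (simp_all add: ln_mult)
    have "\<bar>b * ln (norm x) - b * ln (norm ?x)\<bar> = b * \<bar>ln (norm x) - ln (norm ?x)\<bar>"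
      using b by (simp add: abs_mult flip: right_diff_distrib)
    also have "\<dots> \<le> b * ln 2" using lb b by (intro mult_left_mono) linarith+
    finally have 1: "\<bar>b * ln (norm x) - b * ln (norm ?x)\<bar> \<le> b * ln 2" .
    have 2: "\<eta> / 4 * ln (norm ?x) \<le> \<eta> / 4 * (ln (norm x) + ln 2)" using lb eta by (intro mult_left_mono) auto
    have "\<bar>refl_diff e l x\<bar> \<le> \<eta> / 4 * ln (norm x) + C + (\<eta> / 4 * ln (norm x) + \<eta> / 4 * ln 2 + C) + b * ln 2"
      unfolding refl_diff_def using CR[OF x0(1)] CR[OF x0(2)] 1 2 by (simp add: distrib_left)
    also have "\<dots> = \<eta> / 2 * ln (norm x) + (\<eta> / 4 * ln 2 + 2 * C + b * ln 2)" by (simp add: field_simps)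
    also have "\<dots> \<le> \<eta> / 2 * ln (norm x) + \<eta> / 2 * ln (norm x)" using R2[of "norm x"] x by (intro add_left_mono) auto
    also have "\<dots> = \<eta> * ln (norm x)" by simp
    finally show ?thesis .
  qed
  then show ?thesis by blast
qed

lemma u_tendsto_minus_infinity: "\<exists>R. \<forall>x. R \<le> norm x \<longrightarrow> u x < c"
proof -
  define b where "b = total_mass / (2 * pi)"
  have b: "0 < b" using total_mass_pos by (simp add: b_def)
  obtain C R1 where R1: "2 \<le> R1" and CR: "\<And>x. R1 \<le> norm x \<Longrightarrow> \<bar>u x + b * ln (norm x)\<bar> \<le> b / 2 * ln (norm x) + C"
    using u_asymptotics[of "b / 2"] b unfolding b_def by auto
  have "\<forall>\<^sub>F s in at_top. C - c < b / 2 * ln s" using b by real_asymp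
  then obtain R2 where R2: "\<And>s. R2 \<le> s \<Longrightarrow> C - c < b / 2 * ln s"
    unfolding eventually_at_top_linorder by blast
  have "u x < c" if "max R1 R2 \<le> norm x" for x
    using CR[of x] R2[of "norm x"] that by (simp add: abs_le_iff)
  then show ?thesis by blast
qed

text \<open>The reflected difference is divided by a strict supersolution that grows like the logarithm, so that
  the logarithmic asymptotics of u suffice for the quotient to vanish at infinity.\<close>

theorem negative_min_bounded:
  "\<exists>R. \<forall>e l. norm e = 1 \<longrightarrow> K_refl_ge e l \<longrightarrow> (\<exists>x. l \<le> x \<bullet> e \<and> refl_diff e l x < 0) \<longrightarrow>
     (\<exists>x. l < x \<bullet> e \<and> norm x \<le> R \<and> refl_diff e l x < 0)"
proof -
  obtain \<gamma>0 A R0 where g0: "0 < \<gamma>0" and A: "0 \<le> A" and R0: "2 \<le> R0"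
    and dec: "\<And>x. R0 \<le> norm x \<Longrightarrow> \<bar>K x\<bar> * exp (2 * u x) \<le> A * norm x powr (- 2 - \<gamma>0)"
    using Kexp_decay by blast
  \<comment> \<open>The comparison function is built for exponents at most 1; lowering the exponent
    only weakens the decay bound.\<close>
  define \<gamma> where "\<gamma> = min \<gamma>0 1"
  define a where "a = \<gamma> / 4"
  have g: "0 < \<gamma>" "\<gamma> \<le> 1" using g0 by (auto simp: \<gamma>_def)
  define H where "H = (\<lambda>s::real. ln (1 + s) / 2 + 2 - (1 + s) powr (- a))"
  define H1 where "H1 = (\<lambda>s::real. 1 / (2 * (1 + s)) + a * (1 + s) powr (- a - 1))"
  define H2 where "H2 = (\<lambda>s::real. - 1 / (2 * (1 + s)\<^sup>2) - a * (a + 1) * (1 + s) powr (- a - 2))"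
  obtain R2 where R2: "1 \<le> R2" and sup: "\<And>s. R2 \<le> s \<Longrightarrow> 2 * A * s powr (- 1 - \<gamma> / 2) * H s < - (4 * H1 s + 4 * s * H2 s)"
    using comparison_supersolution[OF g, of A] unfolding H_def H1_def H2_def a_def by blast
  have dH1: "(H has_real_derivative H1 s) (at s)" if "0 \<le> s" for s
    unfolding H_def H1_def using that by (auto intro!: derivative_eq_intros simp: field_simps)
  have dH2: "(H1 has_real_derivative H2 s) (at s)" if "0 \<le> s" for s
  proof -
    have 1: "((\<lambda>s. 1 / (2 * (1 + s))) has_real_derivative - 1 / (2 * (1 + s)\<^sup>2)) (at s)"
    proof -
      have "((\<lambda>s. 1 / 2 * inverse (1 + s)) has_real_derivative 1 / 2 * (- (inverse (1 + s) * 1 * inverse (1 + s)))) (at s)"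
        by (intro DERIV_cmult DERIV_inverse') (use that in \<open>auto intro!: derivative_eq_intros\<close>)
      moreover have "1 / 2 * (- (inverse (1 + s) * 1 * inverse (1 + s))) = - 1 / (2 * (1 + s)\<^sup>2)"
        by (simp add: inverse_eq_divide power2_eq_square)
      ultimately have "((\<lambda>s. 1 / 2 * inverse (1 + s)) has_real_derivative - 1 / (2 * (1 + s)\<^sup>2)) (at s)"
        by (rule DERIV_cong)
      then show ?thesis by (simp add: inverse_eq_divide)
    qed
    have "((\<lambda>s. (1 + s) powr (- a - 1)) has_real_derivative (- a - 1) * (1 + s) powr (- a - 1 - 1) * 1) (at s)"
      by (rule DERIV_chain2[OF has_real_derivative_powr]) (use that in \<open>auto intro!: derivative_eq_intros\<close>)
    from DERIV_add[OF 1 DERIV_cmult[OF this, of a]] show ?thesis unfolding H1_def H2_def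
      by (rule DERIV_cong) (simp add: algebra_simps)
  qed
  have Hge: "1 \<le> H s" "ln (1 + s) / 2 \<le> H s" if "0 \<le> s" for s
  proof -
    have "(1 + s) powr (- a) \<le> (1 + s) powr 0" using that g by (intro powr_mono) (auto simp: a_def)
    then have "(1 + s) powr (- a) \<le> 1" using that by simp
    moreover have "0 \<le> ln (1 + s)" using that by simp
    ultimately show "1 \<le> H s" "ln (1 + s) / 2 \<le> H s" unfolding H_def by linarith+
  qed
  define G where "G = (\<lambda>x::real^2. H ((norm x)\<^sup>2))"
  have G1: "1 \<le> G x" for x unfolding G_def by (rule Hge) simp
  have Gln: "ln (norm x) \<le> G x" if "1 \<le> norm x" for x
  proof -
    have "ln ((norm x)\<^sup>2) \<le> ln (1 + (norm x)\<^sup>2)" using that by (subst ln_le_cancel_iff) (auto simp: add_pos_nonneg)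
    moreover have "ln ((norm x)\<^sup>2) = 2 * ln (norm x)" using that by (simp add: ln_realpow)
    ultimately show ?thesis using Hge(2)[of "(norm x)\<^sup>2"] by (simp add: G_def)
  qed
  have Gcont: "continuous_on S G" for S
    unfolding G_def H_def by (intro continuous_intros) (auto simp: add_pos_nonneg intro!: less_imp_neq[symmetric])
  have main: "\<exists>x. l < x \<bullet> e \<and> norm x \<le> max R0 R2 \<and> refl_diff e l x < 0"
    if e: "norm e = 1" and Kc: "K_refl_ge e l" and p: "l \<le> p \<bullet> e" "refl_diff e l p < 0" for e l p
  proof -
    define m0 where "m0 = refl_diff e l p / G p"
    have Gp: "0 < G x" for x using G1[of x] by simp
    have m0: "m0 < 0" using p Gp by (simp add: m0_def divide_neg_pos)
    \<comment> \<open>\<open>R3\<close> and \<open>R4\<close> depend on the line and on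
      \<open>p\<close> and serve only to show that the quotient attains its minimum. The final
      radius \<open>max R0 R2\<close> is independent of the line.\<close>
    obtain R3 where R3: "\<And>x. R3 \<le> norm x \<Longrightarrow> \<bar>refl_diff e l x\<bar> \<le> (- m0 / 2) * ln (norm x)"
      using refl_diff_small[OF e, of "- m0 / 2" l] m0 by auto
    define R4 where "R4 = max (max R3 1) (norm p)"
    have far: "m0 < refl_diff e l x / G x" if "R4 \<le> norm x" for x
    proof -
      have "\<bar>refl_diff e l x\<bar> \<le> (- m0 / 2) * ln (norm x)" using R3 that by (simp add: R4_def)
      also have "\<dots> \<le> (- m0 / 2) * G x" using Gln[of x] that m0 by (intro mult_left_mono) (auto simp: R4_def)
      finally have "(m0 / 2) * G x \<le> refl_diff e l x" by simp
      moreover have "m0 * G x < (m0 / 2) * G x" using m0 Gp by (intro mult_strict_right_mono) auto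
      ultimately show ?thesis using Gp by (simp add: pos_less_divide_eq)
    qed
    define D where "D = cball (0::real^2) R4 \<inter> {x. l \<le> x \<bullet> e}"
    have cD: "compact D" unfolding D_def
      by (intro compact_Int_closed compact_cball closed_Collect_le continuous_intros)
    have pD: "p \<in> D" using p by (auto simp: D_def R4_def)
    have "\<exists>x\<in>D. \<forall>y\<in>D. refl_diff e l x / G x \<le> refl_diff e l y / G y"
      using pD Gp by (intro continuous_attains_inf cD continuous_intros Gcont) (auto simp: less_imp_neq[symmetric])
    then obtain x where xD: "x \<in> D" and xmin: "\<And>y. y \<in> D \<Longrightarrow> refl_diff e l x / G x \<le> refl_diff e l y / G y" by blast
    define m where "m = refl_diff e l x / G x"
    have mm0: "m \<le> m0" using xmin[OF pD] by (simp add: m_def m0_def)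
    with m0 have m: "m < 0" by simp
    have wx: "refl_diff e l x = m * G x" using Gp[of x] by (simp add: m_def)
    have wneg: "refl_diff e l x < 0" using wx m Gp[of x] by (simp add: mult_neg_pos)
    have all: "m * G y \<le> refl_diff e l y" if "l \<le> y \<bullet> e" for y
    proof -
      have "m \<le> refl_diff e l y / G y"
      proof (cases "norm y \<le> R4")
        case True
        then show ?thesis unfolding m_def using that by (intro xmin) (auto simp: D_def)
      next
        case False
        then show ?thesis using far[of y] mm0 by simp
      qed
      then show ?thesis using Gp[of y] by (simp add: pos_le_divide_eq)
    qed
    have xl: "l < x \<bullet> e"
      using xD wneg refl_diff_zero[of x e l] by (cases "x \<bullet> e = l") (auto simp: D_def)
    have "norm x \<le> max R0 R2"
    proof (rule ccontr)
      assume nx: "\<not> norm x \<le> max R0 R2"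
      then have n: "R0 \<le> norm x" "R2 \<le> norm x" "1 \<le> norm x" using R2 by auto
      define s where "s = (norm x)\<^sup>2"
      have "norm x * 1 \<le> norm x * norm x" using n by (intro mult_left_mono) auto
      then have s: "R2 \<le> s" "0 \<le> s" using n by (auto simp: s_def power2_eq_square)
      have d0: "0 < x \<bullet> e - l" using xl by simp
      \<comment> \<open>At the minimum \<open>m\<close> of the quotient, the reflected difference
        minus \<open>m * G\<close> is nonnegative on the half plane and zero at \<open>x\<close>;
        the radius \<open>x \<bullet> e - l\<close> keeps the comparison in the half plane.\<close>
      have "4 * (m * H1 ((norm (x - 0))\<^sup>2)) + 4 * (norm (x - 0))\<^sup>2 * (m * H2 ((norm (x - 0))\<^sup>2))
        \<le> laplacian u (reflect e l x) - laplacian u x"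
      proof (rule refl_diff_comparison[OF e _ _ d0, where H="\<lambda>s. m * H s"])
        show "((\<lambda>s. m * H s) has_real_derivative m * H1 s) (at s)" if "0 \<le> s" for s by (intro DERIV_cmult dH1 that)
        show "((\<lambda>s. m * H1 s) has_real_derivative m * H2 s) (at s)" if "0 \<le> s" for s by (intro DERIV_cmult dH2 that)
        fix y assume "dist y x < x \<bullet> e - l"
        moreover have "\<bar>y \<bullet> e - x \<bullet> e\<bar> \<le> dist y x"
          using Cauchy_Schwarz_ineq2[of "y - x" e] e by (simp add: dist_norm inner_diff_left)
        ultimately have "l \<le> y \<bullet> e" by linarith
        from all[OF this] show "refl_diff e l x - m * H ((norm (x - 0))\<^sup>2) \<le> refl_diff e l y - m * H ((norm (y - 0))\<^sup>2)"
          using wx by (simp add: G_def)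
      qed
      then have "m * (4 * H1 s + 4 * s * H2 s) \<le> laplacian u (reflect e l x) - laplacian u x"
        by (simp add: s_def algebra_simps)
      also have "\<dots> \<le> K x * (exp (2 * u x) - exp (2 * u (reflect e l x)))"
        by (rule laplacian_refl_diff_le[OF Kc]) (use xl in simp)
      also have "\<dots> \<le> - m * (2 * A * s powr (- 1 - \<gamma> / 2) * H s)"
      proof -
        have ed: "0 \<le> exp (2 * u x) - exp (2 * u (reflect e l x))" using wneg by (simp add: refl_diff_def)
        have "K x * (exp (2 * u x) - exp (2 * u (reflect e l x))) \<le> \<bar>K x\<bar> * (exp (2 * u x) - exp (2 * u (reflect e l x)))"
          using ed by (intro mult_right_mono) auto
        also have "\<dots> \<le> \<bar>K x\<bar> * (2 * exp (2 * u x) * (- refl_diff e l x))"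
          using exp_diff_le[of "u x" "u (reflect e l x)"] by (intro mult_left_mono) (auto simp: refl_diff_def)
        also have "\<dots> = 2 * (\<bar>K x\<bar> * exp (2 * u x)) * (- refl_diff e l x)" by simp
        also have "\<dots> \<le> 2 * (A * s powr (- 1 - \<gamma> / 2)) * (- refl_diff e l x)"
        proof (intro mult_right_mono mult_left_mono)
          have "\<bar>K x\<bar> * exp (2 * u x) \<le> A * norm x powr (- 2 - \<gamma>0)" by (rule dec[OF n(1)])
          also have "\<dots> \<le> A * norm x powr (- 2 - \<gamma>)" using A n by (intro mult_left_mono powr_mono) (auto simp: \<gamma>_def)
          also have "norm x powr (- 2 - \<gamma>) = s powr (- 1 - \<gamma> / 2)"
          proof -
            have "s = norm x powr 2" using n by (simp add: s_def)
            then have "s powr (- 1 - \<gamma> / 2) = (norm x powr 2) powr (- 1 - \<gamma> / 2)" by (simp only:)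
            also have "\<dots> = norm x powr (2 * (- 1 - \<gamma> / 2))" by (rule powr_powr)
            also have "2 * (- 1 - \<gamma> / 2) = - 2 - \<gamma>" by simp
            finally show ?thesis by simp
          qed
          finally show "\<bar>K x\<bar> * exp (2 * u x) \<le> A * s powr (- 1 - \<gamma> / 2)" .
        qed (use wneg in auto)
        also have "\<dots> = - m * (2 * A * s powr (- 1 - \<gamma> / 2) * H s)" by (simp add: wx G_def s_def)
        finally show ?thesis .
      qed
      finally have "- m * (- (4 * H1 s + 4 * s * H2 s)) \<le> - m * (2 * A * s powr (- 1 - \<gamma> / 2) * H s)"
        by (simp only: minus_mult_minus)
      then have "- (4 * H1 s + 4 * s * H2 s) \<le> 2 * A * s powr (- 1 - \<gamma> / 2) * H s"
        using m by (subst (asm) mult_le_cancel_left_pos) auto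
      with sup[OF s(1)] show False by simp
    qed
    with xl wneg show ?thesis by blast
  qed
  show ?thesis by (rule exI[of _ "max R0 R2"]) (use main in blast)
qed

end

section \<open>The moving plane argument\<close>

lemma reflect_line:
  assumes "norm e = 1"
  shows "reflect e l (x + t *\<^sub>R e) = x + (2 * (l - x \<bullet> e) - t) *\<^sub>R e"
proof -
  have "reflect e l (x + t *\<^sub>R e) = x + (t + 2 * (l - (x \<bullet> e + t))) *\<^sub>R e"
    using assms by (simp only: reflect_def inner_add_left inner_scaleR_left inner_self_unit mult_1_right scaleR_add_left add.assoc)
  also have "t + 2 * (l - (x \<bullet> e + t)) = 2 * (l - x \<bullet> e) - t" by simp
  finally show ?thesis .
qed

text \<open>For \<open>y\<close> strictly closer to \<open>xs\<close>, the reflection that exchanges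
  \<open>x\<close> and \<open>y\<close> has \<open>xs\<close> strictly on the side of
  \<open>y\<close>, so the hypothesis applies to it.\<close>

lemma radially_nonincreasing_of_reflections:
  assumes cont: "continuous_on UNIV (u :: real^2 \<Rightarrow> real)"
    and reflect: "\<And>e l x. norm e = 1 \<Longrightarrow> xs \<bullet> e < l \<Longrightarrow> l \<le> x \<bullet> e \<Longrightarrow> u x \<le> u (reflect e l x)"
    and le: "norm (y - xs) \<le> norm (x - xs)"
  shows "u x \<le> u y"
proof -
  have strict: "u x \<le> u y" if lt: "norm (y - xs) < norm (x - xs)" for x y
  proof -
    define e where "e = (1 / norm (x - y)) *\<^sub>R (x - y)"
    define l where "l = (1 / 2) * ((x + y) \<bullet> e)"
    have n0: "0 < norm (x - y)" using lt by auto
    have e: "norm e = 1" using n0 by (simp add: e_def)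
    have xy: "x - y = norm (x - y) *\<^sub>R e" using n0 by (simp add: e_def)
    have d: "(x - y) \<bullet> e = norm (x - y)" by (subst xy) (simp add: inner_self_unit e)
    have r: "reflect e l x = y"
    proof -
      have "2 * (l - x \<bullet> e) = - norm (x - y)" using d by (simp add: l_def inner_add_left inner_diff_left)
      then have "reflect e l x = x - norm (x - y) *\<^sub>R e" by (simp add: reflect_def)
      then show ?thesis using xy by (metis add_diff_cancel_left' diff_add_cancel diff_diff_eq2)
    qed
    have "x \<bullet> e - y \<bullet> e = norm (x - y)" using d by (simp add: inner_diff_left)
    with n0 have "y \<bullet> e < x \<bullet> e" by linarith
    then have xl: "l \<le> x \<bullet> e" by (simp add: l_def inner_add_left)
    have "(norm (y - xs))\<^sup>2 < (norm (x - xs))\<^sup>2" using lt by (intro power_strict_mono) auto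
    then have "(y - xs) \<bullet> (y - xs) < (x - xs) \<bullet> (x - xs)" by (simp add: power2_norm_eq_inner)
    then have "0 < (x - y) \<bullet> (x + y - 2 *\<^sub>R xs)"
      by (simp add: inner_add_left inner_add_right inner_diff_left inner_diff_right inner_commute algebra_simps)
    also have "(x - y) \<bullet> (x + y - 2 *\<^sub>R xs) = norm (x - y) * (2 * (l - xs \<bullet> e))"
      by (subst xy) (simp add: l_def inner_add_right inner_diff_right inner_commute algebra_simps)
    finally have "xs \<bullet> e < l" using n0 by (simp add: zero_less_mult_iff)
    from reflect[OF e this xl] show ?thesis by (simp add: r)
  qed
  show ?thesis
  proof (cases "norm (y - xs) < norm (x - xs)")
    case False
    with le have eq: "norm (y - xs) = norm (x - xs)" by simp
    show ?thesis
    proof (cases "x = xs")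
      case True
      with eq show ?thesis by simp
    next
      case False
      \<comment> \<open>Equal distances are reached by approaching \<open>x\<close> along the ray
        from outside, where the strict case holds.\<close>
      let ?X = "\<lambda>n::nat. x + (1 / real (Suc n)) *\<^sub>R (x - xs)"
      have "?X \<longlonglongrightarrow> x + 0 *\<^sub>R (x - xs)"
        by (intro tendsto_intros LIMSEQ_Suc[OF lim_1_over_n])
      then have X: "?X \<longlonglongrightarrow> x" by simp
      have "(\<lambda>n. u (?X n)) \<longlonglongrightarrow> u x"
        by (rule continuous_on_tendsto_compose[OF cont X]) auto
      moreover have "u (?X n) \<le> u y" for n
      proof (rule strict)
        have "?X n - xs = (1 + 1 / real (Suc n)) *\<^sub>R (x - xs)" by (simp add: algebra_simps)
        then have "norm (?X n - xs) = (1 + 1 / real (Suc n)) * norm (x - xs)" by simp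
        moreover have "1 * norm (x - xs) < (1 + 1 / real (Suc n)) * norm (x - xs)"
          using False by (intro mult_strict_right_mono) auto
        ultimately show "norm (y - xs) < norm (?X n - xs)" using eq by simp
      qed
      ultimately show ?thesis by (intro LIMSEQ_le_const2) auto
    qed
  qed (rule strict)
qed

context moving_planes
begin

lemma symmetric_everywhere:
  assumes e: "norm e = 1" and z: "\<And>x. l < x \<bullet> e \<Longrightarrow> refl_diff e l x = 0"
  shows "refl_diff e l x = 0"
proof -
  consider "l < x \<bullet> e" | "x \<bullet> e = l" | "l < reflect e l x \<bullet> e" by (fastforce simp: reflect_inner[OF e])
  then show ?thesis using z[of x] z[of "reflect e l x"] by cases (auto simp: refl_diff_zero refl_diff_reflect[OF e])
qed

text \<open>\<open>refl_diff_comparison\<close> with the zero function gives one inequality between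
  the Laplacians and, at the mirror point, the reverse; the equation can then be divided by the
  common exponential.\<close>

lemma K_symmetric:
  assumes e: "norm e = 1" and z: "\<And>x. refl_diff e l x = 0"
  shows "K (reflect e l x) = K x"
proof -
  have 1: "0 \<le> laplacian u (reflect e l x) - laplacian u x" for x
    using refl_diff_comparison[OF e, of "\<lambda>_. 0" "\<lambda>_. 0" "\<lambda>_. 0" 1 x l 0] by (simp add: z)
  have "laplacian u (reflect e l x) = laplacian u x" using 1[of x] 1[of "reflect e l x"] by (simp add: reflect_reflect e)
  moreover have "u (reflect e l x) = u x" using z[of x] by (simp add: refl_diff_def)
  ultimately show ?thesis by (simp add: pde)
qed

end

context liouville_mono
begin

lemma K_refl_ge_nonneg: "norm e = 1 \<Longrightarrow> 0 \<le> l \<Longrightarrow> K_refl_ge e l"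
  unfolding K_refl_ge_def using norm_reflect_le K_mono by blast

text \<open>All lines beyond \<open>l\<close> are included, so goodness passes to larger
  \<open>l\<close> and the good positions have a critical infimum.\<close>

definition good :: "real^2 \<Rightarrow> real \<Rightarrow> bool" where
  "good e l \<longleftrightarrow> (\<forall>\<mu>\<ge>l. \<forall>x. \<mu> \<le> x \<bullet> e \<longrightarrow> 0 \<le> refl_diff e \<mu> x)"

lemma goodD: "good e l \<Longrightarrow> l \<le> \<mu> \<Longrightarrow> \<mu> \<le> x \<bullet> e \<Longrightarrow> 0 \<le> refl_diff e \<mu> x"
  by (auto simp: good_def)

text \<open>The line starts beyond the uniform radius of \<open>negative_min_bounded\<close> and
  moves inwards. \<open>L\<close> marks how far the monotonicity of \<open>K\<close> permits this: 0
  for general \<open>K\<close>, arbitrary for constant \<open>K\<close>. At the infimum of good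
  positions, failure of symmetry gives strict positivity, and the negative points just below it form
  a sequence excluded by \<open>no_bad_sequence\<close>.\<close>

theorem moving_plane_dichotomy:
  assumes e: "norm e = 1" and Kc: "\<And>l. L < l \<Longrightarrow> K_refl_ge e l"
    and bad: "L < l1" "\<not> good e l1"
  shows "\<exists>l>L. good e l \<and> (\<forall>x. refl_diff e l x = 0)"
proof (rule ccontr)
  assume nosym: "\<not> (\<exists>l>L. good e l \<and> (\<forall>x. refl_diff e l x = 0))"
  obtain R where R: "\<And>l x. K_refl_ge e l \<Longrightarrow> l \<le> x \<bullet> e \<Longrightarrow> refl_diff e l x < 0 \<Longrightarrow>
      \<exists>x. l < x \<bullet> e \<and> norm x \<le> R \<and> refl_diff e l x < 0"
    using negative_min_bounded e by blast
  have start: "good e l" if l: "R \<le> l" "L < l" for l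
    unfolding good_def
  proof (intro allI impI, rule ccontr)
    fix \<mu> x assume mu: "l \<le> \<mu>" "\<mu> \<le> x \<bullet> e" and "\<not> 0 \<le> refl_diff e \<mu> x"
    then obtain y where y: "\<mu> < y \<bullet> e" "norm y \<le> R" using R[OF Kc, of \<mu> x] l by auto
    have "y \<bullet> e \<le> norm y" using Cauchy_Schwarz_ineq2[of y e] e by simp
    with y mu l show False by simp
  qed
  define G where "G = {l. L < l \<and> good e l}"
  have up: "good e b" if "good e a" "a \<le> b" for a b using that by (auto simp: good_def)
  have lb: "l1 < a" if "a \<in> G" for a using up[of a l1] that bad by (force simp: G_def not_le[symmetric])
  have "max R (L + 1) \<in> G" using start[of "max R (L + 1)"] by (simp add: G_def less_max_iff_disj)
  then have Gne: "G \<noteq> {}" by blast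
  have bdd: "bdd_below G" using lb by (meson bdd_belowI less_imp_le)
  define l0 where "l0 = Inf G"
  have l0: "l1 \<le> l0" unfolding l0_def using Gne lb by (intro cInf_greatest) (auto intro: less_imp_le)
  then have Ll0: "L < l0" using bad by simp
  have above: "good e b" if l0b: "l0 < b" for b
  proof -
    obtain a where "a \<in> G" "a < b" using cInf_lessD[OF Gne l0b[unfolded l0_def]] by blast
    then show ?thesis using up[of a b] by (simp add: G_def)
  qed
  have w0: "0 \<le> refl_diff e l0 x" if x: "l0 \<le> x \<bullet> e" for x
  proof (cases "x \<bullet> e = l0")
    case False
    with x have lt: "l0 < x \<bullet> e" by simp
    have "continuous_on UNIV (\<lambda>l. refl_diff e l x)" by (intro continuous_intros)
    then have "isCont (\<lambda>l. refl_diff e l x) l0" by (simp add: continuous_on_eq_continuous_at)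
    then have "((\<lambda>l. refl_diff e l x) \<longlongrightarrow> refl_diff e l0 x) (at_right l0)" by (simp add: isCont_def filterlim_at_split)
    moreover have "\<forall>\<^sub>F l in at_right l0. 0 \<le> refl_diff e l x"
      using eventually_at_right_real[OF lt]
      by eventually_elim (auto intro!: goodD[OF above])
    ultimately show ?thesis by (rule tendsto_lowerbound) simp
  qed (simp add: refl_diff_zero)
  have good0: "good e l0" unfolding good_def
  proof (intro allI impI)
    fix \<mu> x assume "l0 \<le> \<mu>" "\<mu> \<le> x \<bullet> e"
    then show "0 \<le> refl_diff e \<mu> x" using w0 goodD[OF above, of \<mu> \<mu> x] by (cases "\<mu> = l0") auto
  qed
  have "\<not> (\<forall>x. refl_diff e l0 x = 0)" using nosym good0 Ll0 by blast
  then obtain p where p: "l0 < p \<bullet> e" "refl_diff e l0 p \<noteq> 0" using symmetric_everywhere[OF e, of l0] by blast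
  then have wp: "0 < refl_diff e l0 p" using w0[of p] by simp
  have pos: "0 < refl_diff e l0 x" if "l0 < x \<bullet> e" for x
    by (rule strong_maximum_principle[OF e Kc[OF Ll0] _ p(1) wp that]) (rule w0)
  \<comment> \<open>The denominator starts at 2 rather than 1, so that already for
    \<open>n = 0\<close> the position is strictly above \<open>L\<close>.\<close>
  have "\<exists>\<mu> x. l0 - (l0 - L) / (real n + 2) \<le> \<mu> \<and> \<mu> \<le> l0 \<and> \<mu> < x \<bullet> e \<and> norm x \<le> R \<and> refl_diff e \<mu> x < 0" for n :: nat
  proof -
    let ?b = "l0 - (l0 - L) / (real n + 2)"
    define t where "t = (l0 - L) / (real n + 2)"
    have "t < (l0 - L) / 1" unfolding t_def using Ll0 by (intro divide_strict_left_mono) auto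
    moreover have "0 < t" using Ll0 by (simp add: t_def)
    ultimately have "L < l0 - t" "l0 - t < l0" by simp_all
    then have b: "L < ?b" "?b < l0" by (simp_all only: t_def)
    have "?b \<notin> G" using cInf_lower[OF _ bdd, of ?b] b(2) by (auto simp: l0_def)
    then have "\<not> good e ?b" using b(1) by (simp add: G_def)
    then obtain \<mu> x where mu: "?b \<le> \<mu>" "\<mu> \<le> x \<bullet> e" "refl_diff e \<mu> x < 0" unfolding good_def by (auto simp: not_le)
    have "\<mu> \<le> l0" using goodD[OF above, of \<mu> \<mu> x] mu by (cases "l0 < \<mu>") auto
    moreover have "L < \<mu>" using b mu by simp
    ultimately show ?thesis using R[OF Kc mu(2,3)] mu(1) by blast
  qed
  then obtain \<mu> X where 1: "\<And>n. l0 - (l0 - L) / (real n + 2) \<le> \<mu> n" "\<And>n. \<mu> n \<le> l0" "\<And>n. \<mu> n < X n \<bullet> e"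
     "\<And>n. norm (X n) \<le> R" "\<And>n. refl_diff e (\<mu> n) (X n) < 0" by metis
  have "(\<lambda>n. l0 - (l0 - L) / (real n + 2)) \<longlonglongrightarrow> l0" by real_asymp
  then have "\<mu> \<longlonglongrightarrow> l0"
    by (rule tendsto_sandwich[OF always_eventually always_eventually _ tendsto_const, rotated 2]) (intro allI 1)+
  from no_bad_sequence[OF e Kc[OF Ll0] pos this 1(3-5)] show False by simp
qed

text \<open>\<open>K\<close> is radial, so the sign change along the axis followed by the reflection
  acts as the translation by 2l and leaves the values of \<open>K\<close> unchanged. The value at
  the origin thus recurs arbitrarily far out, and monotonicity fixes everything between.\<close>

lemma K_constant_of_symmetric:
  assumes e: "norm e = 1" and l: "0 < l" and sym: "\<And>x. K (reflect e l x) = K x"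
  shows "\<exists>c. \<forall>x. K x = c"
proof -
  have rad: "K x = K y" if "norm x = norm y" for x y using K_mono[of x y] K_mono[of y x] that by simp
  have step: "K ((2 * l * real n) *\<^sub>R e) = K 0" for n
  proof (induction n)
    case (Suc n)
    have "reflect e l ((- (2 * l * real n)) *\<^sub>R e) = (2 * l * real (Suc n)) *\<^sub>R e"
      using reflect_line[OF e, of l 0 "- (2 * l * real n)"] by (simp add: distrib_left add.commute)
    then have "K ((2 * l * real (Suc n)) *\<^sub>R e) = K ((- (2 * l * real n)) *\<^sub>R e)" using sym by metis
    also have "\<dots> = K ((2 * l * real n) *\<^sub>R e)" by (rule rad) simp
    finally show ?case using Suc by simp
  qed simp
  have "K x = K 0" for x
  proof -
    obtain n :: nat where n: "norm x / (2 * l) \<le> real n" using real_arch_simple by blast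
    then have "norm x \<le> 2 * l * real n" using l by (simp add: pos_divide_le_eq mult.commute)
    then have "K ((2 * l * real n) *\<^sub>R e) \<le> K x" using e l by (intro K_mono) simp
    moreover have "K x \<le> K 0" by (rule K_mono) simp
    ultimately show ?thesis using step[of n] by simp
  qed
  then show ?thesis by blast
qed

lemma radial_about_origin:
  assumes nc: "\<nexists>c. \<forall>x. K x = c" and le: "norm y \<le> norm x"
  shows "u x \<le> u y"
proof (rule radially_nonincreasing_of_reflections[of u 0])
  show "continuous_on UNIV u" by (rule cont_u)
  show "u x \<le> u (reflect e l x)" if e: "norm e = 1" and l: "0 \<bullet> e < l" "l \<le> x \<bullet> e" for e l x
  proof (rule ccontr)
    assume "\<not> ?thesis"
    then have "\<not> good e l" using l goodD[of e l l x] by (auto simp: refl_diff_def)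
    then obtain l' where "0 < l'" "\<And>x. refl_diff e l' x = 0"
      using moving_plane_dichotomy[OF e, of 0 l] K_refl_ge_nonneg[OF e] l by (metis inner_zero_left less_imp_le)
    with K_constant_of_symmetric[OF e, of l'] K_symmetric[OF e] nc show False by blast
  qed
qed (use le in simp)

text \<open>For constant \<open>K\<close> the line may travel without limit, but it must stop:
  otherwise \<open>u 0\<close> would be at most the value at arbitrarily distant points, while
  \<open>u\<close> tends to minus infinity. Two orthogonal symmetry lines give symmetry about the
  point \<open>xs\<close>.\<close>

lemma radial_of_constant:
  assumes c: "\<And>x. K x = c"
  shows "\<exists>xs. \<forall>x y. norm (y - xs) \<le> norm (x - xs) \<longrightarrow> u x \<le> u y"
proof -
  have Kc: "K_refl_ge e l" for e l by (simp add: K_refl_ge_def c)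
  have ex: "\<exists>l. good e l \<and> (\<forall>x. refl_diff e l x = 0)" if e: "norm e = 1" for e
  proof (rule ccontr)
    assume no: "\<not> ?thesis"
    have good: "good e l" for l
      using moving_plane_dichotomy[OF e Kc, of "l - 1" l] no by auto
    obtain R where R: "\<And>x. R \<le> norm x \<Longrightarrow> u x < u 0" using u_tendsto_minus_infinity[of "u 0"] by blast
    have "0 \<le> refl_diff e (- \<bar>R\<bar>) 0" by (rule goodD[OF good, of _ "- \<bar>R\<bar>"]) auto
    then have "u 0 \<le> u ((- (2 * \<bar>R\<bar>)) *\<^sub>R e)" by (simp add: refl_diff_def reflect_def)
    moreover have "R \<le> norm ((- (2 * \<bar>R\<bar>)) *\<^sub>R e)" using e by simp
    ultimately show False using R[of "(- (2 * \<bar>R\<bar>)) *\<^sub>R e"] by simp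
  qed
  have ne: "norm e1 = 1" "norm e2 = 1" by simp_all
  obtain l1 where l1: "\<And>x. refl_diff e1 l1 x = 0" using ex[OF ne(1)] by blast
  obtain l2 where l2: "\<And>x. refl_diff e2 l2 x = 0" using ex[OF ne(2)] by blast
  define xs :: "real^2" where "xs = l1 *\<^sub>R e1 + l2 *\<^sub>R e2"
  have point: "u (2 *\<^sub>R xs - x) = u x" for x
  proof -
    have "reflect e1 l1 (reflect e2 l2 x) = 2 *\<^sub>R xs - x"
      by (simp add: vec2_eq_iff reflect_def xs_def inner2 axis_def)
    then show ?thesis using l1[of "reflect e2 l2 x"] l2[of x] by (simp add: refl_diff_def)
  qed
  \<comment> \<open>If the line missed \<open>xs\<close>, its reflection composed with the point
    reflection would be a translation, and \<open>u\<close> would be periodic on the line through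
    \<open>xs\<close> in direction \<open>e\<close>, against its decay. One inequality suffices,
    since goodness passes to larger \<open>l\<close>.\<close>
  have le: "l \<le> xs \<bullet> e" if e: "norm e = 1" and sym: "\<And>x. refl_diff e l x = 0" for e l
  proof (rule ccontr)
    assume "\<not> l \<le> xs \<bullet> e"
    define \<delta> where "\<delta> = l - xs \<bullet> e"
    have d: "0 < \<delta>" using \<open>\<not> l \<le> xs \<bullet> e\<close> by (simp add: \<delta>_def)
    define v where "v = (\<lambda>t. u (xs + t *\<^sub>R e))"
    have v1: "v (- t) = v t" for t
    proof -
      have "2 *\<^sub>R xs - (xs + t *\<^sub>R e) = xs + (- t) *\<^sub>R e" by (simp add: scaleR_2)
      then show ?thesis using point[of "xs + t *\<^sub>R e"] by (simp add: v_def)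
    qed
    have v2: "v (2 * \<delta> - t) = v t" for t
    proof -
      have "reflect e l (xs + t *\<^sub>R e) = xs + (2 * \<delta> - t) *\<^sub>R e"
        using reflect_line[OF e] by (simp add: \<delta>_def)
      then show ?thesis using sym[of "xs + t *\<^sub>R e"] by (simp add: v_def refl_diff_def)
    qed
    have v3: "v (2 * \<delta> * real n) = v 0" for n
    proof (induction n)
      case (Suc n)
      have "v (2 * \<delta> * real (Suc n)) = v (2 * \<delta> - 2 * \<delta> * real (Suc n))" by (simp add: v2)
      also have "2 * \<delta> - 2 * \<delta> * real (Suc n) = - (2 * \<delta> * real n)" by (simp add: algebra_simps)
      finally show ?case using Suc v1[of "2 * \<delta> * real n"] by simp
    qed simp
    obtain R where R: "\<And>x. R \<le> norm x \<Longrightarrow> u x < u xs" using u_tendsto_minus_infinity[of "u xs"] by blast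
    obtain n :: nat where "(R + norm xs) / (2 * \<delta>) \<le> real n" using real_arch_simple by blast
    then have n: "R + norm xs \<le> 2 * \<delta> * real n" using d by (simp add: pos_divide_le_eq mult.commute)
    have "norm ((2 * \<delta> * real n) *\<^sub>R e) \<le> norm (xs + (2 * \<delta> * real n) *\<^sub>R e) + norm xs"
      using norm_triangle_ineq4[of "xs + (2 * \<delta> * real n) *\<^sub>R e" xs] by simp
    then have "R \<le> norm (xs + (2 * \<delta> * real n) *\<^sub>R e)" using n e d by simp
    then have "v (2 * \<delta> * real n) < v 0" using R by (simp add: v_def)
    with v3[of n] show False by simp
  qed
  have "u x \<le> u y" if "norm (y - xs) \<le> norm (x - xs)" for x y
  proof (rule radially_nonincreasing_of_reflections[OF cont_u _ that])
    fix e l x assume e: "norm e = 1" and l: "xs \<bullet> e < l" "l \<le> x \<bullet> e"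
    obtain l' where l': "good e l'" "\<And>x. refl_diff e l' x = 0" using ex[OF e] by blast
    have "0 \<le> refl_diff e l x" using le[OF e l'(2)] l by (intro goodD[OF l'(1)]) auto
    then show "u x \<le> u (reflect e l x)" by (simp add: refl_diff_def)
  qed
  then show ?thesis by blast
qed

end

lemma holder_loc_continuous:
  assumes "holder_loc \<alpha> K" "0 < \<alpha>"
  shows "continuous_on UNIV K"
proof -
  have "isCont K x" for x
  proof -
    define R where "R = norm x + 1"
    obtain C where C: "\<And>a b. a \<in> cball 0 R \<Longrightarrow> b \<in> cball 0 R \<Longrightarrow> \<bar>K a - K b\<bar> \<le> C * dist a b powr \<alpha>"
      using assms(1) unfolding holder_loc_def by metis
    have "((\<lambda>y. C * dist y x powr \<alpha>) \<longlongrightarrow> C * 0 powr \<alpha>) (at x)"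
      by (intro tendsto_mult tendsto_const tendsto_powr' tendsto_dist_iff[THEN iffD1] tendsto_ident_at) (use assms(2) in auto)
    then have lim: "((\<lambda>y. C * dist y x powr \<alpha>) \<longlongrightarrow> 0) (at x)" using assms(2) by simp
    have "\<forall>\<^sub>F y in at x. dist (K y) (K x) \<le> C * dist y x powr \<alpha>"
      unfolding eventually_at
    proof (intro exI[of _ 1] conjI ballI impI)
      fix y assume "y \<noteq> x \<and> dist y x < 1"
      then have "norm y \<le> R" using norm_triangle_ineq[of "y - x" x] by (simp add: R_def dist_norm)
      then show "dist (K y) (K x) \<le> C * dist y x powr \<alpha>" using C[of y x] by (simp add: R_def dist_real_def)
    qed simp
    then have "((\<lambda>y. dist (K y) (K x)) \<longlongrightarrow> 0) (at x)"
      by (intro tendsto_sandwich[OF _ _ tendsto_const lim]) auto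
    then show ?thesis by (simp add: isCont_def tendsto_dist_iff[symmetric])
  qed
  then show ?thesis by (simp add: continuous_at_imp_continuous_on)
qed

text \<open>The strict inequality leaves room for an admissible exponent even if the infimum is not
  attained. Arguing by contradiction, with multiplication by pi, also covers the empty set, whose
  infimum is infinite.\<close>

lemma kappa_star_lessE:
  assumes "kappa_star K < ereal m"
  obtains q where "0 < q" "integrable lborel (\<lambda>x. \<bar>K x\<bar> * (1 + norm x) powr (- q))" "pi * q < m"
proof -
  let ?S = "{ereal q | q. q > 0 \<and> integrable lborel (\<lambda>x. \<bar>K x\<bar> * (1 + norm x) powr (- q))}"
  have "Inf ?S < ereal (m / pi)"
  proof (rule ccontr)
    assume "\<not> Inf ?S < ereal (m / pi)"
    then have "ereal (m / pi) \<le> Inf ?S" by simp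
    then have "ereal pi * ereal (m / pi) \<le> ereal pi * Inf ?S" by (intro ereal_mult_left_mono) auto
    then show False using assms unfolding kappa_star_def by simp
  qed
  then obtain s where "s \<in> ?S" "s < ereal (m / pi)" using Inf_less_iff by blast
  then obtain q where "q > 0" "integrable lborel (\<lambda>x. \<bar>K x\<bar> * (1 + norm x) powr (- q))" "q < m / pi" by auto
  then show ?thesis by (intro that[of q]) (auto simp: field_simps)
qed

theorem theorem3p6:
  fixes K u :: "real^2 \<Rightarrow> real" and \<alpha> :: real
  assumes alpha: "0 < \<alpha>" "\<alpha> < 1"
    and K_holder: "holder_loc \<alpha> K"
    and K_mono: "\<And>x y. norm x \<ge> norm y \<Longrightarrow> K x \<le> K y"
    and K_growth: "\<not> bdd_below (range K) \<Longrightarrow>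
       (\<exists>C>0. \<exists>R0. \<forall>x. norm x \<ge> R0 \<longrightarrow> \<bar>K x\<bar> \<le> C * (INF y\<in>ball x 1. \<bar>K y\<bar>))
     \<or> (\<exists>P\<ge>1. \<exists>C>0. \<exists>R0. \<forall>x. norm x \<ge> R0 \<longrightarrow> \<bar>K x\<bar> \<le> C * \<bar>ln (norm x)\<bar> powr P)"
    and u_C2: "C2 u"
    and u_eq: "\<And>x. laplacian u x + K x * exp (2 * u x) = 0"
    and u_int: "integrable lborel (\<lambda>x. \<bar>K x\<bar> * exp (2 * u x))"
    and u_plus: "\<And>R. R > 0 \<Longrightarrow>
       bdd_above ((\<lambda>y. LINT x:ball y R|lborel. max (u x) 0) ` UNIV)"
    and u_mass: "ereal (LINT x|lborel. K x * exp (2 * u x)) > kappa_star K"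
  shows "\<exists>xs. (\<forall>x y. norm (x - xs) \<ge> norm (y - xs) \<longrightarrow> u x \<le> u y)
            \<and> ((\<nexists>c. \<forall>x. K x = c) \<longrightarrow> xs = 0)"
proof -
  obtain Du D2u where "C2_plane u Du D2u" using C2_planeE[OF u_C2] .
  then interpret C2_plane u Du D2u .
  obtain B where B: "\<And>y. (LINT x:ball y 1|lborel. max (u x) 0) \<le> B"
    using u_plus[of 1] by (auto simp: bdd_above_def)
  obtain q where q: "0 < q" "integrable lborel (\<lambda>x. \<bar>K x\<bar> * (1 + norm x) powr (- q))"
      "pi * q < (LINT x|lborel. K x * exp (2 * u x))"
    using kappa_star_lessE[OF u_mass] by blast
  have K_cont: "continuous_on UNIV K" by (rule holder_loc_continuous[OF K_holder alpha(1)])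
  have meas: "(\<lambda>x. K x * exp (2 * u x)) \<in> borel_measurable lborel"
    using borel_measurable_continuous_onI[OF continuous_on_mult[OF K_cont continuous_on_exp[OF continuous_on_mult[OF continuous_on_const cont_u]]]] by simp
  have int: "integrable lborel (\<lambda>x. K x * exp (2 * u x))"
    by (rule Bochner_Integration.integrable_bound[OF u_int meas]) (auto simp: abs_mult)
  interpret liouville_mono u Du D2u K "\<lambda>x. K x * exp (2 * u x)" B q
    by unfold_locales (use K_cont u_eq int B K_mono q in \<open>auto simp: eq_neg_iff_add_eq_0\<close>)
  show ?thesis
  proof (cases "\<exists>c. \<forall>x. K x = c")
    case True
    then show ?thesis using radial_of_constant by blast
  next
    case False
    then show ?thesis using radial_about_origin[OF False] by (intro exI[of _ 0]) auto
  qed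
qed

end
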